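(* Let $n\ge 3$ be an integer, $\gamma\in(1,2]$, $\beta>0$ with $\beta\gamma<n$, $q\ge p>1$, and $-\beta\gamma<\sigma_1\le\sigma_2\le 0$. Let $c_1,c_2:\mathbb{R}^n\to(0,\infty)$ be double bounded, and assume the non-subcritical condition $$\frac{n+\sigma_1}{\gamma-1+q}+\frac{n+\sigma_2}{\gamma-1+p}\le\frac{n-\beta\gamma}{\gamma-1}.$$ If $(u,v)$ is a positive integrable solution of the integral system $$u(x)=c_1(x)W_{\beta,\gamma}(|y|^{\sigma_1}v^q)(x),\qquad v(x)=c_2(x)W_{\beta,\gamma}(|y|^{\sigma_2}u^p)(x),\qquad x\in\mathbb{R}^n,$$ then $(u,v)\in L^r(\mathbb{R}^n)\times L^s(\mathbb{R}^n)$ for all $r,s$ with $$\frac{n(\gamma-1)}{n-\beta\gamma}<r\le\infty\quad\text{and}\quad\max\Big\{\frac{n(\gamma-1)}{n-\beta\gamma},\ \frac{n(\gamma-1)}{p\big(\frac{n-\beta\gamma}{\gamma-1}\big)-(\beta\gamma+\sigma_2)}\Big\}<s\le\infty.$$ Furthermore, $u(x)\to0$ and $v(x)\to0$ as $|x|\to\infty$.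
   Context: $B_t(x)\subset\mathbb{R}^n$ is the ball of radius $t$ centered at $x$. The Wolff potential of a nonnegative $f\in L^1_{loc}(\mathbb{R}^n)$ is $$W_{\beta,\gamma}(f)(x)=\int_0^\infty\Big(\frac{\int_{B_t(x)}f(y)\,dy}{t^{n-\beta\gamma}}\Big)^{\frac1{\gamma-1}}\frac{dt}{t}.$$ In the system, $W_{\beta,\gamma}(|y|^{\sigma_1}v^q)$ means the Wolff potential of the function $y\mapsto|y|^{\sigma_1}v(y)^q$, and similarly for the second equation. A function $c$ is double bounded if there is $C>0$ with $C^{-1}\le c(x)\le C$ for all $x\in\mathbb{R}^n$. A positive solution is a pair of positive (finite-valued, measurable) functions on $\mathbb{R}^n$ satisfying the system. A positive solution $(u,v)$ is an integrable solution if $(u,v)\in L^{r_0}(\mathbb{R}^n)\times L^{s_0}(\mathbb{R}^n)$, where $r_0=n/q_0$, $s_0=n/p_0$ and $$q_0=\frac{\beta\gamma(\gamma-1+q)+(\gamma-1)\sigma_1+\sigma_2q}{pq-(\gamma-1)^2},\qquad p_0=\frac{\beta\gamma(\gamma-1+p)+(\gamma-1)\sigma_2+\sigma_1p}{pq-(\gamma-1)^2}.$$ *)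

theory Defs
  imports "HOL-Analysis.Analysis"
begin

(* Real powers on [0,\<infinity>]; used only for exponents s > 0, where \<infinity>^s = \<infinity>. *)
definition ennreal_powr :: "ennreal \<Rightarrow> real \<Rightarrow> ennreal" where
  "ennreal_powr a s = (if a = \<infinity> then \<infinity> else ennreal (enn2real a powr s))"

(* Nonnegative integrals are used, so the value is \<infinity> whenever f is not locally
   integrable; a finite value at a single point forces f to be in L^1_loc. *)
definition wolff :: "real \<Rightarrow> real \<Rightarrow> (real ^ 'n \<Rightarrow> real) \<Rightarrow> real ^ 'n \<Rightarrow> ennreal" where
  "wolff \<beta> \<gamma> f x =
     (\<integral>\<^sup>+ t \<in> {0<..}.
        (ennreal_powr
          ((\<integral>\<^sup>+ y \<in> ball x t. ennreal (f y) \<partial>lebesgue)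
             / ennreal (t powr (real CARD('n) - \<beta> * \<gamma>)))
          (1 / (\<gamma> - 1)) / ennreal t) \<partial>lborel)"

definition double_bounded :: "('a \<Rightarrow> real) \<Rightarrow> bool" where
  "double_bounded c \<longleftrightarrow> (\<exists>C>0. \<forall>x. inverse C \<le> c x \<and> c x \<le> C)"

(* Membership in L^r for 0 < r \<le> \<infinity>; exponents below 1 are allowed. *)
definition in_Lspace :: "ereal \<Rightarrow> ('a::euclidean_space \<Rightarrow> real) \<Rightarrow> bool" where
  "in_Lspace r f \<longleftrightarrow>
     f \<in> borel_measurable lebesgue \<and>
     (if r = \<infinity> then \<exists>C. AE x in lebesgue. \<bar>f x\<bar> \<le> C
      else integrable lebesgue (\<lambda>x. \<bar>f x\<bar> powr real_of_ereal r))"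

(* The origin, where 0 powr \<sigma> = 0 by convention, is a null set and does not affect
   the potentials. *)
definition positive_solution ::
  "real \<Rightarrow> real \<Rightarrow> real \<Rightarrow> real \<Rightarrow> real \<Rightarrow> real \<Rightarrow> (real ^ 'n \<Rightarrow> real) \<Rightarrow> (real ^ 'n \<Rightarrow> real)
     \<Rightarrow> (real ^ 'n \<Rightarrow> real) \<Rightarrow> (real ^ 'n \<Rightarrow> real) \<Rightarrow> bool" where
  "positive_solution \<beta> \<gamma> \<sigma>\<^sub>1 \<sigma>\<^sub>2 p q c\<^sub>1 c\<^sub>2 u v \<longleftrightarrow>
     u \<in> borel_measurable lebesgue \<and> v \<in> borel_measurable lebesgue \<and>
     (\<forall>x. 0 < u x) \<and> (\<forall>x. 0 < v x) \<and>
     (\<forall>x. ennreal (u x) = ennreal (c\<^sub>1 x) * wolff \<beta> \<gamma> (\<lambda>y. norm y powr \<sigma>\<^sub>1 * v y powr q) x) \<and>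
     (\<forall>x. ennreal (v x) = ennreal (c\<^sub>2 x) * wolff \<beta> \<gamma> (\<lambda>y. norm y powr \<sigma>\<^sub>2 * u y powr p) x)"

definition q0 :: "real \<Rightarrow> real \<Rightarrow> real \<Rightarrow> real \<Rightarrow> real \<Rightarrow> real \<Rightarrow> real" where
  "q0 \<beta> \<gamma> \<sigma>\<^sub>1 \<sigma>\<^sub>2 p q =
     (\<beta> * \<gamma> * (\<gamma> - 1 + q) + (\<gamma> - 1) * \<sigma>\<^sub>1 + \<sigma>\<^sub>2 * q) / (p * q - (\<gamma> - 1)\<^sup>2)"

definition p0 :: "real \<Rightarrow> real \<Rightarrow> real \<Rightarrow> real \<Rightarrow> real \<Rightarrow> real \<Rightarrow> real" where
  "p0 \<beta> \<gamma> \<sigma>\<^sub>1 \<sigma>\<^sub>2 p q =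
     (\<beta> * \<gamma> * (\<gamma> - 1 + p) + (\<gamma> - 1) * \<sigma>\<^sub>2 + \<sigma>\<^sub>1 * p) / (p * q - (\<gamma> - 1)\<^sup>2)"

definition integrable_solution ::
  "real \<Rightarrow> real \<Rightarrow> real \<Rightarrow> real \<Rightarrow> real \<Rightarrow> real \<Rightarrow> (real ^ 'n \<Rightarrow> real) \<Rightarrow> (real ^ 'n \<Rightarrow> real)
     \<Rightarrow> (real ^ 'n \<Rightarrow> real) \<Rightarrow> (real ^ 'n \<Rightarrow> real) \<Rightarrow> bool" where
  "integrable_solution \<beta> \<gamma> \<sigma>\<^sub>1 \<sigma>\<^sub>2 p q c\<^sub>1 c\<^sub>2 u v \<longleftrightarrow>
     positive_solution \<beta> \<gamma> \<sigma>\<^sub>1 \<sigma>\<^sub>2 p q c\<^sub>1 c\<^sub>2 u v \<and>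
     in_Lspace (ereal (real CARD('n) / q0 \<beta> \<gamma> \<sigma>\<^sub>1 \<sigma>\<^sub>2 p q)) u \<and>
     in_Lspace (ereal (real CARD('n) / p0 \<beta> \<gamma> \<sigma>\<^sub>1 \<sigma>\<^sub>2 p q)) v"

end

(*
  The idea is to regard the system as a sublinear problem with small coefficient. Write a = gamma - 1,
  b = n - beta gamma, and let V1 be V restricted to the set where |y| or V is large. Then V^q splits
  as V1^(q - a) V^a plus a bounded, compactly supported term, and w |-> W(|y|^sigma V1^(q - a) w^a) is
  homogeneous of degree one with a norm as small as we like on every L^(n/X) with a X < b. This uses a
  weighted Hardy-Littlewood-Sobolev inequality for Wolff potentials. It is obtained by Hedberg's
  method: Hoelder's inequality on a ball absorbs the weight, so that
    int_{B_t(x)} |y|^sigma g <= C t^(n + sigma) (M g^eta)(x)^(1/eta),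
  and one interpolates with the bound by the L^(n/Z) norm of g. Iterating the two inequalities then
  lifts the integrability of (U, V) along the line X - Y = q0 - p0, and one more application of the
  Hardy-Littlewood-Sobolev inequality yields the full ranges. Boundedness and decay follow since the
  densities lie in Lebesgue spaces on both sides of the critical exponent.

  Throughout, Lebesgue exponents are written r = n/X, which makes all exponent relations linear, and
  the non-subcritical condition reads a (q0 + p0) <= b.
*)

theory Submission
  imports Defs
begin

section \<open>Real powers of extended nonnegative reals\<close>

text \<open>All estimates take values in the extended nonnegative reals, so potentials, maximal
  functions and integrals may be infinite. Exponents n/X below 1 occur, so sums are estimated with
  factors 2^s instead of a triangle inequality; the smallness of the coefficient pays for them. The
  line X - Y = q0 - p0 is forced. With V1 fixed in L^(n/p0), Hoelder and Hardy-Littlewood-Sobolev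
  require n + sigma1 - b + a X = (q - a) p0 + a Y, which (q0, p0) satisfies; subtracting leaves a (X
  - Y) = a (q0 - p0). The second equation gives the same line. The obstacle is that U is not known
  to be finite in the target space, so no contraction argument applies there directly. The known
  space L^(n/q0) makes the iterates of the homogeneous part vanish, while the inhomogeneous part is
  bounded in the target space. The non-subcritical condition yields a q0 < b and a p0 < b, as the
  Hardy-Littlewood-Sobolev inequality demands at the starting point. As q0 >= p0, the line reaches
  only X > q0 - p0 for U; smaller X come from V. The exponents of V then come from those of U under
  a Z / p < b with Z = n + sigma2 - b + a Y, which is the second term of the maximum.\<close>

notation ennreal_powr (infixr \<open>epowr\<close> 80)

lemma epowr_ennreal: "0 \<le> x \<Longrightarrow> ennreal x epowr s = ennreal (x powr s)"
  by (simp add: ennreal_powr_def)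

lemma epowr_top [simp]: "top epowr s = top"
  by (simp add: ennreal_powr_def)

lemma epowr_0 [simp]: "0 epowr s = 0"
  by (simp add: ennreal_powr_def)

lemma epowr_id [simp]: "x epowr 1 = x"
  by (cases x) (auto simp: epowr_ennreal)

lemma epowr_mono: "0 < s \<Longrightarrow> x \<le> y \<Longrightarrow> x epowr s \<le> y epowr s"
  by (cases x; cases y) (auto simp: epowr_ennreal powr_mono2 top_unique)

lemma epowr_mult: "0 < s \<Longrightarrow> (x * y) epowr s = x epowr s * y epowr s"
proof (cases x; cases y)
  assume "0 < s" "x = top" "y = top" then show ?thesis by simp
next
  fix r assume "0 < s" "0 \<le> r" "x = ennreal r" "y = top"
  then show ?thesis by (cases "r = 0") (auto simp: epowr_ennreal ennreal_mult_top)
next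
  fix r assume "0 < s" "0 \<le> r" "y = ennreal r" "x = top"
  then show ?thesis by (cases "r = 0") (auto simp: epowr_ennreal ennreal_top_mult)
qed (simp add: epowr_ennreal powr_mult flip: ennreal_mult)

lemma epowr_epowr: "(x epowr s) epowr t = x epowr (s * t)"
  by (cases x) (auto simp: epowr_ennreal powr_powr)

lemma epowr_add: "0 < s \<Longrightarrow> 0 < t \<Longrightarrow> x epowr (s + t) = x epowr s * x epowr t"
  by (cases x) (auto simp: epowr_ennreal powr_add ennreal_mult)

lemma epowr_eq_top_iff [simp]: "x epowr s = top \<longleftrightarrow> x = top"
  by (cases x) (auto simp: epowr_ennreal)

lemma epowr_less_top_iff [simp]: "x epowr s < top \<longleftrightarrow> x < top"
  by (metis epowr_eq_top_iff less_top)

lemma epowr_eq_0_iff [simp]: "x epowr s = 0 \<longleftrightarrow> x = 0"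
  by (cases x) (auto simp: epowr_ennreal)

lemma measurable_epowr [measurable]:
  assumes [measurable]: "f \<in> borel_measurable M"
  shows "(\<lambda>x. f x epowr s) \<in> borel_measurable M"
  unfolding ennreal_powr_def by measurable

lemma pred_in_ball [measurable]:
  fixes f c :: "'b \<Rightarrow> 'a::euclidean_space"
  assumes [measurable]: "f \<in> borel_measurable M" "c \<in> borel_measurable M" "r \<in> borel_measurable M"
  shows "Measurable.pred M (\<lambda>z. f z \<in> ball (c z) (r z))"
  unfolding mem_ball by measurable

lemma epowr_max: "0 < s \<Longrightarrow> max x y epowr s = max (x epowr s) (y epowr s)"
  by (metis epowr_mono max.absorb1 max.absorb2 nle_le)

text \<open>The bound x + y <= 2 max x y gives one constant for all positive exponents, above and
  below 1 alike.\<close>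

lemma epowr_add_le:
  assumes "0 < s"
  shows "(x + y) epowr s \<le> ennreal (2 powr s) * (x epowr s + y epowr s)"
proof -
  have "x + y \<le> ennreal 2 * max x y"
    using add_mono[of x "max x y" y "max x y"] by (simp add: mult_2 )
  then have "(x + y) epowr s \<le> (ennreal 2 * max x y) epowr s"
    using assms by (rule epowr_mono[rotated])
  also have "\<dots> = ennreal (2 powr s) * max (x epowr s) (y epowr s)"
    using assms by (simp add: epowr_mult epowr_max epowr_ennreal del: ennreal_numeral)
  also have "\<dots> \<le> ennreal (2 powr s) * (x epowr s + y epowr s)"
    by (intro mult_left_mono) (auto simp: add_increasing add_increasing2)
  finally show ?thesis .
qed

section \<open>Hoelder's inequality, power integrals and singular weights on balls\<close>

lemma Hoelder_nn_integral:
  fixes f g :: "'a \<Rightarrow> ennreal"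
  assumes [measurable]: "f \<in> borel_measurable M" "g \<in> borel_measurable M"
    and p: "1 < p" "1 < q" "1 / p + 1 / q = 1"
  shows "(\<integral>\<^sup>+x. f x * g x \<partial>M) \<le>
    (\<integral>\<^sup>+x. f x epowr p \<partial>M) epowr (1 / p) * (\<integral>\<^sup>+x. g x epowr q \<partial>M) epowr (1 / q)"
    (is "?L \<le> ?I epowr _ * ?J epowr _")
proof -
  \<comment> \<open>A vanishing factor must be treated before an infinite one: the right-hand side
    may be 0 * top = 0, and then the product has to vanish almost everywhere.\<close>
  consider "?I = 0 \<or> ?J = 0" | "?I \<noteq> 0" "?J \<noteq> 0" "?I = top \<or> ?J = top"
    | "?I \<noteq> 0" "?J \<noteq> 0" "?I \<noteq> top" "?J \<noteq> top" by blast
  then show ?thesis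
  proof cases
    case 1
    then have "AE x in M. f x * g x = 0"
      by (auto simp: nn_integral_0_iff_AE elim: AE_mp)
    then have "?L = 0" by (simp add: nn_integral_0_iff_AE)
    then show ?thesis by simp
  next
    case 2
    then have "?I epowr (1 / p) * ?J epowr (1 / q) = top"
      by (auto simp: ennreal_mult_eq_top_iff)
    then show ?thesis by simp
  next
    case 3
    define A where "A = enn2real ?I powr (1 / p)"
    define B where "B = enn2real ?J powr (1 / q)"
    have pos: "0 < enn2real ?I" "0 < enn2real ?J"
      using 3 by (auto simp: enn2real_positive_iff zero_less_iff_neq_zero less_top)
    have AB: "0 < A" "0 < B" using pos by (auto simp: A_def B_def)
    have I: "?I epowr (1 / p) = ennreal A" "?J epowr (1 / q) = ennreal B"
      using 3 by (auto simp: ennreal_powr_def A_def B_def)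
    have IA: "?I = ennreal (A powr p)" "?J = ennreal (B powr q)"
      using 3 p by (auto simp: A_def B_def powr_powr ennreal_enn2real less_top)
    \<comment> \<open>\<open>c\<close> and \<open>d\<close> collect the factors of Young's
      inequality for f/A and g/B after multiplication by A B, so that integration gives A B (1/p +
      1/q) = A B.\<close>
    define c where "c = A * B / (p * A powr p)"
    define d where "d = A * B / (q * B powr q)"
    have cd: "0 < c" "0 < d" using AB p by (auto simp: c_def d_def)
    have young: "f x * g x \<le> ennreal c * f x epowr p + ennreal d * g x epowr q" for x
    proof (cases "f x = top \<or> g x = top")
      case True
      then have "ennreal c * f x epowr p = top \<or> ennreal d * g x epowr q = top"
        using cd by (auto simp: ennreal_mult_eq_top_iff)
      then show ?thesis by (auto simp: top_unique)
    next
      case False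
      then obtain r s where rs: "f x = ennreal r" "g x = ennreal s" "0 \<le> r" "0 \<le> s"
        by (metis ennreal_cases)
      have "(r / A) * (s / B) \<le> (r / A) powr p / p + (s / B) powr q / q"
        using p AB rs by (intro Youngs_inequality) auto
      then have "(r * s) \<le> A * B * ((r / A) powr p / p + (s / B) powr q / q)"
        using AB by (simp add: field_simps)
      also have "\<dots> = c * r powr p + d * s powr q"
        using AB rs by (simp add: powr_divide field_simps c_def d_def)
      finally have "ennreal (r * s) \<le> ennreal (c * r powr p + d * s powr q)"
        by (rule ennreal_leI)
      then show ?thesis
        using cd rs by (simp add: epowr_ennreal ennreal_mult)
    qed
    have "?L \<le> (\<integral>\<^sup>+x. ennreal c * f x epowr p + ennreal d * g x epowr q \<partial>M)"
      by (intro nn_integral_mono young)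
    also have "\<dots> = ennreal c * ?I + ennreal d * ?J"
      by (simp add: nn_integral_add nn_integral_cmult)
    also have "\<dots> = ennreal (c * A powr p + d * B powr q)"
      using cd by (simp add: IA ennreal_mult)
    also have "c * A powr p + d * B powr q = A * B * (1 / p + 1 / q)"
      using AB by (simp add: field_simps c_def d_def)
    finally show ?thesis using AB p by (simp add: I ennreal_mult)
  qed
qed

lemma nn_integral_powr_Ioo:
  fixes s c :: real
  assumes "0 < s" "0 \<le> c"
  shows "(\<integral>\<^sup>+t. ennreal (t powr (s - 1)) * indicator {0<..<c} t \<partial>lborel) = ennreal (c powr s / s)"
proof -
  have "(\<integral>\<^sup>+t. ennreal (t powr (s - 1)) * indicator {0<..<c} t \<partial>lborel)
      = (\<integral>\<^sup>+t. ennreal (t powr (s - 1)) * indicator {0..c} t \<partial>lborel)"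
    using AE_lborel_singleton[of 0] AE_lborel_singleton[of c]
    by (intro nn_integral_cong_AE) (auto split: split_indicator)
  also have "\<dots> = ennreal (c powr s / s)"
    using has_integral_powr_from_0[of "s - 1" c] assms by (intro nn_integral_has_integral_lebesgue') auto
  finally show ?thesis .
qed

lemma nn_integral_powr_Ici:
  fixes s c :: real
  assumes "0 < s" "0 < c"
  shows "(\<integral>\<^sup>+t. ennreal (t powr (- s - 1)) * indicator {c..} t \<partial>lborel) = ennreal (c powr (- s) / s)"
  using has_integral_powr_to_inf[of "- s - 1" c] assms by (intro nn_integral_has_integral_lebesgue') auto

text \<open>Countable subadditivity over an arbitrary countable index set, in the
  \<open>count_space\<close> form in which additivity over disjoint families is available; the
  covering argument for the maximal function combines the two.\<close>

lemma emeasure_UN_le_count_space: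
  assumes "countable I" "\<And>i. i \<in> I \<Longrightarrow> X i \<in> sets M"
  shows "emeasure M (\<Union>i\<in>I. X i) \<le> (\<integral>\<^sup>+i. emeasure M (X i) \<partial>count_space I)"
proof -
  have "emeasure M (\<Union>i\<in>I. X i) = (\<integral>\<^sup>+x. indicator (\<Union>i\<in>I. X i) x \<partial>M)"
    using assms by (intro nn_integral_indicator[symmetric] sets.countable_UN'') auto
  also have "\<dots> \<le> (\<integral>\<^sup>+x. (\<integral>\<^sup>+i. indicator (X i) x \<partial>count_space I) \<partial>M)"
  proof (intro nn_integral_mono)
    fix x
    show "indicator (\<Union>i\<in>I. X i) x \<le> (\<integral>\<^sup>+i. indicator (X i) x \<partial>count_space I :: ennreal)"
    proof (cases "x \<in> (\<Union>i\<in>I. X i)")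
      case True
      then obtain i where i: "i \<in> I" "x \<in> X i" by auto
      have "indicator (\<Union>i\<in>I. X i) x = (indicator (X i) x :: ennreal)" using True i by simp
      with nn_integral_ge_point[OF i(1), of "\<lambda>i. indicator (X i) x"] show ?thesis by simp
    qed auto
  qed
  also have "\<dots> = (\<integral>\<^sup>+i. (\<integral>\<^sup>+x. indicator (X i) x \<partial>M) \<partial>count_space I)"
    by (rule nn_integral_count_space_nn_integral) (use assms in auto)
  also have "\<dots> = (\<integral>\<^sup>+i. emeasure M (X i) \<partial>count_space I)"
    using assms by (intro nn_integral_cong) auto
  finally show ?thesis .
qed

lemma emeasure_ball_powr:
  fixes x :: "'a::euclidean_space"
  assumes "0 < r"
  shows "emeasure lborel (ball x r) = ennreal (unit_ball_vol DIM('a) * r powr DIM('a))"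
  using assms by (simp add: emeasure_ball powr_realpow)

lemma dyadic_shell:
  fixes x t :: real
  assumes "0 < x" "x < t"
  obtains k :: nat where "t / 2 ^ Suc k \<le> x" "x < t / 2 ^ k"
proof -
  obtain m where "(1 / 2) ^ m < x / t"
    using assms real_arch_pow_inv[of "x / t" "1 / 2"] by auto
  then have ex: "t / 2 ^ m \<le> x" using assms by (simp add: field_simps power_divide)
  define l where "l = (LEAST m. t / 2 ^ m \<le> x)"
  have l: "t / 2 ^ l \<le> x" unfolding l_def by (rule LeastI[of _ m]) (rule ex)
  have "l \<noteq> 0" using l assms by (intro notI) simp
  then obtain k where k: "l = Suc k" by (cases l) auto
  have "\<not> t / 2 ^ k \<le> x" using not_less_Least[of k "\<lambda>m. t / 2 ^ m \<le> x"] k l_def by simp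
  then show ?thesis using l k that by auto
qed

text \<open>The constant is uniform in the centre: where |y| >= t the weight is at most t^(-b), and
  the ball |y| < t around the origin is cut into dyadic shells whose contributions form a geometric
  series of ratio \<open>\<rho>\<close> = 2^(b - n) < 1. No case distinction on the position of the
  ball is needed.\<close>

lemma nn_integral_norm_powr_ball:
  fixes b :: real
  assumes "0 \<le> b" "b < DIM('a)"
  shows "\<exists>C>0. \<forall>(x::'a::euclidean_space) t. 0 < t \<longrightarrow>
    (\<integral>\<^sup>+y. ennreal (norm y powr (- b)) * indicator (ball x t) y \<partial>lborel) \<le> ennreal (C * t powr (DIM('a) - b))"
proof -
  define n where "n = real DIM('a)"
  define w where "w = unit_ball_vol n"
  define \<rho> where "\<rho> = 2 powr (b - n)"
  define S where "S = (\<Sum>k. \<rho> ^ k)"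
  define C where "C = w + w * 2 powr b * S"
  have n: "0 < n" "b < n" using assms by (auto simp: n_def)
  have w: "0 < w" using n by (simp add: w_def)
  have \<rho>: "0 < \<rho>" "\<rho> < 1" using n powr_less_mono[of "b - n" 0 2] by (auto simp: \<rho>_def)
  then have sm: "summable (\<lambda>k. \<rho> ^ k)" by (intro summable_geometric) auto
  have S: "0 \<le> S" unfolding S_def by (rule suminf_nonneg[OF sm]) (use \<rho> in simp)
  have C: "0 < C" unfolding C_def using w S by (intro add_pos_nonneg mult_nonneg_nonneg) auto
  moreover have "(\<integral>\<^sup>+y. ennreal (norm y powr (- b)) * indicator (ball x t) y \<partial>lborel) \<le> ennreal (C * t powr (n - b))"
    if t: "0 < t" for x :: 'a and t
  proof -
    define h where "h k y = ennreal ((t / 2 ^ Suc k) powr (- b)) * indicator (ball 0 (t / 2 ^ k)) y" for k and y :: 'a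
    have [measurable]: "(\<lambda>y. h k y) \<in> borel_measurable borel" for k unfolding h_def by measurable
    have pt: "ennreal (norm y powr (- b)) * indicator (ball x t) y
        \<le> ennreal (t powr (- b)) * indicator (ball x t) y + (\<Sum>k. h k y)" for y
    proof -
      \<comment> \<open>The origin lies in no shell, but there the left-hand side is 0 because
        \<open>0 powr (- b) = 0\<close>.\<close>
      have "y = 0 \<or> t \<le> norm y \<or> (0 < norm y \<and> norm y < t)" using zero_less_norm_iff[of y] by linarith
      then consider "y = 0" | "t \<le> norm y" | "0 < norm y" "norm y < t" by blast
      then show ?thesis
      proof cases
        case 2
        then have "norm y powr (- b) \<le> t powr (- b)" using t assms by (intro powr_mono2') auto
        then have "ennreal (norm y powr (- b)) * indicator (ball x t) y \<le> ennreal (t powr (- b)) * indicator (ball x t) y"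
          by (intro mult_right_mono ennreal_leI) auto
        also have "\<dots> \<le> ennreal (t powr (- b)) * indicator (ball x t) y + (\<Sum>k. h k y)" by simp
        finally show ?thesis .
      next
        case 3
        then obtain k where k: "t / 2 ^ Suc k \<le> norm y" "norm y < t / 2 ^ k" by (rule dyadic_shell)
        have "norm y powr (- b) \<le> (t / 2 ^ Suc k) powr (- b)"
          using t k(1) assms by (intro powr_mono2') auto
        then have "ennreal (norm y powr (- b)) * indicator (ball x t) y \<le> ennreal ((t / 2 ^ Suc k) powr (- b)) * 1"
          by (intro mult_mono ennreal_leI) (auto split: split_indicator)
        also have "\<dots> = h k y" using k by (simp add: h_def)
        also have "\<dots> \<le> (\<Sum>k. h k y)"
          using sum_le_suminf[of "\<lambda>k. h k y" "{k}"] by simp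
        finally show ?thesis by (simp add: add_increasing)
      qed auto
    qed
    have hk: "(\<integral>\<^sup>+y. h k y \<partial>lborel) = ennreal (w * 2 powr b * t powr (n - b) * \<rho> ^ k)" for k
    proof -
      define s where "s = t / 2 ^ k"
      have s: "0 < s" using t by (simp add: s_def)
      have "(\<integral>\<^sup>+y. h k y \<partial>lborel) = ennreal ((s / 2) powr (- b)) * emeasure lborel (ball (0::'a) s)"
        unfolding h_def s_def by (subst nn_integral_cmult_indicator) (simp_all add: mult.commute)
      also have "\<dots> = ennreal ((s / 2) powr (- b) * (w * s powr n))"
        using s w by (simp add: emeasure_ball_powr n_def w_def flip: ennreal_mult)
      also have "(s / 2) powr (- b) * (w * s powr n) = w * 2 powr b * s powr (n - b)"
        using s by (simp add: powr_divide powr_minus powr_diff field_simps)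
      also have "s powr (n - b) = t powr (n - b) * \<rho> ^ k"
      proof -
        have "(2 ^ k :: real) powr (n - b) = 2 powr (real k * (n - b))"
          by (simp add: powr_powr flip: powr_realpow)
        moreover have "\<rho> ^ k = inverse (2 powr (real k * (n - b)))"
          unfolding \<rho>_def by (simp add: powr_power algebra_simps flip: powr_minus)
        ultimately show ?thesis
          using t by (simp only: s_def powr_divide powr_minus) (simp add: field_simps)
      qed
      finally show ?thesis by (simp add: mult_ac)
    qed
    have "(\<integral>\<^sup>+y. ennreal (norm y powr (- b)) * indicator (ball x t) y \<partial>lborel)
       \<le> (\<integral>\<^sup>+y. ennreal (t powr (- b)) * indicator (ball x t) y + (\<Sum>k. h k y) \<partial>lborel)"
      by (intro nn_integral_mono pt)
    also have "\<dots> = ennreal (t powr (- b)) * emeasure lborel (ball x t) + (\<Sum>k. \<integral>\<^sup>+y. h k y \<partial>lborel)"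
      by (subst nn_integral_add) (simp_all add: nn_integral_suminf nn_integral_cmult_indicator)
    also have "(\<Sum>k. \<integral>\<^sup>+y. h k y \<partial>lborel) = ennreal (w * 2 powr b * t powr (n - b) * S)"
      unfolding hk S_def by (intro suminf_ennreal_eq sums_mult summable_sums sm) (use w \<rho> in simp)
    also have "ennreal (t powr (- b)) * emeasure lborel (ball x t) = ennreal (w * t powr (n - b))"
      using t w by (simp add: emeasure_ball_powr n_def w_def powr_diff powr_minus field_simps flip: ennreal_mult)
    also have "ennreal (w * t powr (n - b)) + ennreal (w * 2 powr b * t powr (n - b) * S) = ennreal (C * t powr (n - b))"
      using w S by (subst ennreal_plus[symmetric]) (auto simp: C_def algebra_simps)
    finally show ?thesis .
  qed
  ultimately show ?thesis unfolding n_def by blast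
qed

section \<open>Wolff potentials\<close>

text \<open>The Wolff potential of an extended-valued density, with a = gamma - 1 and b = n - beta
  gamma as parameters and quotients written as products with real powers of t.\<close>

definition wpot :: "real \<Rightarrow> real \<Rightarrow> ('a::euclidean_space \<Rightarrow> ennreal) \<Rightarrow> 'a \<Rightarrow> ennreal" where
  "wpot a b F x = (\<integral>\<^sup>+t. ((\<integral>\<^sup>+y. F y * indicator (ball x t) y \<partial>lborel) * ennreal (t powr (- b))) epowr (1 / a)
     * ennreal (1 / t) * indicator {0<..} t \<partial>lborel)"

lemma wolff_eq_wpot:
  fixes x :: "real ^ 'n"
  shows "wolff \<beta> \<gamma> f x = wpot (\<gamma> - 1) (real CARD('n) - \<beta> * \<gamma>) (\<lambda>y. ennreal (f y)) x"
  unfolding wolff_def wpot_def nn_integral_completion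
proof (intro nn_integral_cong)
  fix t :: real
  show "((\<integral>\<^sup>+ y\<in>ball x t. ennreal (f y) \<partial>lborel) / ennreal (t powr (real CARD('n) - \<beta> * \<gamma>))) epowr (1 / (\<gamma> - 1)) /
          ennreal t * indicator {0<..} t =
          ((\<integral>\<^sup>+ y\<in>ball x t. ennreal (f y) \<partial>lborel) * ennreal (t powr - (real CARD('n) - \<beta> * \<gamma>))) epowr (1 / (\<gamma> - 1)) *
          ennreal (1 / t) * indicator {0<..} t"
  proof (cases "0 < t")
    case True
    have "X / ennreal (t powr d) = X * ennreal (t powr (- d))" for X d
      using True by (simp add: divide_ennreal_def inverse_ennreal powr_minus)
    moreover have "X / ennreal t = X * ennreal (1 / t)" for X
      using True by (simp add: divide_ennreal_def inverse_ennreal inverse_eq_divide)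
    ultimately show ?thesis by (simp only:)
  qed simp
qed

lemma wpot_mono_AE:
  assumes "0 < a" "AE y in lborel. F y \<le> G y"
  shows "wpot a b F x \<le> wpot a b G x"
proof -
  have "(\<integral>\<^sup>+y. F y * indicator (ball x t) y \<partial>lborel) \<le> (\<integral>\<^sup>+y. G y * indicator (ball x t) y \<partial>lborel)" for t
    using assms(2) by (intro nn_integral_mono_AE, eventually_elim) (auto intro: mult_right_mono)
  then have "((\<integral>\<^sup>+y. F y * indicator (ball x t) y \<partial>lborel) * ennreal (t powr (- b))) epowr (1 / a)
    \<le> ((\<integral>\<^sup>+y. G y * indicator (ball x t) y \<partial>lborel) * ennreal (t powr (- b))) epowr (1 / a)" for t
    using assms(1) by (intro epowr_mono mult_right_mono) auto
  then show ?thesis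
    unfolding wpot_def by (intro nn_integral_mono mult_right_mono) auto
qed

lemma wpot_cong_AE:
  assumes "AE y in lborel. F y = G y"
  shows "wpot a b F = wpot a b G"
proof -
  have "(\<integral>\<^sup>+y. F y * indicator (ball x t) y \<partial>lborel) = (\<integral>\<^sup>+y. G y * indicator (ball x t) y \<partial>lborel)" for x t
    using assms by (intro nn_integral_cong_AE) auto
  then show ?thesis by (simp add: wpot_def fun_eq_iff)
qed

lemma measurable_nn_integral_ball [measurable]:
  fixes F :: "'a::euclidean_space \<Rightarrow> ennreal"
  assumes [measurable]: "F \<in> borel_measurable borel" "c \<in> borel_measurable M" "r \<in> borel_measurable M"
  shows "(\<lambda>z. \<integral>\<^sup>+y. F y * indicator (ball (c z) (r z)) y \<partial>lborel) \<in> borel_measurable M"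
  by measurable

lemma measurable_wpot [measurable]:
  fixes F :: "'a::euclidean_space \<Rightarrow> ennreal"
  assumes [measurable]: "F \<in> borel_measurable borel"
  shows "wpot a b F \<in> borel_measurable borel"
  unfolding wpot_def by measurable

lemma wpot_add_le:
  fixes F G :: "'a::euclidean_space \<Rightarrow> ennreal"
  assumes [measurable]: "F \<in> borel_measurable borel" "G \<in> borel_measurable borel" and a: "0 < a"
  shows "wpot a b (\<lambda>y. F y + G y) x \<le> ennreal (2 powr (1 / a)) * (wpot a b F x + wpot a b G x)"
proof -
  define f where "f F t = (\<integral>\<^sup>+y. F y * indicator (ball x t) y \<partial>lborel) * ennreal (t powr (- b))" for F and t :: real
  have [measurable]: "f F \<in> borel_measurable borel" "f G \<in> borel_measurable borel"
    unfolding f_def by measurable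
  have "f (\<lambda>y. F y + G y) t = f F t + f G t" for t
    by (simp add: f_def nn_integral_add distrib_right)
  then have "wpot a b (\<lambda>y. F y + G y) x = (\<integral>\<^sup>+t. (f F t + f G t) epowr (1 / a) * ennreal (1 / t) * indicator {0<..} t \<partial>lborel)"
    by (simp add: wpot_def flip: f_def)
  also have "\<dots> \<le> (\<integral>\<^sup>+t. (ennreal (2 powr (1 / a)) * (f F t epowr (1 / a) + f G t epowr (1 / a))) *
      ennreal (1 / t) * indicator {0<..} t \<partial>lborel)"
    using a by (intro nn_integral_mono mult_right_mono epowr_add_le) auto
  also have "\<dots> = (\<integral>\<^sup>+t. ennreal (2 powr (1 / a)) * (f F t epowr (1 / a) * ennreal (1 / t) * indicator {0<..} t
      + f G t epowr (1 / a) * ennreal (1 / t) * indicator {0<..} t) \<partial>lborel)"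
    by (intro nn_integral_cong) (simp add: algebra_simps)
  also have "\<dots> = ennreal (2 powr (1 / a)) * (wpot a b F x + wpot a b G x)"
    by (simp add: nn_integral_cmult nn_integral_add wpot_def f_def)
  finally show ?thesis .
qed

text \<open>Splitting the scale integral at \<delta>, the mass bounds turn the integrand into
  multiples of t^(A/a - 1) below \<delta> and t^(-B/a - 1) above it, both integrable. The factors
  \<open>K\<close> and \<open>L\<close> are extended reals, since a maximal function value or a norm
  is inserted for them.\<close>

lemma wpot_le_two_scales:
  fixes F :: "'a::euclidean_space \<Rightarrow> ennreal"
  assumes pos: "0 < a" "0 < A" "0 < B" "0 < \<delta>"
    and small: "\<And>t. 0 < t \<Longrightarrow> t < \<delta> \<Longrightarrow> (\<integral>\<^sup>+y. F y * indicator (ball x t) y \<partial>lborel) \<le> K * ennreal (t powr (b + A))"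
    and large: "\<And>t. \<delta> \<le> t \<Longrightarrow> (\<integral>\<^sup>+y. F y * indicator (ball x t) y \<partial>lborel) \<le> L * ennreal (t powr (b - B))"
  shows "wpot a b F x \<le> K epowr (1 / a) * ennreal (\<delta> powr (A / a) * (a / A))
     + L epowr (1 / a) * ennreal (\<delta> powr (- (B / a)) * (a / B))"
proof -
  \<comment> \<open>One computation for both ranges, applied with s = A and s = - B.\<close>
  have *: "(I * ennreal (t powr (- b))) epowr (1 / a) * ennreal (1 / t) \<le> M epowr (1 / a) * ennreal (t powr (s / a - 1))"
    if "0 < t" "I \<le> M * ennreal (t powr (b + s))" for I M t s
  proof -
    have "I * ennreal (t powr (- b)) \<le> M * ennreal (t powr (b + s)) * ennreal (t powr (- b))"
      using that by (intro mult_right_mono) auto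
    also have "\<dots> = M * ennreal (t powr s)"
      by (simp add: mult.assoc flip: ennreal_mult powr_add)
    finally have "(I * ennreal (t powr (- b))) epowr (1 / a) \<le> M epowr (1 / a) * ennreal (t powr (s / a))"
      using epowr_mono[of "1 / a"] pos by (fastforce simp: epowr_mult epowr_ennreal powr_powr)
    then have "(I * ennreal (t powr (- b))) epowr (1 / a) * ennreal (1 / t)
        \<le> M epowr (1 / a) * ennreal (t powr (s / a)) * ennreal (1 / t)"
      by (rule mult_right_mono) auto
    also have "\<dots> = M epowr (1 / a) * ennreal (t powr (s / a - 1))"
      using that by (simp add: mult.assoc powr_diff flip: ennreal_mult)
    finally show ?thesis .
  qed
  have "wpot a b F x \<le> (\<integral>\<^sup>+t. K epowr (1 / a) * (ennreal (t powr (A / a - 1)) * indicator {0<..<\<delta>} t)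
     + L epowr (1 / a) * (ennreal (t powr (- (B / a) - 1)) * indicator {\<delta>..} t) \<partial>lborel)"
    unfolding wpot_def
  proof (intro nn_integral_mono)
    fix t :: real
    let ?I = "\<integral>\<^sup>+y. F y * indicator (ball x t) y \<partial>lborel"
    consider "t \<le> 0" | "0 < t" "t < \<delta>" | "\<delta> \<le> t" by linarith
    then show "(?I * ennreal (t powr (- b))) epowr (1 / a) * ennreal (1 / t) * indicator {0<..} t
      \<le> K epowr (1 / a) * (ennreal (t powr (A / a - 1)) * indicator {0<..<\<delta>} t)
     + L epowr (1 / a) * (ennreal (t powr (- (B / a) - 1)) * indicator {\<delta>..} t)"
    proof cases
      case 2
      then show ?thesis using *[of t ?I K A] small by simp
    next
      case 3
      then show ?thesis using *[of t ?I L "- B"] large pos by simp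
    qed simp
  qed
  also have "\<dots> = K epowr (1 / a) * (\<integral>\<^sup>+t. ennreal (t powr (A / a - 1)) * indicator {0<..<\<delta>} t \<partial>lborel)
     + L epowr (1 / a) * (\<integral>\<^sup>+t. ennreal (t powr (- (B / a) - 1)) * indicator {\<delta>..} t \<partial>lborel)"
    by (simp add: nn_integral_add nn_integral_cmult)
  also have "(\<integral>\<^sup>+t. ennreal (t powr (A / a - 1)) * indicator {0<..<\<delta>} t \<partial>lborel) = ennreal (\<delta> powr (A / a) * (a / A))"
    using nn_integral_powr_Ioo[of "A / a" \<delta>] pos by simp
  also have "(\<integral>\<^sup>+t. ennreal (t powr (- (B / a) - 1)) * indicator {\<delta>..} t \<partial>lborel) = ennreal (\<delta> powr (- (B / a)) * (a / B))"
    using nn_integral_powr_Ici[of "B / a" \<delta>] pos by simp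
  finally show ?thesis .
qed

text \<open>Balancing the two scales at \<open>\<delta>\<^bsup>A + B\<^esup> = L / K\<close>.\<close>

lemma wpot_le_interpolate:
  fixes F :: "'a::euclidean_space \<Rightarrow> ennreal"
  assumes pos: "0 < a" "0 < A" "0 < B"
    and small: "\<And>t. 0 < t \<Longrightarrow> (\<integral>\<^sup>+y. F y * indicator (ball x t) y \<partial>lborel) \<le> K * ennreal (t powr (b + A))"
    and large: "\<And>t. 0 < t \<Longrightarrow> (\<integral>\<^sup>+y. F y * indicator (ball x t) y \<partial>lborel) \<le> L * ennreal (t powr (b - B))"
  shows "wpot a b F x \<le> ennreal (a / A + a / B) * (K epowr (B / (A + B)) * L epowr (A / (A + B))) epowr (1 / a)"
proof -
  \<comment> \<open>If a factor is zero, all ball integrals and hence the potential vanish. If both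
    are nonzero and one is infinite, so is the right-hand side. Only finite positive factors can be
    balanced.\<close>
  consider "K = 0 \<or> L = 0" | "K \<noteq> 0" "L \<noteq> 0" "K = top \<or> L = top" | k l where "K = ennreal k" "L = ennreal l" "0 < k" "0 < l"
    by (metis ennreal_cases ennreal_eq_0_iff leI)
  then show ?thesis
  proof cases
    case 1
    then have "(\<integral>\<^sup>+y. F y * indicator (ball x t) y \<partial>lborel) = 0" if "0 < t" for t
      using small[OF that] large[OF that] by auto
    then have "wpot a b F x = (\<integral>\<^sup>+t. 0 \<partial>(lborel :: real measure))"
      unfolding wpot_def by (intro nn_integral_cong) (auto split: split_indicator)
    then show ?thesis by simp
  next
    case 2
    then have "K epowr (B / (A + B)) * L epowr (A / (A + B)) = top"
      by (auto simp: ennreal_mult_eq_top_iff)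
    moreover have "0 < a / A + a / B" using pos by (simp add: add_pos_pos)
    ultimately have "ennreal (a / A + a / B) * (K epowr (B / (A + B)) * L epowr (A / (A + B))) epowr (1 / a) = top"
      by (simp add: ennreal_mult_eq_top_iff)
    then show ?thesis by simp
  next
    case (3 k l)
    define \<delta> where "\<delta> = (l / k) powr (1 / (A + B))"
    \<comment> \<open>\<open>m\<close> is the common value of k \<delta>^A and l \<delta>^(-B) at
      the balancing radius.\<close>
    define m where "m = k powr (B / (A + B)) * l powr (A / (A + B))"
    have \<delta>: "0 < \<delta>" using 3 by (simp add: \<delta>_def)
    have AB: "B / (A + B) = 1 - A / (A + B)" "A / (A + B) = 1 - B / (A + B)"
      using pos by (simp_all add: field_simps)
    have m1: "m = k * \<delta> powr A"
      using 3 by (simp add: m_def \<delta>_def powr_powr AB(1) powr_diff powr_divide)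
    have m2: "m = l * \<delta> powr (- B)"
      using 3 by (simp add: m_def \<delta>_def powr_powr AB(2) powr_diff powr_divide powr_minus)
    have "wpot a b F x \<le> K epowr (1 / a) * ennreal (\<delta> powr (A / a) * (a / A))
     + L epowr (1 / a) * ennreal (\<delta> powr (- (B / a)) * (a / B))"
      using \<delta> pos by (intro wpot_le_two_scales small large) auto
    also have "\<dots> = ennreal (k powr (1 / a) * (\<delta> powr (A / a) * (a / A)) + l powr (1 / a) * (\<delta> powr (- (B / a)) * (a / B)))"
      using 3 pos by (simp add: epowr_ennreal ennreal_mult del: times_divide_eq_right)
    also have "k powr (1 / a) * (\<delta> powr (A / a) * (a / A)) = m powr (1 / a) * (a / A)"
      using 3 by (simp add: m1 powr_mult powr_powr)
    also have "l powr (1 / a) * (\<delta> powr (- (B / a)) * (a / B)) = m powr (1 / a) * (a / B)"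
      using 3 by (simp add: m2 powr_mult powr_powr)
    also have "ennreal (m powr (1 / a) * (a / A) + m powr (1 / a) * (a / B)) = ennreal (a / A + a / B) * ennreal m epowr (1 / a)"
      using 3 pos by (simp add: epowr_ennreal m_def algebra_simps flip: ennreal_mult)
    also have "ennreal m = K epowr (B / (A + B)) * L epowr (A / (A + B))"
      using 3 by (simp add: epowr_ennreal m_def ennreal_mult)
    finally show ?thesis .
  qed
qed

section \<open>The maximal function\<close>

text \<open>The uncentred Hardy-Littlewood maximal function, normalised by r^n instead of the
  volume. With uncentred balls, a superlevel set is a union of balls: it is open, and the Vitali
  covering lemma applies to it directly.\<close>

definition maxfun :: "('a::euclidean_space \<Rightarrow> ennreal) \<Rightarrow> 'a \<Rightarrow> ennreal" where
  "maxfun f x = (SUP (z, r) \<in> {(z, r). 0 < r \<and> x \<in> ball z r}.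
     (\<integral>\<^sup>+y. f y * indicator (ball z r) y \<partial>lborel) * ennreal (r powr (- real DIM('a))))"

lemma nn_integral_ball_le_maxfun:
  fixes f :: "'a::euclidean_space \<Rightarrow> ennreal"
  assumes "0 < t"
  shows "(\<integral>\<^sup>+y. f y * indicator (ball x t) y \<partial>lborel) \<le> maxfun f x * ennreal (t powr DIM('a))"
proof -
  have "(\<integral>\<^sup>+y. f y * indicator (ball x t) y \<partial>lborel) * ennreal (t powr (- real DIM('a))) \<le> maxfun f x"
    unfolding maxfun_def using assms by (intro SUP_upper2[where i = "(x, t)"]) auto
  then have "(\<integral>\<^sup>+y. f y * indicator (ball x t) y \<partial>lborel) * ennreal (t powr (- real DIM('a))) * ennreal (t powr DIM('a))
      \<le> maxfun f x * ennreal (t powr DIM('a))"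
    by (rule mult_right_mono) auto
  moreover have "ennreal (t powr (- real DIM('a))) * ennreal (t powr DIM('a)) = 1"
    using assms by (simp flip: ennreal_mult powr_add)
  ultimately show ?thesis by (simp add: mult.assoc)
qed

lemma measurable_maxfun [measurable]: "maxfun f \<in> borel_measurable borel"
proof (rule borel_measurableI_greater)
  fix l
  have "{x. l < maxfun f x} = (\<Union>(z, r)\<in>{(z, r). 0 < r \<and>
      l < (\<integral>\<^sup>+y. f y * indicator (ball z r) y \<partial>lborel) * ennreal (r powr (- real DIM('a)))}. ball z r)"
    unfolding set_eq_iff UN_iff by (simp add: maxfun_def less_SUP_iff Bex_def split_paired_Ex conj_ac)
  moreover have "open \<dots>" by (auto intro!: open_UN)
  ultimately show "{x \<in> space borel. l < maxfun f x} \<in> sets borel" by simp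
qed

lemma less_maxfun_iff:
  fixes f :: "'a::euclidean_space \<Rightarrow> ennreal"
  assumes "0 \<le> l"
  shows "ennreal l < maxfun f x \<longleftrightarrow>
    (\<exists>z r. 0 < r \<and> x \<in> ball z r \<and> ennreal (l * r powr DIM('a)) < (\<integral>\<^sup>+y. f y * indicator (ball z r) y \<partial>lborel))"
proof -
  have *: "ennreal l < I * ennreal (r powr (- real DIM('a))) \<longleftrightarrow> ennreal (l * r powr DIM('a)) < I" if "0 < r" for I r
  proof (cases I)
    case (real i)
    then show ?thesis using that assms
      by (simp add: ennreal_less_iff powr_minus field_simps flip: ennreal_mult)
  next
    case top
    then show ?thesis using that by (simp add: ennreal_top_mult less_top)
  qed
  show ?thesis by (simp add: maxfun_def less_SUP_iff Bex_def split_paired_Ex * conj_assoc del: mem_ball cong: conj_cong)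
qed

text \<open>The superlevel set is a union of balls of f-mass above l r^n. Vitali selects disjoint
  ones whose fivefold dilates still cover it; each dilate has volume 5^n w r^n, with w the volume of
  the unit ball, and so costs at most 5^n w / l times the mass of its ball. Disjointness bounds the
  total by the integral of f.\<close>

lemma maxfun_weak_type:
  fixes f :: "'a::euclidean_space \<Rightarrow> ennreal"
  assumes [measurable]: "f \<in> borel_measurable borel" and l: "0 < l"
  shows "ennreal l * emeasure lborel {x. ennreal l < maxfun f x} \<le>
    ennreal (5 powr DIM('a) * unit_ball_vol DIM('a)) * (\<integral>\<^sup>+x. f x \<partial>lborel)"
proof (cases "(\<integral>\<^sup>+x. f x \<partial>lborel)")
  case top
  have "0 < 5 powr DIM('a) * unit_ball_vol (real DIM('a))" by simp
  then have "ennreal (5 powr DIM('a) * unit_ball_vol (real DIM('a))) * top = top"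
    by (metis ennreal_mult_top ennreal_eq_0_iff not_le)
  then show ?thesis unfolding top by simp
next
  case (real I)
  define n where "n = real DIM('a)"
  define \<mu> where "\<mu> = density lborel f"
  define K where "K = {(z::'a, r). 0 < r \<and> ennreal (l * r powr n) < (\<integral>\<^sup>+y. f y * indicator (ball z r) y \<partial>lborel)}"
  have n: "1 \<le> n" by (simp add: n_def Suc_leI)
  have \<mu>: "emeasure \<mu> (ball z r) = (\<integral>\<^sup>+y. f y * indicator (ball z r) y \<partial>lborel)" for z r
    by (simp add: \<mu>_def emeasure_density)
  have sets: "sets \<mu> = sets borel" by (simp add: \<mu>_def)
  have S: "{x. ennreal l < maxfun f x} = (\<Union>i\<in>K. ball (fst i) (snd i))"
    using l by (auto simp: less_maxfun_iff K_def n_def simp del: mem_ball) blast+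
  \<comment> \<open>Vitali's lemma needs bounded radii. A selected ball satisfies l r^n < I with
    \<open>I\<close> the finite total mass, and r <= r^n for r >= 1 makes this a bound on r.\<close>
  have rad: "0 < snd i \<and> snd i \<le> max 1 (I / l)" if "i \<in> K" for i
  proof -
    obtain z r where i: "i = (z, r)" by force
    have r: "0 < r" "ennreal (l * r powr n) < (\<integral>\<^sup>+y. f y * indicator (ball z r) y \<partial>lborel)"
      using that by (auto simp: K_def i)
    note r(2)
    also have "(\<integral>\<^sup>+y. f y * indicator (ball z r) y \<partial>lborel) \<le> (\<integral>\<^sup>+y. f y \<partial>lborel)"
      by (intro nn_integral_mono) (auto split: split_indicator)
    finally have "l * r powr n < I" using real l by (simp add: ennreal_less_iff)
    moreover have "r \<le> r powr n" if "1 \<le> r" using powr_mono[of 1 n r] that n by simp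
    ultimately have "1 \<le> r \<Longrightarrow> r * l \<le> I" using l by (smt (verit) mult.commute mult_left_mono)
    then show ?thesis using r l by (cases "1 \<le> r") (auto simp: i le_max_iff_disj field_simps)
  qed
  obtain C where C: "countable C" "C \<subseteq> K"
     and disj: "pairwise (\<lambda>i j. disjnt (ball (fst i) (snd i)) (ball (fst j) (snd j))) C"
     and cov: "(\<Union>i\<in>K. ball (fst i) (snd i)) \<subseteq> (\<Union>i\<in>C. ball (fst i) (5 * snd i))"
    by (rule Vitali_covering_lemma_balls[where a = fst and r = snd and K = K, OF order_refl rad]) (blast intro: that)+
  have "emeasure lborel {x. ennreal l < maxfun f x} \<le> emeasure lborel (\<Union>i\<in>C. ball (fst i) (5 * snd i))"
    using C cov by (intro emeasure_mono) (auto simp: S)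
  also have "\<dots> \<le> (\<integral>\<^sup>+i. emeasure lborel (ball (fst i) (5 * snd i)) \<partial>count_space C)"
    using C by (intro emeasure_UN_le_count_space) auto
  finally have "ennreal l * emeasure lborel {x. ennreal l < maxfun f x}
    \<le> ennreal l * (\<integral>\<^sup>+i. emeasure lborel (ball (fst i) (5 * snd i)) \<partial>count_space C)"
    by (rule mult_left_mono) auto
  also have "\<dots> = (\<integral>\<^sup>+i. ennreal l * emeasure lborel (ball (fst i) (5 * snd i)) \<partial>count_space C)"
    by (simp add: nn_integral_cmult)
  also have "\<dots> \<le> (\<integral>\<^sup>+i. ennreal (5 powr n * unit_ball_vol n) * emeasure \<mu> (ball (fst i) (snd i)) \<partial>count_space C)"
  proof (intro nn_integral_mono)
    fix i assume "i \<in> space (count_space C)"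
    then have "i \<in> K" using C by auto
    then obtain z r where i: "i = (z, r)" "0 < r" "ennreal (l * r powr n) \<le> emeasure \<mu> (ball z r)"
      by (cases i) (auto simp: K_def \<mu>)
    have "ennreal l * emeasure lborel (ball z (5 * r)) = ennreal (5 powr n * unit_ball_vol n) * ennreal (l * r powr n)"
      using i l by (simp add: emeasure_ball_powr powr_mult n_def mult_ac flip: ennreal_mult)
    also have "\<dots> \<le> ennreal (5 powr n * unit_ball_vol n) * emeasure \<mu> (ball z r)"
      using i by (intro mult_left_mono) auto
    finally show "ennreal l * emeasure lborel (ball (fst i) (5 * snd i)) \<le> 
        ennreal (5 powr n * unit_ball_vol n) * emeasure \<mu> (ball (fst i) (snd i))" by (simp add: i)
  qed
  also have "\<dots> = ennreal (5 powr n * unit_ball_vol n) * (\<integral>\<^sup>+i. emeasure \<mu> (ball (fst i) (snd i)) \<partial>count_space C)"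
    by (simp add: nn_integral_cmult)
  also have "(\<integral>\<^sup>+i. emeasure \<mu> (ball (fst i) (snd i)) \<partial>count_space C) = emeasure \<mu> (\<Union>i\<in>C. ball (fst i) (snd i))"
    using C disj by (intro emeasure_UN_countable[symmetric])
      (auto simp: sets disjoint_family_on_def pairwise_def disjnt_def)
  also have "\<dots> \<le> emeasure \<mu> (space \<mu>)" by (rule emeasure_space)
  also have "emeasure \<mu> (space \<mu>) = (\<integral>\<^sup>+x. f x \<partial>lborel)"
    by (simp add: \<mu>_def emeasure_density)
  finally show ?thesis by (simp add: n_def mult_left_mono)
qed

text \<open>With w the volume of the unit ball, values of f up to l / (2 w) put mass at most (l / 2)
  r^n on a ball of radius r. So where the maximal function exceeds l, that of the truncated f
  exceeds l / 2. This form is what makes the integral over levels converge in the strong type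
  bound.\<close>

lemma maxfun_weak_type_truncated:
  fixes f :: "'a::euclidean_space \<Rightarrow> ennreal"
  assumes [measurable]: "f \<in> borel_measurable borel" and l: "0 < l"
  shows "ennreal l * emeasure lborel {x. ennreal l < maxfun f x} \<le>
    ennreal (2 * 5 powr DIM('a) * unit_ball_vol DIM('a)) *
      (\<integral>\<^sup>+x. f x * indicator {x. ennreal (l / (2 * unit_ball_vol DIM('a))) < f x} x \<partial>lborel)"
proof -
  define n where "n = real DIM('a)"
  define w where "w = unit_ball_vol n"
  define m where "m = l / (2 * w)"
  define g where "g x = f x * indicator {x. ennreal m < f x} x" for x
  have [measurable]: "g \<in> borel_measurable borel" unfolding g_def by measurable
  have w: "0 < w" by (simp add: w_def n_def)
  have m: "0 < m" using l w by (simp add: m_def)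
  have "{x. ennreal l < maxfun f x} \<subseteq> {x. ennreal (l / 2) < maxfun g x}"
  proof safe
    fix x assume "ennreal l < maxfun f x"
    then obtain z r where r: "0 < r" "x \<in> ball z r"
      "ennreal (l * r powr n) < (\<integral>\<^sup>+y. f y * indicator (ball z r) y \<partial>lborel)"
      using l by (auto simp: less_maxfun_iff n_def simp del: mem_ball)
    have "(\<integral>\<^sup>+y. f y * indicator (ball z r) y \<partial>lborel)
        \<le> (\<integral>\<^sup>+y. g y * indicator (ball z r) y + ennreal m * indicator (ball z r) y \<partial>lborel)"
      by (intro nn_integral_mono) (auto simp: g_def split: split_indicator)
    also have "\<dots> = (\<integral>\<^sup>+y. g y * indicator (ball z r) y \<partial>lborel) + ennreal m * emeasure lborel (ball z r)"
      by (simp add: nn_integral_add nn_integral_cmult_indicator)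
    also have "ennreal m * emeasure lborel (ball z r) = ennreal (l / 2 * r powr n)"
      using r w m unfolding m_def by (simp add: emeasure_ball_powr flip: n_def w_def ennreal_mult)
    finally have *: "ennreal (l * r powr n) < (\<integral>\<^sup>+y. g y * indicator (ball z r) y \<partial>lborel) + ennreal (l / 2 * r powr n)"
      using r by (simp add: order_less_le_trans)
    have "ennreal (l / 2 * r powr n) < (\<integral>\<^sup>+y. g y * indicator (ball z r) y \<partial>lborel)"
    proof (rule ccontr)
      assume "\<not> ?thesis"
      then have "(\<integral>\<^sup>+y. g y * indicator (ball z r) y \<partial>lborel) + ennreal (l / 2 * r powr n)
          \<le> ennreal (l / 2 * r powr n) + ennreal (l / 2 * r powr n)"
        by (intro add_right_mono) simp
      also have "\<dots> = ennreal (l * r powr n)" using l by (simp flip: ennreal_plus)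
      finally show False using * by simp
    qed
    then show "ennreal (l / 2) < maxfun g x"
      using r l by (auto simp: less_maxfun_iff n_def simp del: mem_ball)
  qed
  then have "ennreal l * emeasure lborel {x. ennreal l < maxfun f x} \<le> ennreal l * emeasure lborel {x. ennreal (l / 2) < maxfun g x}"
    by (intro mult_left_mono emeasure_mono) auto
  also have "\<dots> = ennreal 2 * (ennreal (l / 2) * emeasure lborel {x. ennreal (l / 2) < maxfun g x})"
    using l by (simp add: mult.assoc[symmetric] del: ennreal_numeral flip: ennreal_mult)
  also have "\<dots> \<le> ennreal 2 * (ennreal (5 powr n * w) * (\<integral>\<^sup>+x. g x \<partial>lborel))"
    unfolding n_def w_def using l by (intro mult_left_mono maxfun_weak_type) auto
  also have "\<dots> = ennreal (2 * 5 powr n * w) * (\<integral>\<^sup>+x. g x \<partial>lborel)"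
    using w by (simp add: mult.assoc[symmetric] del: ennreal_numeral flip: ennreal_mult)
  finally show ?thesis by (simp add: g_def m_def w_def n_def)
qed

text \<open>The half of the layer-cake formula that the strong type bound uses. For m = top the
  right-hand side dominates every finite power, hence is infinite.\<close>

lemma epowr_le_layer_cake:
  assumes p: "0 < p"
  shows "m epowr p \<le> (\<integral>\<^sup>+l. ennreal (p * l powr (p - 1)) * indicator {l. 0 < l \<and> ennreal l < m} l \<partial>lborel)"
proof -
  have fin: "ennreal c epowr p = (\<integral>\<^sup>+l. ennreal (p * l powr (p - 1)) * indicator {0<..<c} l \<partial>lborel)" if "0 \<le> c" for c
  proof -
    have "(\<integral>\<^sup>+l. ennreal (p * l powr (p - 1)) * indicator {0<..<c} l \<partial>lborel)
        = ennreal p * (\<integral>\<^sup>+l. ennreal (l powr (p - 1)) * indicator {0<..<c} l \<partial>lborel)"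
      using p by (simp add: ennreal_mult mult.assoc nn_integral_cmult)
    also have "\<dots> = ennreal (c powr p)"
      using p that by (simp add: nn_integral_powr_Ioo flip: ennreal_mult)
    finally show ?thesis using that by (simp add: epowr_ennreal)
  qed
  show ?thesis
  proof (cases m)
    case (real c)
    then have "{l. 0 < l \<and> ennreal l < m} = {0<..<c}" by (auto simp: ennreal_less_iff)
    then show ?thesis using real fin by simp
  next
    case top
    let ?J = "\<integral>\<^sup>+l. ennreal (p * l powr (p - 1)) * indicator {l. 0 < l \<and> ennreal l < m} l \<partial>lborel"
    have ge: "ennreal c epowr p \<le> ?J" if "0 \<le> c" for c
      unfolding fin[OF that] by (intro nn_integral_mono) (auto simp: top split: split_indicator)
    have "?J = top"
    proof (rule ccontr)
      assume "?J \<noteq> top"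
      then obtain v where v: "?J = ennreal v" "0 \<le> v" by (cases ?J) auto
      have "ennreal ((v + 1) powr (1 / p)) epowr p = ennreal (v + 1)"
        using p v by (simp add: epowr_ennreal powr_powr)
      then have "ennreal (v + 1) \<le> ennreal v" using ge[of "(v + 1) powr (1 / p)"] v by simp
      then show False using v by simp
    qed
    then show ?thesis by simp
  qed
qed

text \<open>Marcinkiewicz interpolation: layer cake, Fubini, the truncated weak type bound at each
  level, and Fubini back. What remains is the integral of l^(p - 2) over 0 < l < f(x) / c, finite at
  0 because p > 1.\<close>

lemma maxfun_strong_type:
  assumes p: "1 < p"
  shows "\<exists>C>0. \<forall>f::'a::euclidean_space \<Rightarrow> ennreal. f \<in> borel_measurable borel \<longrightarrow>
    (\<integral>\<^sup>+x. maxfun f x epowr p \<partial>lborel) \<le> ennreal C * (\<integral>\<^sup>+x. f x epowr p \<partial>lborel)"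
proof -
  define c where "c = 1 / (2 * unit_ball_vol (real DIM('a)))"
  define A where "A = 2 * 5 powr DIM('a) * unit_ball_vol (real DIM('a))"
  \<comment> \<open>\<open>A\<close> is the weak type constant, \<open>p\<close> comes from the
    layer cake, and the last factor from integrating l^(p - 2) up to y / c; the remaining y^(p - 1)
    joins the factor y to form y^p.\<close>
  define C where "C = A * p * ((1 / c) powr (p - 1) / (p - 1))"
  have c: "0 < c" and A: "0 < A" by (auto simp: c_def A_def)
  have C: "0 < C" using p c A by (auto simp: C_def)
  moreover have "(\<integral>\<^sup>+x. maxfun f x epowr p \<partial>lborel) \<le> ennreal C * (\<integral>\<^sup>+x. f x epowr p \<partial>lborel)"
    if [measurable]: "f \<in> borel_measurable borel" for f :: "'a \<Rightarrow> ennreal"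
  proof -
    have "(\<integral>\<^sup>+x. maxfun f x epowr p \<partial>lborel) \<le>
      (\<integral>\<^sup>+x. (\<integral>\<^sup>+l. ennreal (p * l powr (p - 1)) * indicator {l. 0 < l \<and> ennreal l < maxfun f x} l \<partial>lborel) \<partial>lborel)"
      using p by (intro nn_integral_mono epowr_le_layer_cake) auto
    also have "\<dots> = (\<integral>\<^sup>+l. (\<integral>\<^sup>+x. ennreal (p * l powr (p - 1)) * indicator {l. 0 < l \<and> ennreal l < maxfun f x} l \<partial>lborel) \<partial>lborel)"
      by (rule lborel_pair.Fubini'[symmetric]) measurable
    also have "\<dots> \<le> (\<integral>\<^sup>+l. (\<integral>\<^sup>+x. ennreal (A * p) * (f x * (ennreal (l powr (p - 1 - 1)) * indicator {l. 0 < l \<and> ennreal (l * c) < f x} l)) \<partial>lborel) \<partial>lborel)"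
    proof (rule nn_integral_mono)
      fix l :: real
      show "(\<integral>\<^sup>+x. ennreal (p * l powr (p - 1)) * indicator {l. 0 < l \<and> ennreal l < maxfun f x} l \<partial>lborel)
        \<le> (\<integral>\<^sup>+x. ennreal (A * p) * (f x * (ennreal (l powr (p - 1 - 1)) * indicator {l. 0 < l \<and> ennreal (l * c) < f x} l)) \<partial>lborel)"
      proof (cases "0 < l")
        case True
        have "(\<integral>\<^sup>+x. ennreal (p * l powr (p - 1)) * indicator {l. 0 < l \<and> ennreal l < maxfun f x} l \<partial>lborel)
          = (\<integral>\<^sup>+x. ennreal (p * l powr (p - 1)) * indicator {x. ennreal l < maxfun f x} x \<partial>lborel)"
          using True by (intro nn_integral_cong) (auto split: split_indicator)
        also have "\<dots> = ennreal (p * l powr (p - 1)) * emeasure lborel {x. ennreal l < maxfun f x}"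
          by (rule nn_integral_cmult_indicator) measurable
        also have "\<dots> = ennreal (p * l powr (p - 1 - 1)) * (ennreal l * emeasure lborel {x. ennreal l < maxfun f x})"
        proof -
          have eq: "p * l powr (p - 1) = p * l powr (p - 1 - 1) * l"
            using True powr_mult_base[of l "p - 1 - 1"] by (simp add: mult_ac)
          have "ennreal (p * l powr (p - 1)) = ennreal (p * l powr (p - 1 - 1)) * ennreal l"
            unfolding eq using True p by (intro ennreal_mult) auto
          then show ?thesis by (simp only: mult.assoc)
        qed
        also have "\<dots> \<le> ennreal (p * l powr (p - 1 - 1)) * (ennreal A * (\<integral>\<^sup>+x. f x * indicator {x. ennreal (l * c) < f x} x \<partial>lborel))"
          using maxfun_weak_type_truncated[of f l] True by (intro mult_left_mono) (auto simp: A_def c_def)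
        also have "\<dots> = ennreal (A * p * l powr (p - 1 - 1)) * (\<integral>\<^sup>+x. f x * indicator {x. ennreal (l * c) < f x} x \<partial>lborel)"
          using A p by (simp add: ennreal_mult mult_ac)
        also have "\<dots> = (\<integral>\<^sup>+x. ennreal (A * p * l powr (p - 1 - 1)) * (f x * indicator {x. ennreal (l * c) < f x} x) \<partial>lborel)"
          by (rule nn_integral_cmult[symmetric]) measurable
        also have "\<dots> = (\<integral>\<^sup>+x. ennreal (A * p) * (f x * (ennreal (l powr (p - 1 - 1)) * indicator {l. 0 < l \<and> ennreal (l * c) < f x} l)) \<partial>lborel)"
          using True A p by (intro nn_integral_cong) (auto simp: ennreal_mult mult_ac split: split_indicator)
        finally show ?thesis .
      qed simp
    qed
    also have "\<dots> = (\<integral>\<^sup>+x. (\<integral>\<^sup>+l. ennreal (A * p) * (f x * (ennreal (l powr (p - 1 - 1)) * indicator {l. 0 < l \<and> ennreal (l * c) < f x} l)) \<partial>lborel) \<partial>lborel)"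
      by (rule lborel_pair.Fubini') measurable
    also have "\<dots> \<le> (\<integral>\<^sup>+x. ennreal C * f x epowr p \<partial>lborel)"
    proof (intro nn_integral_mono)
      fix x
      show "(\<integral>\<^sup>+l. ennreal (A * p) * (f x * (ennreal (l powr (p - 1 - 1)) * indicator {l. 0 < l \<and> ennreal (l * c) < f x} l)) \<partial>lborel)
          \<le> ennreal C * f x epowr p"
      proof (cases "f x")
        case top
        then show ?thesis using C by (simp add: ennreal_mult_top)
      next
        case (real y)
        have "{l. 0 < l \<and> ennreal (l * c) < f x} = {0<..<y / c}"
          using c real by (auto simp: ennreal_less_iff field_simps)
        then have "(\<integral>\<^sup>+l. ennreal (A * p) * (f x * (ennreal (l powr (p - 1 - 1)) * indicator {l. 0 < l \<and> ennreal (l * c) < f x} l)) \<partial>lborel)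
          = ennreal (A * p) * (f x * (\<integral>\<^sup>+l. ennreal (l powr (p - 1 - 1)) * indicator {0<..<y / c} l \<partial>lborel))"
          by (simp add: nn_integral_cmult)
        also have "\<dots> = ennreal (A * p * (y * ((y / c) powr (p - 1) / (p - 1))))"
          using nn_integral_powr_Ioo[of "p - 1" "y / c"] p c A real
          by (simp add: ennreal_mult del: times_divide_eq_right)
        also have "A * p * (y * ((y / c) powr (p - 1) / (p - 1))) = C * y powr p"
          using c real p by (cases "y = 0") (simp_all add: C_def powr_divide powr_diff field_simps)
        finally show ?thesis using real C by (simp add: epowr_ennreal ennreal_mult)
      qed
    qed
    also have "\<dots> = ennreal C * (\<integral>\<^sup>+x. f x epowr p \<partial>lborel)"
      by (simp add: nn_integral_cmult)
    finally show ?thesis .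
  qed
  ultimately show ?thesis by blast
qed

section \<open>The weighted Hardy-Littlewood-Sobolev inequality\<close>

abbreviation weighted :: "real \<Rightarrow> ('a::euclidean_space \<Rightarrow> ennreal) \<Rightarrow> 'a \<Rightarrow> ennreal" where
  "weighted \<sigma> g \<equiv> (\<lambda>y. ennreal (norm y powr \<sigma>) * g y)"

text \<open>Hoelder with exponent n / Z on g. The conjugate exponent is Q = n / (n - Z), and the
  Q-th power |y|^(\<sigma> Q) of the weight is locally integrable precisely because Z < n +
  \<sigma>.\<close>

lemma nn_integral_weighted_ball_le:
  fixes Z \<sigma> :: real
  assumes Z: "0 < Z" "Z < real DIM('a::euclidean_space) + \<sigma>" and \<sigma>: "\<sigma> \<le> 0"
  shows "\<exists>C>0. \<forall>(g::'a \<Rightarrow> ennreal) x t. g \<in> borel_measurable borel \<longrightarrow> 0 < t \<longrightarrow>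
    (\<integral>\<^sup>+y. weighted \<sigma> g y * indicator (ball x t) y \<partial>lborel) \<le>
    ennreal (C * t powr (DIM('a) + \<sigma> - Z)) *
      (\<integral>\<^sup>+y. g y epowr (DIM('a) / Z) * indicator (ball x t) y \<partial>lborel) epowr (Z / DIM('a))"
proof -
  define n where "n = real DIM('a)"
  define P where "P = n / Z"
  define Q where "Q = n / (n - Z)"
  define b where "b = - \<sigma> * Q"
  have n: "0 < n" "Z < n" using Z \<sigma> by (auto simp: n_def)
  have PQ: "1 < P" "1 < Q" "1 / P + 1 / Q = 1"
    using n Z by (auto simp: P_def Q_def field_simps)
  have "0 \<le> b" using PQ \<sigma> by (simp add: b_def mult_nonpos_nonneg)
  moreover have "b < n" using mult_strict_left_mono[of Z "n + \<sigma>" n] Z n by (simp add: b_def Q_def n_def field_simps)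
  ultimately obtain C0 where C0: "0 < C0" and w: "\<And>(x::'a) t. 0 < t \<Longrightarrow>
    (\<integral>\<^sup>+y. ennreal (norm y powr (- b)) * indicator (ball x t) y \<partial>lborel) \<le> ennreal (C0 * t powr (n - b))"
    using nn_integral_norm_powr_ball[of b] unfolding n_def by blast
  have e: "(n - b) / Q = n + \<sigma> - Z"
    using n PQ Z by (simp add: b_def Q_def field_simps)
  have "(\<integral>\<^sup>+y. weighted \<sigma> g y * indicator (ball x t) y \<partial>lborel) \<le>
    ennreal (C0 powr (1 / Q) * t powr (n + \<sigma> - Z)) *
      (\<integral>\<^sup>+y. g y epowr (n / Z) * indicator (ball x t) y \<partial>lborel) epowr (Z / n)"
    if [measurable]: "g \<in> borel_measurable borel" and t: "0 < t" for g and x :: 'a and t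
  proof -
    have "(\<integral>\<^sup>+y. weighted \<sigma> g y * indicator (ball x t) y \<partial>lborel)
       = (\<integral>\<^sup>+y. (ennreal (norm y powr \<sigma>) * indicator (ball x t) y) * (g y * indicator (ball x t) y) \<partial>lborel)"
      by (intro nn_integral_cong) (auto split: split_indicator)
    also have "\<dots> \<le> (\<integral>\<^sup>+y. (ennreal (norm y powr \<sigma>) * indicator (ball x t) y) epowr Q \<partial>lborel) epowr (1 / Q)
       * (\<integral>\<^sup>+y. (g y * indicator (ball x t) y) epowr P \<partial>lborel) epowr (1 / P)"
      using PQ by (intro Hoelder_nn_integral) auto
    also have "(\<integral>\<^sup>+y. (ennreal (norm y powr \<sigma>) * indicator (ball x t) y) epowr Q \<partial>lborel)
       = (\<integral>\<^sup>+y. ennreal (norm y powr (- b)) * indicator (ball x t) y \<partial>lborel)"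
      by (intro nn_integral_cong) (auto simp: epowr_ennreal powr_powr b_def split: split_indicator)
    also have "(\<integral>\<^sup>+y. (g y * indicator (ball x t) y) epowr P \<partial>lborel)
       = (\<integral>\<^sup>+y. g y epowr (n / Z) * indicator (ball x t) y \<partial>lborel)"
      by (intro nn_integral_cong) (auto simp: P_def split: split_indicator)
    also have "(\<integral>\<^sup>+y. ennreal (norm y powr (- b)) * indicator (ball x t) y \<partial>lborel) epowr (1 / Q)
       \<le> ennreal (C0 * t powr (n - b)) epowr (1 / Q)"
      using PQ by (intro epowr_mono w t) auto
    also have "\<dots> = ennreal (C0 powr (1 / Q) * t powr (n + \<sigma> - Z))"
      using C0 e by (simp add: epowr_ennreal powr_mult powr_powr)
    finally show ?thesis by (simp add: P_def mult_right_mono)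
  qed
  then show ?thesis using C0 unfolding n_def by (intro exI[of _ "C0 powr (1 / Q)"]) auto
qed

text \<open>The value of \<open>Z\<close> is dictated by homogeneity: a density |y|^(\<sigma> - Z)
  has a potential homogeneous of degree - X. The mass on small balls is bounded by a maximal
  function with the power t^(b + A), that on large balls by the L^(n/Z) norm with the power t^(b -
  B), where A = n + \<sigma> - b and B = a X; then \<open>wpot_le_interpolate\<close> applies
  pointwise.\<close>

lemma wpot_weighted_HLS:
  fixes a b \<sigma> X Z :: real
  assumes a: "0 < a" and \<sigma>: "\<sigma> \<le> 0" and A: "b < DIM('a) + \<sigma>" and X: "0 < X" "a * X < b"
    and Z: "Z = DIM('a) + \<sigma> - b + a * X"
  shows "\<exists>C>0. \<forall>g::'a::euclidean_space \<Rightarrow> ennreal. g \<in> borel_measurable borel \<longrightarrow>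
    (\<integral>\<^sup>+x. wpot a b (weighted \<sigma> g) x epowr (DIM('a) / X) \<partial>lborel) \<le>
      ennreal C * (\<integral>\<^sup>+y. g y epowr (DIM('a) / Z) \<partial>lborel) epowr (Z / (a * X))"
proof -
  define n where "n = real DIM('a)"
  define A where "A = n + \<sigma> - b"
  define B where "B = a * X"
  \<comment> \<open>A value strictly between Z and n + \<sigma>: below n + \<sigma> for the weighted
    Hoelder bound, above Z so that the maximal theorem applies to g^(n/Z') with exponent Z'/Z > 1.
    The \<eta> of the overview is n / Z'.\<close>
  define Z' where "Z' = (Z + (n + \<sigma>)) / 2"
  have n: "0 < n" by (simp add: n_def)
  have AB: "0 < A" "0 < B" "Z = A + B" "0 < Z" "Z < n + \<sigma>"
    unfolding A_def B_def n_def using assms mult_pos_pos[OF a X(1)] by linarith+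
  have Z': "Z < Z'" "Z' < n + \<sigma>" "0 < Z'" using AB by (auto simp: Z'_def)
  obtain C1 where C1: "0 < C1" "\<And>(g::'a \<Rightarrow> ennreal) x t. g \<in> borel_measurable borel \<Longrightarrow> 0 < t \<Longrightarrow>
    (\<integral>\<^sup>+y. weighted \<sigma> g y * indicator (ball x t) y \<partial>lborel) \<le>
    ennreal (C1 * t powr (n + \<sigma> - Z')) * (\<integral>\<^sup>+y. g y epowr (n / Z') * indicator (ball x t) y \<partial>lborel) epowr (Z' / n)"
    using nn_integral_weighted_ball_le[OF Z'(3), of \<sigma>, where 'a = 'a, folded n_def, OF Z'(2) \<sigma>] by blast
  obtain C2 where C2: "0 < C2" "\<And>(g::'a \<Rightarrow> ennreal) x t. g \<in> borel_measurable borel \<Longrightarrow> 0 < t \<Longrightarrow>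
    (\<integral>\<^sup>+y. weighted \<sigma> g y * indicator (ball x t) y \<partial>lborel) \<le>
    ennreal (C2 * t powr (n + \<sigma> - Z)) * (\<integral>\<^sup>+y. g y epowr (n / Z) * indicator (ball x t) y \<partial>lborel) epowr (Z / n)"
    using nn_integral_weighted_ball_le[OF AB(4), of \<sigma>, where 'a = 'a, folded n_def, OF AB(5) \<sigma>] by blast
  have "1 < Z' / Z" using Z' AB by simp
  from maxfun_strong_type[OF this] obtain C3 where C3: "0 < C3"
    "\<And>f::'a \<Rightarrow> ennreal. f \<in> borel_measurable borel \<Longrightarrow>
    (\<integral>\<^sup>+x. maxfun f x epowr (Z' / Z) \<partial>lborel) \<le> ennreal C3 * (\<integral>\<^sup>+x. f x epowr (Z' / Z) \<partial>lborel)"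
    by blast
  define c where "c = (a / A + a / B) powr (n / X) * (C1 powr (n / Z) * C2 powr (A / Z * n / B))"
  have "0 < a / A + a / B" using a AB by (simp add: add_pos_pos)
  then have c: "0 < c" using C1 C2 by (simp add: c_def)
  have "(\<integral>\<^sup>+x. wpot a b (weighted \<sigma> g) x epowr (n / X) \<partial>lborel) \<le>
      ennreal (c * C3) * (\<integral>\<^sup>+y. g y epowr (n / Z) \<partial>lborel) epowr (Z / B)"
    if [measurable]: "g \<in> borel_measurable borel" for g :: "'a \<Rightarrow> ennreal"
  proof -
    define I where "I = (\<integral>\<^sup>+y. g y epowr (n / Z) \<partial>lborel)"
    define h where "h y = g y epowr (n / Z')" for y
    have [measurable]: "h \<in> borel_measurable borel" unfolding h_def by measurable
    have eq_pos: "0 < n / Z" "0 < A / Z * n / B" "0 < n / X" "0 < 1 / a"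
      using n AB a X by auto
    have exps: "(k * (M epowr (B / Z) * L epowr (A / Z)) epowr (1 / a)) epowr (n / X)
        = k epowr (n / X) * (M epowr (n / Z) * L epowr (A / Z * n / B))" for k M L
    proof -
      have "B / Z * (1 / a * (n / X)) = n / Z" "A / Z * (1 / a * (n / X)) = A / Z * n / B"
        using a X AB by (simp_all add: B_def)
      then show ?thesis
        by (simp only: epowr_mult[OF eq_pos(3)] epowr_mult[OF eq_pos(4)] epowr_epowr mult.assoc)
    qed
    have eqs: "Z' / n * (n / Z) = Z' / Z" "Z / n * (A / Z * n / B) = A / B"
      using n AB by simp_all
    have small: "(\<integral>\<^sup>+y. weighted \<sigma> g y * indicator (ball x t) y \<partial>lborel) \<le>
        (ennreal C1 * maxfun h x epowr (Z' / n)) * ennreal (t powr (b + A))" if t: "0 < t" for x t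
    proof -
      have "(\<integral>\<^sup>+y. weighted \<sigma> g y * indicator (ball x t) y \<partial>lborel) \<le>
        ennreal (C1 * t powr (n + \<sigma> - Z')) * (\<integral>\<^sup>+y. h y * indicator (ball x t) y \<partial>lborel) epowr (Z' / n)"
        using C1(2)[of g t x] t by (simp add: h_def)
      also have "\<dots> \<le> ennreal (C1 * t powr (n + \<sigma> - Z')) * (maxfun h x * ennreal (t powr n)) epowr (Z' / n)"
        unfolding n_def using t n Z' by (intro mult_left_mono epowr_mono nn_integral_ball_le_maxfun) (auto simp: n_def)
      also have "\<dots> = ennreal (C1 * t powr (n + \<sigma> - Z')) * (maxfun h x epowr (Z' / n) * ennreal (t powr Z'))"
        using n Z' by (simp add: epowr_mult epowr_ennreal powr_powr)
      also have "\<dots> = (ennreal C1 * maxfun h x epowr (Z' / n)) * (ennreal (t powr (n + \<sigma> - Z')) * ennreal (t powr Z'))"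
        using C1 by (simp add: ennreal_mult mult_ac)
      also have "ennreal (t powr (n + \<sigma> - Z')) * ennreal (t powr Z') = ennreal (t powr (b + A))"
        by (simp add: A_def flip: ennreal_mult powr_add)
      finally show ?thesis .
    qed
    have large: "(\<integral>\<^sup>+y. weighted \<sigma> g y * indicator (ball x t) y \<partial>lborel) \<le>
        (ennreal C2 * I epowr (Z / n)) * ennreal (t powr (b - B))" if t: "0 < t" for x t
    proof -
      have "(\<integral>\<^sup>+y. weighted \<sigma> g y * indicator (ball x t) y \<partial>lborel) \<le>
        ennreal (C2 * t powr (n + \<sigma> - Z)) * (\<integral>\<^sup>+y. g y epowr (n / Z) * indicator (ball x t) y \<partial>lborel) epowr (Z / n)"
        using C2(2)[of g t x] t by simp
      also have "\<dots> \<le> ennreal (C2 * t powr (n + \<sigma> - Z)) * I epowr (Z / n)"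
        unfolding I_def using n AB
        by (intro mult_left_mono epowr_mono nn_integral_mono) (auto split: split_indicator)
      also have "\<dots> = (ennreal C2 * I epowr (Z / n)) * ennreal (t powr (n + \<sigma> - Z))"
        using C2 by (simp add: ennreal_mult mult_ac)
      also have "n + \<sigma> - Z = b - B" by (simp add: AB A_def)
      finally show ?thesis .
    qed
    \<comment> \<open>The pointwise Hedberg inequality. The outer powers 1/a and n/X turn the
      interpolation weights B/Z and A/Z into n/Z and (A/Z)(n/B), because B = a X.\<close>
    have "wpot a b (weighted \<sigma> g) x epowr (n / X) \<le> ennreal c * (maxfun h x epowr (Z' / Z) * I epowr (A / B))" for x
    proof -
      have "wpot a b (weighted \<sigma> g) x \<le> ennreal (a / A + a / B) *
        ((ennreal C1 * maxfun h x epowr (Z' / n)) epowr (B / (A + B)) * (ennreal C2 * I epowr (Z / n)) epowr (A / (A + B))) epowr (1 / a)"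
        by (rule wpot_le_interpolate[OF a AB(1,2) small large])
      then have "wpot a b (weighted \<sigma> g) x epowr (n / X) \<le> (ennreal (a / A + a / B) *
        ((ennreal C1 * maxfun h x epowr (Z' / n)) epowr (B / Z) * (ennreal C2 * I epowr (Z / n)) epowr (A / Z)) epowr (1 / a)) epowr (n / X)"
        using n X by (intro epowr_mono) (auto simp: AB(3))
      also have "\<dots> = ennreal ((a / A + a / B) powr (n / X)) *
        ((ennreal (C1 powr (n / Z)) * maxfun h x epowr (Z' / Z)) * (ennreal (C2 powr (A / Z * n / B)) * I epowr (A / B)))"
        unfolding exps epowr_mult[OF eq_pos(1)] epowr_mult[OF eq_pos(2)]
        using \<open>0 < a / A + a / B\<close> C1 C2 eqs by (simp only: epowr_epowr epowr_ennreal less_imp_le)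
      also have "\<dots> = ennreal c * (maxfun h x epowr (Z' / Z) * I epowr (A / B))"
        by (simp add: c_def ennreal_mult mult_ac)
      finally show ?thesis .
    qed
    then have "(\<integral>\<^sup>+x. wpot a b (weighted \<sigma> g) x epowr (n / X) \<partial>lborel) \<le>
        (\<integral>\<^sup>+x. ennreal c * (maxfun h x epowr (Z' / Z) * I epowr (A / B)) \<partial>lborel)"
      by (intro nn_integral_mono)
    also have "\<dots> = ennreal c * ((\<integral>\<^sup>+x. maxfun h x epowr (Z' / Z) \<partial>lborel) * I epowr (A / B))"
      by (simp add: nn_integral_cmult nn_integral_multc)
    also have "\<dots> \<le> ennreal c * ((ennreal C3 * (\<integral>\<^sup>+x. h x epowr (Z' / Z) \<partial>lborel)) * I epowr (A / B))"
      by (intro mult_left_mono mult_right_mono C3) auto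
    also have "(\<integral>\<^sup>+x. h x epowr (Z' / Z) \<partial>lborel) = I"
      using Z' by (simp add: h_def I_def epowr_epowr)
    \<comment> \<open>One power of I comes from the maximal theorem and A/B from the interpolation;
      together 1 + A/B = Z/B.\<close>
    also have "ennreal c * ((ennreal C3 * I) * I epowr (A / B)) = ennreal (c * C3) * (I epowr 1 * I epowr (A / B))"
      using c C3 by (simp add: ennreal_mult mult_ac)
    also have "I epowr 1 * I epowr (A / B) = I epowr (Z / B)"
      using AB by (subst epowr_add[symmetric]) (auto simp: add_divide_distrib add.commute)
    finally show ?thesis by (simp add: I_def)
  qed
  then show ?thesis using c C3 unfolding n_def B_def by (intro exI[of _ "c * C3"]) auto
qed

text \<open>Dominated convergence with h itself as majorant. It serves twice: to make the
  coefficient small and to discard the density near infinity.\<close>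

lemma nn_integral_tendsto_zero:
  fixes h :: "'a \<Rightarrow> ennreal"
  assumes [measurable]: "h \<in> borel_measurable M" "\<And>k. E k \<in> sets M" and fin: "(\<integral>\<^sup>+x. h x \<partial>M) < top"
    and ev: "AE x in M. \<forall>\<^sub>F k in sequentially. x \<notin> E k"
  shows "(\<lambda>k. \<integral>\<^sup>+x. h x * indicator (E k) x \<partial>M) \<longlonglongrightarrow> 0"
proof -
  have "(\<lambda>k. \<integral>\<^sup>+x. h x * indicator (E k) x \<partial>M) \<longlonglongrightarrow> (\<integral>\<^sup>+x. 0 \<partial>M)"
  proof (rule nn_integral_dominated_convergence[where w = h])
    show "AE x in M. h x * indicator (E k) x \<le> h x" for k by (auto split: split_indicator)
    show "AE x in M. (\<lambda>k. h x * indicator (E k) x) \<longlonglongrightarrow> 0"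
      using ev by eventually_elim (auto intro!: tendsto_eventually elim!: eventually_mono)
  qed (use fin in \<open>auto simp: less_top\<close>)
  then show ?thesis by simp
qed

section \<open>Regularity lifting\<close>

lemma suminf_less_top_imp_LIMSEQ_0:
  fixes f :: "nat \<Rightarrow> ennreal"
  assumes "(\<Sum>m. f m) < top"
  shows "f \<longlonglongrightarrow> 0"
proof -
  have "f m \<le> (\<Sum>m. f m)" for m using sum_le_suminf[of f "{m}"] by simp
  then have fin: "f m < top" for m using assms by (metis order_le_less_trans)
  define g where "g m = enn2real (f m)" for m
  have f: "ennreal (g m) = f m" for m by (simp add: g_def ennreal_enn2real[OF fin])
  have "summable g"
    using assms by (intro summable_suminf_not_top) (simp_all add: f, simp add: g_def)
  then have "g \<longlonglongrightarrow> 0" by (rule summable_LIMSEQ_zero)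
  then have "(\<lambda>m. ennreal (g m)) \<longlonglongrightarrow> ennreal 0" by (rule tendsto_ennrealI)
  then show ?thesis by (simp add: f)
qed

text \<open>Iterating \<open>u \<le> T u + H\<close> yields \<open>u \<le> U\<^sub>m + h\<^sub>m\<close> where \<open>U\<^sub>m \<rightarrow> 0\<close> in \<open>L\<^bsup>r\<^esup>\<close> and \<open>h\<^sub>m\<close> stays
  bounded in \<open>L\<^bsup>s\<^esup>\<close>; no a priori finiteness in \<open>L\<^bsup>s\<^esup>\<close> is required.\<close>

lemma regularity_lifting:
  fixes T :: "('a \<Rightarrow> ennreal) \<Rightarrow> 'a \<Rightarrow> ennreal" and K :: ennreal
  assumes meas [measurable]: "\<And>w. w \<in> borel_measurable M \<Longrightarrow> T w \<in> borel_measurable M"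
    and mono: "\<And>w w'. AE x in M. w x \<le> w' x \<Longrightarrow> AE x in M. T w x \<le> T w' x"
    and add: "\<And>w w' x. w \<in> borel_measurable M \<Longrightarrow> w' \<in> borel_measurable M \<Longrightarrow>
      T (\<lambda>y. w y + w' y) x \<le> K * (T w x + T w' x)"
    and rs: "0 < r" "0 < s"
    and contr_r: "\<And>w. w \<in> borel_measurable M \<Longrightarrow>
      (\<integral>\<^sup>+x. (K * T w x) epowr r \<partial>M) \<le> ennreal (1 / 2) * (\<integral>\<^sup>+x. w x epowr r \<partial>M)"
    and contr_s: "\<And>w. w \<in> borel_measurable M \<Longrightarrow>
      ennreal (2 powr s) * (\<integral>\<^sup>+x. (K * T w x) epowr s \<partial>M) \<le> ennreal (1 / 2) * (\<integral>\<^sup>+x. w x epowr s \<partial>M)"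
    and [measurable]: "u \<in> borel_measurable M" "H \<in> borel_measurable M"
    and u: "AE x in M. u x \<le> T u x + H x"
    and fin: "(\<integral>\<^sup>+x. u x epowr r \<partial>M) < top" "(\<integral>\<^sup>+x. H x epowr s \<partial>M) < top"
  shows "(\<integral>\<^sup>+x. u x epowr s \<partial>M) < top"
proof -
  \<comment> \<open>Both iterations carry the factor \<open>K\<close> that \<open>T\<close> loses on
    sums, so that u <= U m + h m persists. The contraction hypotheses include \<open>K\<close> for
    this reason, and the factor \<open>2 powr s\<close> in the second one compensates the loss in
    adding \<open>H\<close>.\<close>
  define U where "U m = ((\<lambda>w x. K * T w x) ^^ m) u" for m
  define h where "h m = ((\<lambda>w x. K * T w x + H x) ^^ m) (\<lambda>_. 0)" for m
  have U_simps: "U 0 = u" "U (Suc m) = (\<lambda>x. K * T (U m) x)" for m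
    by (simp_all add: U_def)
  have h_simps: "h 0 = (\<lambda>_. 0)" "h (Suc m) = (\<lambda>x. K * T (h m) x + H x)" for m
    by (simp_all add: h_def)
  have U_meas [measurable]: "U m \<in> borel_measurable M" for m
    by (induction m) (simp_all add: U_simps)
  have h_meas [measurable]: "h m \<in> borel_measurable M" for m
    by (induction m) (simp_all add: h_simps)
  have le: "AE x in M. u x \<le> U m x + h m x" for m
  proof (induction m)
    case (Suc m)
    from mono[OF Suc] u show ?case
    proof eventually_elim
      case (elim x)
      have "u x \<le> T (\<lambda>x. U m x + h m x) x + H x" using elim by (meson add_right_mono order_trans)
      also have "\<dots> \<le> K * (T (U m) x + T (h m) x) + H x"
        by (intro add_right_mono add) measurable
      finally show ?case by (simp add: U_simps h_simps distrib_left add.assoc)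
    qed
  qed (simp add: U_simps h_simps)
  have U_int: "(\<integral>\<^sup>+x. U m x epowr r \<partial>M) \<le> ennreal ((1 / 2) ^ m) * (\<integral>\<^sup>+x. u x epowr r \<partial>M)" for m
  proof (induction m)
    case (Suc m)
    have "(\<integral>\<^sup>+x. U (Suc m) x epowr r \<partial>M) \<le> ennreal (1 / 2) * (\<integral>\<^sup>+x. U m x epowr r \<partial>M)"
      using contr_r[OF U_meas] by (simp add: U_simps)
    also have "\<dots> \<le> ennreal (1 / 2) * (ennreal ((1 / 2) ^ m) * (\<integral>\<^sup>+x. u x epowr r \<partial>M))"
      by (intro mult_left_mono Suc) auto
    also have "\<dots> = ennreal ((1 / 2) ^ Suc m) * (\<integral>\<^sup>+x. u x epowr r \<partial>M)"
      by (subst power_Suc, subst ennreal_mult) (auto simp: mult.assoc)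
    finally show ?case .
  qed (simp add: U_simps)
  \<comment> \<open>The fixed point of B = B / 2 + 2^s times the integral of H^s, hence a bound that
    every iterate inherits.\<close>
  define B where "B = ennreal (2 * 2 powr s) * (\<integral>\<^sup>+x. H x epowr s \<partial>M)"
  have B: "B < top" using fin by (simp add: B_def ennreal_mult_less_top)
  have h_int: "(\<integral>\<^sup>+x. h m x epowr s \<partial>M) \<le> B" for m
  proof (induction m)
    case (Suc m)
    have "(\<integral>\<^sup>+x. h (Suc m) x epowr s \<partial>M) \<le> (\<integral>\<^sup>+x. ennreal (2 powr s) * ((K * T (h m) x) epowr s + H x epowr s) \<partial>M)"
      unfolding h_simps using rs by (intro nn_integral_mono epowr_add_le)
    also have "\<dots> = ennreal (2 powr s) * (\<integral>\<^sup>+x. (K * T (h m) x) epowr s \<partial>M) + ennreal (2 powr s) * (\<integral>\<^sup>+x. H x epowr s \<partial>M)"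
      by (simp add: nn_integral_cmult nn_integral_add distrib_left)
    also have "\<dots> \<le> ennreal (1 / 2) * B + ennreal (2 powr s) * (\<integral>\<^sup>+x. H x epowr s \<partial>M)"
      by (intro add_right_mono order_trans[OF contr_s[OF h_meas]] mult_left_mono Suc) auto
    also have "ennreal (2 powr s) * (\<integral>\<^sup>+x. H x epowr s \<partial>M) = ennreal (1 / 2) * B"
      unfolding B_def mult.assoc[symmetric] by (subst ennreal_mult[symmetric]) auto
    also have "ennreal (1 / 2) * B + ennreal (1 / 2) * B = B"
      unfolding distrib_right[symmetric] by (subst ennreal_plus[symmetric]) auto
    finally show ?case .
  qed (simp add: h_simps)
  \<comment> \<open>Since the integrals decay geometrically, their sum is finite, so U m(x) tends to
    0 almost everywhere without passing to a subsequence.\<close>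
  have "(\<integral>\<^sup>+x. (\<Sum>m. U m x epowr r) \<partial>M) = (\<Sum>m. \<integral>\<^sup>+x. U m x epowr r \<partial>M)"
    by (rule nn_integral_suminf) measurable
  also have "\<dots> \<le> (\<Sum>m. ennreal ((1 / 2) ^ m) * (\<integral>\<^sup>+x. u x epowr r \<partial>M))"
    by (intro suminf_le U_int) auto
  also have "\<dots> = (\<Sum>m. ennreal ((1 / 2) ^ m)) * (\<integral>\<^sup>+x. u x epowr r \<partial>M)"
    by (rule ennreal_suminf_multc)
  also have "(\<Sum>m. ennreal ((1 / 2) ^ m)) = ennreal 2"
    using geometric_sums[of "1 / 2 :: real"] by (intro suminf_ennreal_eq) auto
  also have "ennreal 2 * (\<integral>\<^sup>+x. u x epowr r \<partial>M) < top"
    using fin by (simp add: ennreal_mult_less_top del: ennreal_numeral)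
  finally have "(\<integral>\<^sup>+x. (\<Sum>m. U m x epowr r) \<partial>M) \<noteq> top" by simp
  then have "AE x in M. (\<Sum>m. U m x epowr r) \<noteq> top"
    by (intro nn_integral_PInf_AE[unfolded infinity_ennreal_def]) auto
  then have lim: "AE x in M. (\<lambda>m. U m x epowr r) \<longlonglongrightarrow> 0"
    by eventually_elim (auto intro: suminf_less_top_imp_LIMSEQ_0 simp: less_top)
  have "AE x in M. u x epowr r \<noteq> top"
    using fin by (intro nn_integral_PInf_AE[unfolded infinity_ennreal_def]) auto
  then have u_fin: "AE x in M. u x \<noteq> top" by simp
  have all: "AE x in M. \<forall>m. u x \<le> U m x + h m x"
    using le by (simp add: AE_all_countable)
  \<comment> \<open>Once U m(x) falls below u(x) / 2, it can be absorbed because u(x) is finite,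
    leaving u(x) <= 2 h m(x). Fatou's lemma then transfers the uniform bound on h m to u.\<close>
  have "AE x in M. u x epowr s \<le> liminf (\<lambda>m. ennreal (2 powr s) * h m x epowr s)"
    using lim u_fin all
  proof eventually_elim
    case (elim x)
    obtain c where c: "u x = ennreal c" "0 \<le> c" using elim(2) by (cases "u x") auto
    show ?case
    proof (cases "c = 0")
      case False
      then have "0 < ennreal (c / 2) epowr r" using c by (simp add: zero_less_iff_neq_zero)
      with elim(1) have "\<forall>\<^sub>F m in sequentially. U m x epowr r < ennreal (c / 2) epowr r"
        by (rule order_tendstoD)
      then have "\<forall>\<^sub>F m in sequentially. u x epowr s \<le> ennreal (2 powr s) * h m x epowr s"
      proof eventually_elim
        case (elim m)
        then have "U m x \<le> ennreal (c / 2)" by (meson epowr_mono not_le nle_le rs(1))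
        then have le: "ennreal c \<le> ennreal (c / 2) + h m x"
          using \<open>\<forall>m. u x \<le> U m x + h m x\<close> c by (metis add_right_mono order_trans)
        have "ennreal c \<le> ennreal 2 * h m x"
        proof (cases "h m x")
          case (real d)
          then have "c \<le> c / 2 + d" using le c by (simp add: ennreal_le_iff flip: ennreal_plus)
          then show ?thesis using real c by (simp add: ennreal_le_iff del: ennreal_numeral flip: ennreal_mult)
        qed (simp add: ennreal_mult_top del: ennreal_numeral)
        then have "ennreal c epowr s \<le> (ennreal 2 * h m x) epowr s" using rs by (intro epowr_mono)
        then show ?case using rs c by (simp add: epowr_mult epowr_ennreal del: ennreal_numeral)
      qed
      then show ?thesis by (rule Liminf_bounded)
    qed (use c in simp)
  qed
  then have "(\<integral>\<^sup>+x. u x epowr s \<partial>M) \<le> (\<integral>\<^sup>+x. liminf (\<lambda>m. ennreal (2 powr s) * h m x epowr s) \<partial>M)"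
    by (rule nn_integral_mono_AE)
  also have "\<dots> \<le> liminf (\<lambda>m. \<integral>\<^sup>+x. ennreal (2 powr s) * h m x epowr s \<partial>M)"
    by (rule nn_integral_liminf) measurable
  also have "\<dots> \<le> liminf (\<lambda>m. ennreal (2 powr s) * B)"
    by (intro Liminf_mono always_eventually allI) (simp add: nn_integral_cmult mult_left_mono h_int)
  also have "\<dots> = ennreal (2 powr s) * B" by (simp add: Liminf_const)
  also have "\<dots> < top" using B by (simp add: ennreal_mult_less_top)
  finally show ?thesis .
qed

section \<open>Potentials of degree one with a small coefficient\<close>

lemma wpot_cmult:
  fixes F :: "'a::euclidean_space \<Rightarrow> ennreal"
  assumes [measurable]: "F \<in> borel_measurable borel" and a: "0 < a"
  shows "wpot a b (\<lambda>y. c * F y) x = c epowr (1 / a) * wpot a b F x"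
proof -
  have "wpot a b (\<lambda>y. c * F y) x = (\<integral>\<^sup>+t. c epowr (1 / a) * (((\<integral>\<^sup>+y. F y * indicator (ball x t) y \<partial>lborel) * ennreal (t powr (- b))) epowr (1 / a)
     * ennreal (1 / t) * indicator {0<..} t) \<partial>lborel)"
    unfolding wpot_def using a
    by (intro nn_integral_cong) (simp add: mult.assoc nn_integral_cmult epowr_mult)
  also have "\<dots> = c epowr (1 / a) * wpot a b F x"
    unfolding wpot_def by (rule nn_integral_cmult) measurable
  finally show ?thesis .
qed

text \<open>The power \<open>v\<^bsup>s + a\<^esup>\<close> is split to make the potential homogeneous of degree one in \<open>w\<close>; the original
  potential is recovered for \<open>w = v\<close>.\<close>

definition split_wpot :: "real \<Rightarrow> real \<Rightarrow> real \<Rightarrow> real \<Rightarrow> ('a::euclidean_space \<Rightarrow> ennreal) \<Rightarrow> ('a \<Rightarrow> ennreal) \<Rightarrow> 'a \<Rightarrow> ennreal" where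
  "split_wpot a b \<sigma> s v w = wpot a b (weighted \<sigma> (\<lambda>y. v y epowr s * w y epowr a))"

lemma measurable_split_wpot [measurable]:
  assumes [measurable]: "v \<in> borel_measurable borel" "w \<in> borel_measurable borel"
  shows "split_wpot a b \<sigma> s v w \<in> borel_measurable borel"
  unfolding split_wpot_def by measurable

lemma split_wpot_mono_AE:
  assumes "0 < a" "AE y in lborel. w y \<le> w' y"
  shows "split_wpot a b \<sigma> s v w x \<le> split_wpot a b \<sigma> s v w' x"
  unfolding split_wpot_def
  by (rule wpot_mono_AE[OF assms(1)]) (use assms(2) in eventually_elim, intro mult_left_mono epowr_mono, use assms(1) in auto)

lemma split_wpot_cmult:
  fixes v w :: "'a::euclidean_space \<Rightarrow> ennreal"
  assumes [measurable]: "v \<in> borel_measurable borel" "w \<in> borel_measurable borel" and a: "0 < a"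
  shows "split_wpot a b \<sigma> s v (\<lambda>y. c * w y) x = c * split_wpot a b \<sigma> s v w x"
proof -
  have "split_wpot a b \<sigma> s v (\<lambda>y. c * w y) x
      = wpot a b (\<lambda>y. c epowr a * weighted \<sigma> (\<lambda>y. v y epowr s * w y epowr a) y) x"
    unfolding split_wpot_def using a by (simp add: epowr_mult mult_ac)
  also have "\<dots> = c * split_wpot a b \<sigma> s v w x"
    unfolding split_wpot_def using a by (subst wpot_cmult) (simp_all add: epowr_epowr)
  finally show ?thesis .
qed

text \<open>Expanding (w + w')^a costs 2^a, which the degree 1/a of the potential turns into 2;
  adding the two densities costs another 2^(1/a).\<close>

lemma split_wpot_add_le:
  fixes v w w' :: "'a::euclidean_space \<Rightarrow> ennreal"
  assumes [measurable]: "v \<in> borel_measurable borel" "w \<in> borel_measurable borel" "w' \<in> borel_measurable borel" and a: "0 < a"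
  shows "split_wpot a b \<sigma> s v (\<lambda>y. w y + w' y) x
    \<le> ennreal (2 * 2 powr (1 / a)) * (split_wpot a b \<sigma> s v w x + split_wpot a b \<sigma> s v w' x)"
proof -
  let ?F = "weighted \<sigma> (\<lambda>y. v y epowr s * w y epowr a)" and ?G = "weighted \<sigma> (\<lambda>y. v y epowr s * w' y epowr a)"
  have "split_wpot a b \<sigma> s v (\<lambda>y. w y + w' y) x \<le> wpot a b (\<lambda>y. ennreal (2 powr a) * (?F y + ?G y)) x"
    unfolding split_wpot_def
  proof (intro wpot_mono_AE a AE_I2)
    fix y
    have "weighted \<sigma> (\<lambda>y. v y epowr s * (w y + w' y) epowr a) y
       \<le> weighted \<sigma> (\<lambda>y. v y epowr s * (ennreal (2 powr a) * (w y epowr a + w' y epowr a))) y"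
      using a by (intro mult_left_mono epowr_add_le) auto
    then show "weighted \<sigma> (\<lambda>y. v y epowr s * (w y + w' y) epowr a) y \<le> ennreal (2 powr a) * (?F y + ?G y)"
      by (simp add: algebra_simps)
  qed
  also have "\<dots> = ennreal 2 * wpot a b (\<lambda>y. ?F y + ?G y) x"
    using a by (subst wpot_cmult) (simp_all add: epowr_ennreal powr_powr del: ennreal_numeral)
  also have "\<dots> \<le> ennreal 2 * (ennreal (2 powr (1 / a)) * (wpot a b ?F x + wpot a b ?G x))"
    using a by (intro mult_left_mono wpot_add_le) auto
  also have "\<dots> = ennreal (2 * 2 powr (1 / a)) * (split_wpot a b \<sigma> s v w x + split_wpot a b \<sigma> s v w' x)"
    by (simp only: ennreal_mult split_wpot_def mult.assoc powr_ge_zero zero_le_numeral)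
  finally show ?thesis .
qed

text \<open>The Hardy-Littlewood-Sobolev inequality, then Hoelder for v^s and w^a: the parameters s
  Y0 and a Y add up to Z, which is the hypothesis \<open>rel\<close>. The coefficient enters with a
  positive power, so a small norm of v makes the constant small. The power Y/X only converts
  integrals into norms.\<close>

lemma split_wpot_bound:
  fixes a b \<sigma> s X Y Y0 :: real
  defines "n \<equiv> real DIM('a::euclidean_space)"
  assumes a: "0 < a" and s: "0 < s" and \<sigma>: "\<sigma> \<le> 0" "b < n + \<sigma>" and X: "0 < X" "a * X < b" and Y: "0 < Y" "0 < Y0"
    and rel: "n + \<sigma> - b + a * X = s * Y0 + a * Y" and \<delta>: "0 < \<delta>"
  shows "\<exists>\<eta>>0. \<forall>v w :: 'a \<Rightarrow> ennreal. v \<in> borel_measurable borel \<longrightarrow> w \<in> borel_measurable borel \<longrightarrow>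
    (\<integral>\<^sup>+x. v x epowr (n / Y0) \<partial>lborel) \<le> ennreal \<eta> \<longrightarrow>
    (\<integral>\<^sup>+x. split_wpot a b \<sigma> s v w x epowr (n / X) \<partial>lborel) \<le> ennreal \<delta> * (\<integral>\<^sup>+x. w x epowr (n / Y) \<partial>lborel) epowr (Y / X)"
proof -
  define Z where "Z = s * Y0 + a * Y"
  have n: "0 < n" by (simp add: n_def)
  have sa: "0 < s * Y0" "0 < a * Y" using s a Y by auto
  then have Z: "0 < Z" by (simp add: Z_def)
  obtain C where C: "0 < C" and hls: "\<And>g::'a \<Rightarrow> ennreal. g \<in> borel_measurable borel \<Longrightarrow>
    (\<integral>\<^sup>+x. wpot a b (weighted \<sigma> g) x epowr (n / X) \<partial>lborel) \<le> ennreal C * (\<integral>\<^sup>+y. g y epowr (n / Z) \<partial>lborel) epowr (Z / (a * X))"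
    using wpot_weighted_HLS[OF a \<sigma>(1) \<sigma>(2)[unfolded n_def] X, of Z, folded n_def] rel by (auto simp: Z_def)
  define e where "e = s * Y0 / (a * X)"
  \<comment> \<open>Solves C \<eta>^e = \<delta>, where e is the power to which the integral of
    v^(n/Y0) enters.\<close>
  define \<eta> where "\<eta> = (\<delta> / C) powr (1 / e)"
  have e: "0 < e" using sa a X by (simp add: e_def)
  have \<eta>: "0 < \<eta>" using C \<delta> by (simp add: \<eta>_def)
  have C\<eta>: "C * \<eta> powr e = \<delta>" using C \<delta> e by (simp add: \<eta>_def powr_powr)
  have "(\<integral>\<^sup>+x. split_wpot a b \<sigma> s v w x epowr (n / X) \<partial>lborel) \<le> ennreal \<delta> * (\<integral>\<^sup>+x. w x epowr (n / Y) \<partial>lborel) epowr (Y / X)"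
    if [measurable]: "v \<in> borel_measurable borel" "w \<in> borel_measurable borel"
      and small: "(\<integral>\<^sup>+x. v x epowr (n / Y0) \<partial>lborel) \<le> ennreal \<eta>" for v w :: "'a \<Rightarrow> ennreal"
  proof -
    define I where "I = (\<integral>\<^sup>+x. v x epowr (n / Y0) \<partial>lborel)"
    define J where "J = (\<integral>\<^sup>+x. w x epowr (n / Y) \<partial>lborel)"
    define P where "P = Z / (s * Y0)"
    define Q where "Q = Z / (a * Y)"
    have PQ: "1 < P" "1 < Q" "1 / P + 1 / Q = 1"
      using sa Z by (auto simp: P_def Q_def Z_def add_divide_distrib[symmetric])
    have sP: "s * (n / Z * P) = n / Y0" "a * (n / Z * Q) = n / Y"
      using s a Y Z by (simp_all add: P_def Q_def)
    have "(\<integral>\<^sup>+y. (v y epowr s * w y epowr a) epowr (n / Z) \<partial>lborel)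
       = (\<integral>\<^sup>+y. v y epowr (s * (n / Z)) * w y epowr (a * (n / Z)) \<partial>lborel)"
      using n Z by (simp add: epowr_mult epowr_epowr)
    also have "\<dots> \<le> (\<integral>\<^sup>+y. (v y epowr (s * (n / Z))) epowr P \<partial>lborel) epowr (1 / P)
        * (\<integral>\<^sup>+y. (w y epowr (a * (n / Z))) epowr Q \<partial>lborel) epowr (1 / Q)"
      by (rule Hoelder_nn_integral) (use PQ in auto)
    also have "\<dots> = I epowr (1 / P) * J epowr (1 / Q)"
      by (simp only: epowr_epowr mult.assoc sP I_def J_def)
    finally have H: "(\<integral>\<^sup>+y. (v y epowr s * w y epowr a) epowr (n / Z) \<partial>lborel) \<le> I epowr (1 / P) * J epowr (1 / Q)" .
    have "(\<integral>\<^sup>+x. split_wpot a b \<sigma> s v w x epowr (n / X) \<partial>lborel)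
        \<le> ennreal C * (\<integral>\<^sup>+y. (v y epowr s * w y epowr a) epowr (n / Z) \<partial>lborel) epowr (Z / (a * X))"
      unfolding split_wpot_def by (rule hls) measurable
    also have "\<dots> \<le> ennreal C * (I epowr (1 / P) * J epowr (1 / Q)) epowr (Z / (a * X))"
      using Z a X by (intro mult_left_mono epowr_mono H) auto
    also have "\<dots> = ennreal C * (I epowr e * J epowr (Y / X))"
    proof -
      have "1 / P * (Z / (a * X)) = e" "1 / Q * (Z / (a * X)) = Y / X"
        using Z a X Y by (simp_all add: P_def Q_def e_def)
      then show ?thesis using Z a X by (simp only: epowr_mult epowr_epowr divide_pos_pos mult_pos_pos)
    qed
    also have "\<dots> \<le> ennreal C * (ennreal \<eta> epowr e * J epowr (Y / X))"
      using small e unfolding I_def by (intro mult_left_mono mult_right_mono epowr_mono) auto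
    also have "\<dots> = ennreal (C * \<eta> powr e) * J epowr (Y / X)"
      using C \<eta> by (simp add: epowr_ennreal ennreal_mult mult.assoc)
    finally show ?thesis unfolding C\<eta> J_def .
  qed
  then show ?thesis using \<eta> by blast
qed

text \<open>V is finite almost everywhere, so almost every point leaves \<open>E k\<close> as k
  grows and the integral over \<open>E k\<close> tends to 0. Off \<open>E k\<close> the function is
  at most k and vanishes outside the ball of radius k, which gives every power integral of
  \<open>V2\<close>.\<close>

lemma split_small_coefficient:
  fixes V :: "'a::euclidean_space \<Rightarrow> ennreal"
  assumes [measurable]: "V \<in> borel_measurable borel" and r: "0 < r" and fin: "(\<integral>\<^sup>+y. V y epowr r \<partial>lborel) < top" and \<eta>: "0 < \<eta>"
  obtains V1 V2 where "V1 \<in> borel_measurable borel" "V2 \<in> borel_measurable borel"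
    "\<And>y. V1 y = V y \<and> V2 y = 0 \<or> V1 y = 0 \<and> V2 y = V y"
    "(\<integral>\<^sup>+y. V1 y epowr r \<partial>lborel) \<le> ennreal \<eta>"
    "\<And>s. 0 < s \<Longrightarrow> (\<integral>\<^sup>+y. V2 y epowr s \<partial>lborel) < top"
proof -
  define E where "E k = {y. real k < norm y \<or> ennreal (real k) < V y}" for k
  have [measurable]: "E k \<in> sets borel" for k unfolding E_def by measurable
  have "AE y in lborel. V y epowr r \<noteq> top"
    using fin by (intro nn_integral_PInf_AE[unfolded infinity_ennreal_def]) auto
  then have ev: "AE y in lborel. \<forall>\<^sub>F k in sequentially. y \<notin> E k"
  proof eventually_elim
    case (elim y)
    then obtain c where c: "V y = ennreal c" "0 \<le> c" by (cases "V y") auto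
    obtain N where N: "max c (norm y) < real N" using reals_Archimedean2 by blast
    show ?case
      using N c unfolding E_def eventually_sequentially
      by (intro exI[of _ N]) (auto simp: ennreal_less_iff)
  qed
  have "(\<lambda>k. \<integral>\<^sup>+y. V y epowr r * indicator (E k) y \<partial>lborel) \<longlonglongrightarrow> 0"
    by (rule nn_integral_tendsto_zero[OF _ _ fin ev]) measurable
  moreover have "0 < ennreal \<eta>" using \<eta> by simp
  ultimately have "\<forall>\<^sub>F k in sequentially. (\<integral>\<^sup>+y. V y epowr r * indicator (E k) y \<partial>lborel) < ennreal \<eta>"
    by (rule order_tendstoD)
  then obtain k where k: "(\<integral>\<^sup>+y. V y epowr r * indicator (E k) y \<partial>lborel) < ennreal \<eta>"
    by (auto simp: eventually_sequentially)
  show ?thesis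
  proof (rule that[of "\<lambda>y. V y * indicator (E k) y" "\<lambda>y. V y * indicator (- E k) y"])
    have "(\<integral>\<^sup>+y. (V y * indicator (E k) y) epowr r \<partial>lborel) = (\<integral>\<^sup>+y. V y epowr r * indicator (E k) y \<partial>lborel)"
      by (intro nn_integral_cong) (auto split: split_indicator)
    then show "(\<integral>\<^sup>+y. (V y * indicator (E k) y) epowr r \<partial>lborel) \<le> ennreal \<eta>" using k by simp
    fix s :: real assume s: "0 < s"
    have "(\<integral>\<^sup>+y. (V y * indicator (- E k) y) epowr s \<partial>lborel)
      \<le> (\<integral>\<^sup>+y. ennreal (real k powr s) * indicator (cball 0 (real k)) (y::'a) \<partial>lborel)"
    proof (rule nn_integral_mono)
      fix y
      show "(V y * indicator (- E k) y) epowr s \<le> ennreal (real k powr s) * indicator (cball 0 (real k)) y"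
      proof (cases "y \<in> E k")
        case False
        then have "V y \<le> ennreal (real k)" "norm y \<le> real k" by (auto simp: E_def not_less)
        then show ?thesis using False epowr_mono[OF s, of "V y" "ennreal (real k)"] by (simp add: epowr_ennreal)
      qed simp
    qed
    also have "\<dots> = ennreal (real k powr s) * emeasure lborel (cball (0::'a) (real k))"
      by (rule nn_integral_cmult_indicator) simp
    also have "\<dots> < top"
      using emeasure_lborel_cball_finite[of "0::'a" "real k"] by (simp add: ennreal_mult_less_top)
    finally show "(\<integral>\<^sup>+y. (V y * indicator (- E k) y) epowr s \<partial>lborel) < top" .
  qed (auto split: split_indicator)
qed

lemma wpot_le_split:
  fixes V :: "'a::euclidean_space \<Rightarrow> ennreal"
  assumes [measurable]: "V \<in> borel_measurable borel" "V1 \<in> borel_measurable borel" "V2 \<in> borel_measurable borel"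
    and V: "\<And>y. V1 y = V y \<and> V2 y = 0 \<or> V1 y = 0 \<and> V2 y = V y" and a: "0 < a" "a < q"
  shows "wpot a b (weighted \<sigma> (\<lambda>y. V y epowr q)) x \<le>
    ennreal (2 powr (1 / a)) * (split_wpot a b \<sigma> (q - a) V1 V x + wpot a b (weighted \<sigma> (\<lambda>y. V2 y epowr q)) x)"
proof -
  \<comment> \<open>An identity and not merely an estimate, because at each point one of the two
    parts vanishes.\<close>
  have "V y epowr q = V1 y epowr (q - a) * V y epowr a + V2 y epowr q" for y
    using V[of y] a epowr_add[of "q - a" a "V y"] by auto
  then have "wpot a b (weighted \<sigma> (\<lambda>y. V y epowr q)) x = wpot a b (\<lambda>y. weighted \<sigma> (\<lambda>y. V1 y epowr (q - a) * V y epowr a) y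
     + weighted \<sigma> (\<lambda>y. V2 y epowr q) y) x"
    by (simp add: distrib_left)
  also have "\<dots> \<le> ennreal (2 powr (1 / a)) * (split_wpot a b \<sigma> (q - a) V1 V x + wpot a b (weighted \<sigma> (\<lambda>y. V2 y epowr q)) x)"
    unfolding split_wpot_def using a by (intro wpot_add_le) auto
  finally show ?thesis .
qed

lemma wpot_weighted_finite:
  fixes a b \<sigma> X Z q :: real and g :: "'a::euclidean_space \<Rightarrow> ennreal"
  assumes "0 < a" "\<sigma> \<le> 0" "b < DIM('a) + \<sigma>" "0 < X" "a * X < b" "Z = DIM('a) + \<sigma> - b + a * X"
    and [measurable]: "g \<in> borel_measurable borel" and fin: "(\<integral>\<^sup>+y. g y epowr (q * (DIM('a) / Z)) \<partial>lborel) < top"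
  shows "(\<integral>\<^sup>+x. wpot a b (weighted \<sigma> (\<lambda>y. g y epowr q)) x epowr (DIM('a) / X) \<partial>lborel) < top"
proof -
  obtain C where "0 < C" and hls: "\<And>g::'a \<Rightarrow> ennreal. g \<in> borel_measurable borel \<Longrightarrow>
    (\<integral>\<^sup>+x. wpot a b (weighted \<sigma> g) x epowr (DIM('a) / X) \<partial>lborel) \<le> ennreal C * (\<integral>\<^sup>+y. g y epowr (DIM('a) / Z) \<partial>lborel) epowr (Z / (a * X))"
    using wpot_weighted_HLS[OF assms(1-6)] by blast
  have "(\<integral>\<^sup>+x. wpot a b (weighted \<sigma> (\<lambda>y. g y epowr q)) x epowr (DIM('a) / X) \<partial>lborel)
      \<le> ennreal C * (\<integral>\<^sup>+y. g y epowr (q * (DIM('a) / Z)) \<partial>lborel) epowr (Z / (a * X))"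
    using hls[of "\<lambda>y. g y epowr q"] by (simp add: epowr_epowr)
  also have "\<dots> < top" using fin by (simp add: ennreal_mult_less_top)
  finally show ?thesis .
qed

text \<open>Inserting the bound for V into that for U gives U <= T U + H, with T a multiple of the
  composition of two degree-one potentials. The first maps L^(n/Y) to L^(n/X) and the second maps
  back, at the known pair (X0, Y0) and at the target pair (X1, Y1).
  \<open>regularity_lifting\<close> then moves U from the first to the second.\<close>

lemma wolff_system_lifting:
  fixes a b C \<sigma>1 \<sigma>2 p q X0 Y0 X1 Y1 :: real and U V :: "'a::euclidean_space \<Rightarrow> ennreal"
  defines "n \<equiv> real DIM('a)"
  assumes a: "0 < a" "a < p" "a < q" and C: "0 < C"
    and \<sigma>: "\<sigma>1 \<le> 0" "\<sigma>2 \<le> 0" "b < n + \<sigma>1" "b < n + \<sigma>2"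
    and pos: "0 < X0" "0 < Y0" "0 < X1" "0 < Y1"
    and lt: "a * X0 < b" "a * Y0 < b" "a * X1 < b" "a * Y1 < b"
    and rel: "a * X0 = q * Y0 - (n + \<sigma>1 - b)" "a * Y0 = p * X0 - (n + \<sigma>2 - b)" "X1 - Y1 = X0 - Y0"
    and [measurable]: "U \<in> borel_measurable borel" "V \<in> borel_measurable borel"
    and U: "AE x in lborel. U x \<le> ennreal C * wpot a b (weighted \<sigma>1 (\<lambda>y. V y epowr q)) x"
    and V: "AE x in lborel. V x \<le> ennreal C * wpot a b (weighted \<sigma>2 (\<lambda>y. U y epowr p)) x"
    and fin: "(\<integral>\<^sup>+x. U x epowr (n / X0) \<partial>lborel) < top" "(\<integral>\<^sup>+x. V x epowr (n / Y0) \<partial>lborel) < top"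
  shows "(\<integral>\<^sup>+x. U x epowr (n / X1) \<partial>lborel) < top"
proof -
  \<comment> \<open>\<open>\<kappa>0\<close> is the loss in splitting one equation,
    \<open>K0\<close> the quasi-additivity constant of a split potential, and
    \<open>\<kappa>\<close> results from inserting one equation into the other. The composition is
    quasi-additive with \<open>K0 * K0\<close>, and \<open>\<delta> X\<close> is solved from the
    contraction condition with factor 1/2. Only the first potential is made that small; bound 1
    suffices for the second.\<close>
  define \<kappa>0 where "\<kappa>0 = C * 2 powr (1 / a)"
  define K0 where "K0 = 2 * 2 powr (1 / a)"
  define \<kappa> where "\<kappa> = \<kappa>0 * \<kappa>0 * K0"
  define \<delta> where "\<delta> X = 1 / (2 * 2 powr (n / X) * (K0 * K0 * \<kappa>) powr (n / X))" for X
  have n: "0 < n" by (simp add: n_def)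
  have kpos: "0 < \<kappa>0" "0 < K0" "0 < \<kappa>" using C by (auto simp: \<kappa>0_def K0_def \<kappa>_def)
  then have \<delta>: "0 < \<delta> X" for X by (simp add: \<delta>_def)
  have aX: "a * X1 = a * Y1 + a * X0 - a * Y0"
  proof -
    have "X1 = Y1 + X0 - Y0" using rel(3) by simp
    then show ?thesis by (simp add: right_diff_distrib distrib_left)
  qed
  \<comment> \<open>The coefficients keep the exponents Y0 and X0 in all four cases, so the starting
    pair and the target pair must satisfy the same relation; this is where X1 - Y1 = X0 - Y0
    enters.\<close>
  have relU: "n + \<sigma>1 - b + a * X0 = (q - a) * Y0 + a * Y0" "n + \<sigma>1 - b + a * X1 = (q - a) * Y0 + a * Y1"
    and relV: "n + \<sigma>2 - b + a * Y0 = (p - a) * X0 + a * X0" "n + \<sigma>2 - b + a * Y1 = (p - a) * X0 + a * X1"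
    using rel aX by (simp_all add: algebra_simps)
  have qa: "0 < q - a" "0 < p - a" using a by auto
  note bound = split_wpot_bound[where 'a = 'a, folded n_def]
  obtain \<eta>1 where \<eta>1: "0 < \<eta>1" "\<And>v w :: 'a \<Rightarrow> ennreal. v \<in> borel_measurable borel \<Longrightarrow> w \<in> borel_measurable borel \<Longrightarrow>
    (\<integral>\<^sup>+x. v x epowr (n / Y0) \<partial>lborel) \<le> ennreal \<eta>1 \<Longrightarrow>
    (\<integral>\<^sup>+x. split_wpot a b \<sigma>1 (q - a) v w x epowr (n / X0) \<partial>lborel) \<le> ennreal (\<delta> X0) * (\<integral>\<^sup>+x. w x epowr (n / Y0) \<partial>lborel) epowr (Y0 / X0)"
    using bound[OF a(1) qa(1) \<sigma>(1,3) pos(1) lt(1) pos(2) pos(2) relU(1) \<delta>] by blast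
  obtain \<eta>2 where \<eta>2: "0 < \<eta>2" "\<And>v w :: 'a \<Rightarrow> ennreal. v \<in> borel_measurable borel \<Longrightarrow> w \<in> borel_measurable borel \<Longrightarrow>
    (\<integral>\<^sup>+x. v x epowr (n / Y0) \<partial>lborel) \<le> ennreal \<eta>2 \<Longrightarrow>
    (\<integral>\<^sup>+x. split_wpot a b \<sigma>1 (q - a) v w x epowr (n / X1) \<partial>lborel) \<le> ennreal (\<delta> X1) * (\<integral>\<^sup>+x. w x epowr (n / Y1) \<partial>lborel) epowr (Y1 / X1)"
    using bound[OF a(1) qa(1) \<sigma>(1,3) pos(3) lt(3) pos(4) pos(2) relU(2) \<delta>] by blast
  obtain \<eta>3 where \<eta>3: "0 < \<eta>3" "\<And>v w :: 'a \<Rightarrow> ennreal. v \<in> borel_measurable borel \<Longrightarrow> w \<in> borel_measurable borel \<Longrightarrow>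
    (\<integral>\<^sup>+x. v x epowr (n / X0) \<partial>lborel) \<le> ennreal \<eta>3 \<Longrightarrow>
    (\<integral>\<^sup>+x. split_wpot a b \<sigma>2 (p - a) v w x epowr (n / Y0) \<partial>lborel) \<le> ennreal 1 * (\<integral>\<^sup>+x. w x epowr (n / X0) \<partial>lborel) epowr (X0 / Y0)"
    using bound[OF a(1) qa(2) \<sigma>(2,4) pos(2) lt(2) pos(1) pos(1) relV(1) zero_less_one] by blast
  obtain \<eta>4 where \<eta>4: "0 < \<eta>4" "\<And>v w :: 'a \<Rightarrow> ennreal. v \<in> borel_measurable borel \<Longrightarrow> w \<in> borel_measurable borel \<Longrightarrow>
    (\<integral>\<^sup>+x. v x epowr (n / X0) \<partial>lborel) \<le> ennreal \<eta>4 \<Longrightarrow>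
    (\<integral>\<^sup>+x. split_wpot a b \<sigma>2 (p - a) v w x epowr (n / Y1) \<partial>lborel) \<le> ennreal 1 * (\<integral>\<^sup>+x. w x epowr (n / X1) \<partial>lborel) epowr (X1 / Y1)"
    using bound[OF a(1) qa(2) \<sigma>(2,4) pos(4) lt(4) pos(3) pos(1) relV(2) zero_less_one] by blast
  \<comment> \<open>One decomposition must serve both the known and the target exponent, hence the
    minima.\<close>
  have "0 < n / Y0" "0 < n / X0" using n pos by auto
  have m12: "0 < min \<eta>1 \<eta>2" and m34: "0 < min \<eta>3 \<eta>4" using \<eta>1 \<eta>2 \<eta>3 \<eta>4 by auto
  obtain V1 V2 where [measurable]: "V1 \<in> borel_measurable borel" "V2 \<in> borel_measurable borel"
    and V12: "\<And>y. V1 y = V y \<and> V2 y = 0 \<or> V1 y = 0 \<and> V2 y = V y"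
    and V1: "(\<integral>\<^sup>+y. V1 y epowr (n / Y0) \<partial>lborel) \<le> ennreal (min \<eta>1 \<eta>2)"
    and V2: "\<And>s. 0 < s \<Longrightarrow> (\<integral>\<^sup>+y. V2 y epowr s \<partial>lborel) < top"
    by (rule split_small_coefficient[OF _ \<open>0 < n / Y0\<close> fin(2) m12]) auto
  obtain U1 U2 where [measurable]: "U1 \<in> borel_measurable borel" "U2 \<in> borel_measurable borel"
    and U12: "\<And>y. U1 y = U y \<and> U2 y = 0 \<or> U1 y = 0 \<and> U2 y = U y"
    and U1: "(\<integral>\<^sup>+y. U1 y epowr (n / X0) \<partial>lborel) \<le> ennreal (min \<eta>3 \<eta>4)"
    and U2: "\<And>s. 0 < s \<Longrightarrow> (\<integral>\<^sup>+y. U2 y epowr s \<partial>lborel) < top"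
    by (rule split_small_coefficient[OF _ \<open>0 < n / X0\<close> fin(1) m34]) auto
  define S1 where "S1 = split_wpot a b \<sigma>1 (q - a) V1"
  define S2 where "S2 = split_wpot a b \<sigma>2 (p - a) U1"
  define F where "F = wpot a b (weighted \<sigma>1 (\<lambda>y. V2 y epowr q))"
  define G where "G = wpot a b (weighted \<sigma>2 (\<lambda>y. U2 y epowr p))"
  define T where "T w x = ennreal \<kappa> * S1 (S2 w) x" for w x
  define H where "H x = ennreal \<kappa> * S1 G x + ennreal \<kappa>0 * F x" for x
  have meas [measurable]: "S1 w \<in> borel_measurable borel" "S2 w \<in> borel_measurable borel"
    if "w \<in> borel_measurable borel" for w
    using that unfolding S1_def S2_def by measurable
  have [measurable]: "F \<in> borel_measurable borel" "G \<in> borel_measurable borel"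
    unfolding F_def G_def by measurable
  have S_mono: "S1 w x \<le> S1 w' x" "S2 w x \<le> S2 w' x" if "AE y in lborel. w y \<le> w' y" for w w' x
    using that a unfolding S1_def S2_def by (auto intro: split_wpot_mono_AE)
  have S_cmult: "S1 (\<lambda>y. c * w y) x = c * S1 w x" "S2 (\<lambda>y. c * w y) x = c * S2 w x"
    if "w \<in> borel_measurable borel" for c w x
    using that a unfolding S1_def S2_def by (auto intro: split_wpot_cmult)
  have S_add: "S1 (\<lambda>y. w y + w' y) x \<le> ennreal K0 * (S1 w x + S1 w' x)" "S2 (\<lambda>y. w y + w' y) x \<le> ennreal K0 * (S2 w x + S2 w' x)"
    if "w \<in> borel_measurable borel" "w' \<in> borel_measurable borel" for w w' x
    using that a unfolding S1_def S2_def K0_def by (auto intro: split_wpot_add_le)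
  have min12: "ennreal (min \<eta>1 \<eta>2) \<le> ennreal \<eta>1" "ennreal (min \<eta>1 \<eta>2) \<le> ennreal \<eta>2"
    and min34: "ennreal (min \<eta>3 \<eta>4) \<le> ennreal \<eta>3" "ennreal (min \<eta>3 \<eta>4) \<le> ennreal \<eta>4"
    by (auto intro: ennreal_leI)
  have S1_bd: "(\<integral>\<^sup>+x. S1 w x epowr (n / X) \<partial>lborel) \<le> ennreal (\<delta> X) * (\<integral>\<^sup>+x. w x epowr (n / Y) \<partial>lborel) epowr (Y / X)"
    if w: "w \<in> borel_measurable borel" and XY: "(X, Y) \<in> {(X0, Y0), (X1, Y1)}" for w X Y
    using XY \<eta>1(2)[OF _ w order_trans[OF V1 min12(1)]] \<eta>2(2)[OF _ w order_trans[OF V1 min12(2)]] by (auto simp: S1_def)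
  have S2_bd: "(\<integral>\<^sup>+x. S2 w x epowr (n / Y) \<partial>lborel) \<le> (\<integral>\<^sup>+x. w x epowr (n / X) \<partial>lborel) epowr (X / Y)"
    if w: "w \<in> borel_measurable borel" and XY: "(X, Y) \<in> {(X0, Y0), (X1, Y1)}" for w X Y
    using XY \<eta>3(2)[OF _ w order_trans[OF U1 min34(1)]] \<eta>4(2)[OF _ w order_trans[OF U1 min34(2)]] by (auto simp: S2_def)
  have T_bd: "ennreal (2 powr (n / X)) * (\<integral>\<^sup>+x. (ennreal (K0 * K0) * T w x) epowr (n / X) \<partial>lborel) \<le> ennreal (1 / 2) * (\<integral>\<^sup>+x. w x epowr (n / X) \<partial>lborel)"
    if [measurable]: "w \<in> borel_measurable borel" and XY: "(X, Y) \<in> {(X0, Y0), (X1, Y1)}" for w X Y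
  proof -
    have p: "0 < X" "0 < Y" "0 < n / X" using XY pos n by auto
    have "(\<integral>\<^sup>+x. S1 (S2 w) x epowr (n / X) \<partial>lborel) \<le> ennreal (\<delta> X) * (\<integral>\<^sup>+x. S2 w x epowr (n / Y) \<partial>lborel) epowr (Y / X)"
      using S1_bd[OF _ XY, of "S2 w"] by simp
    also have "\<dots> \<le> ennreal (\<delta> X) * ((\<integral>\<^sup>+x. w x epowr (n / X) \<partial>lborel) epowr (X / Y)) epowr (Y / X)"
      using p S2_bd[OF _ XY, of w] by (intro mult_left_mono epowr_mono) auto
    also have "\<dots> = ennreal (\<delta> X) * (\<integral>\<^sup>+x. w x epowr (n / X) \<partial>lborel)"
      using p by (simp add: epowr_epowr)
    finally have S: "(\<integral>\<^sup>+x. S1 (S2 w) x epowr (n / X) \<partial>lborel) \<le> ennreal (\<delta> X) * (\<integral>\<^sup>+x. w x epowr (n / X) \<partial>lborel)" .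
    have "ennreal (K0 * K0) * T w x = ennreal (K0 * K0 * \<kappa>) * S1 (S2 w) x" for x
      using kpos by (simp add: T_def mult.assoc[symmetric] flip: ennreal_mult)
    then have "(\<integral>\<^sup>+x. (ennreal (K0 * K0) * T w x) epowr (n / X) \<partial>lborel)
       = (\<integral>\<^sup>+x. ennreal ((K0 * K0 * \<kappa>) powr (n / X)) * S1 (S2 w) x epowr (n / X) \<partial>lborel)"
      using p kpos by (simp add: epowr_mult epowr_ennreal)
    also have "\<dots> = ennreal ((K0 * K0 * \<kappa>) powr (n / X)) * (\<integral>\<^sup>+x. S1 (S2 w) x epowr (n / X) \<partial>lborel)"
      by (rule nn_integral_cmult) measurable
    also have "\<dots> \<le> ennreal ((K0 * K0 * \<kappa>) powr (n / X)) * (ennreal (\<delta> X) * (\<integral>\<^sup>+x. w x epowr (n / X) \<partial>lborel))"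
      by (intro mult_left_mono S) auto
    finally have "ennreal (2 powr (n / X)) * (\<integral>\<^sup>+x. (ennreal (K0 * K0) * T w x) epowr (n / X) \<partial>lborel)
      \<le> ennreal (2 powr (n / X)) * (ennreal ((K0 * K0 * \<kappa>) powr (n / X)) * (ennreal (\<delta> X) * (\<integral>\<^sup>+x. w x epowr (n / X) \<partial>lborel)))"
      by (rule mult_left_mono) simp
    also have "\<dots> = ennreal (2 powr (n / X) * ((K0 * K0 * \<kappa>) powr (n / X) * \<delta> X)) * (\<integral>\<^sup>+x. w x epowr (n / X) \<partial>lborel)"
      using \<delta>[of X] by (simp only: ennreal_mult mult.assoc powr_ge_zero mult_nonneg_nonneg less_imp_le)
    also have "2 powr (n / X) * ((K0 * K0 * \<kappa>) powr (n / X) * \<delta> X) = 1 / 2"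
      using kpos by (simp add: \<delta>_def)
    finally show ?thesis .
  qed
  have Ux: "AE x in lborel. U x \<le> ennreal \<kappa>0 * (S1 V x + F x)"
    using U
  proof eventually_elim
    case (elim x)
    also have "ennreal C * wpot a b (weighted \<sigma>1 (\<lambda>y. V y epowr q)) x \<le> ennreal C * (ennreal (2 powr (1 / a)) * (S1 V x + F x))"
      unfolding S1_def F_def using a V12 by (intro mult_left_mono wpot_le_split) auto
    also have "\<dots> = ennreal \<kappa>0 * (S1 V x + F x)"
      using C by (simp add: \<kappa>0_def ennreal_mult mult.assoc)
    finally show ?case .
  qed
  have Vx: "AE x in lborel. V x \<le> ennreal \<kappa>0 * (S2 U x + G x)"
    using V
  proof eventually_elim
    case (elim x)
    also have "ennreal C * wpot a b (weighted \<sigma>2 (\<lambda>y. U y epowr p)) x \<le> ennreal C * (ennreal (2 powr (1 / a)) * (S2 U x + G x))"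
      unfolding S2_def G_def using a U12 by (intro mult_left_mono wpot_le_split) auto
    also have "\<dots> = ennreal \<kappa>0 * (S2 U x + G x)"
      using C by (simp add: \<kappa>0_def ennreal_mult mult.assoc)
    finally show ?case .
  qed
  \<comment> \<open>Insert \<open>Vx\<close> into \<open>Ux\<close>: the composed potential of U
    forms T U, and the terms with G and F form H.\<close>
  have UT: "AE x in lborel. U x \<le> T U x + H x"
    using Ux
  proof eventually_elim
    case (elim x)
    have "S1 V x \<le> S1 (\<lambda>y. ennreal \<kappa>0 * (S2 U y + G y)) x" by (rule S_mono(1)[OF Vx])
    also have "\<dots> = ennreal \<kappa>0 * S1 (\<lambda>y. S2 U y + G y) x" by (rule S_cmult(1)) measurable
    also have "\<dots> \<le> ennreal \<kappa>0 * (ennreal K0 * (S1 (S2 U) x + S1 G x))"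
      by (intro mult_left_mono S_add(1)) auto
    finally have "ennreal \<kappa>0 * (S1 V x + F x) \<le> ennreal \<kappa>0 * (ennreal \<kappa>0 * (ennreal K0 * (S1 (S2 U) x + S1 G x)) + F x)"
      by (intro mult_left_mono add_right_mono) auto
    also have "\<dots> = T U x + H x"
      using kpos by (simp add: T_def H_def \<kappa>_def ennreal_mult algebra_simps)
    finally show ?case using elim by simp
  qed
  \<comment> \<open>The cut-off parts have finite power integrals of every positive order, so F and
    G lie in the target spaces, and so does H once S1 is applied to G.\<close>
  have Ffin: "(\<integral>\<^sup>+x. F x epowr (n / X1) \<partial>lborel) < top"
    unfolding F_def n_def
  proof (rule wpot_weighted_finite)
    show "(\<integral>\<^sup>+y. V2 y epowr (q * (real DIM('a) / (real DIM('a) + \<sigma>1 - b + a * X1))) \<partial>lborel) < top"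
    proof -
      have "0 < real DIM('a) + \<sigma>1 - b + a * X1"
        using \<sigma> mult_pos_pos[OF a(1) pos(3)] unfolding n_def by linarith
      then show ?thesis using a by (intro V2 mult_pos_pos divide_pos_pos) auto
    qed
  qed (use a \<sigma> pos lt in \<open>auto simp: n_def\<close>)
  have Gfin: "(\<integral>\<^sup>+x. G x epowr (n / Y1) \<partial>lborel) < top"
    unfolding G_def n_def
  proof (rule wpot_weighted_finite)
    show "(\<integral>\<^sup>+y. U2 y epowr (p * (real DIM('a) / (real DIM('a) + \<sigma>2 - b + a * Y1))) \<partial>lborel) < top"
    proof -
      have "0 < real DIM('a) + \<sigma>2 - b + a * Y1"
        using \<sigma> mult_pos_pos[OF a(1) pos(4)] unfolding n_def by linarith
      then show ?thesis using a by (intro U2 mult_pos_pos divide_pos_pos) auto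
    qed
  qed (use a \<sigma> pos lt in \<open>auto simp: n_def\<close>)
  have "(\<integral>\<^sup>+x. S1 G x epowr (n / X1) \<partial>lborel) \<le> ennreal (\<delta> X1) * (\<integral>\<^sup>+x. G x epowr (n / Y1) \<partial>lborel) epowr (Y1 / X1)"
    by (rule S1_bd) auto
  also have "\<dots> < top" using Gfin by (simp add: ennreal_mult_less_top)
  finally have S1G: "(\<integral>\<^sup>+x. S1 G x epowr (n / X1) \<partial>lborel) < top" .
  have nX: "0 < n / X0" "0 < n / X1" using n pos by auto
  have "(\<integral>\<^sup>+x. H x epowr (n / X1) \<partial>lborel)
      \<le> (\<integral>\<^sup>+x. ennreal (2 powr (n / X1)) * (ennreal \<kappa> epowr (n / X1) * S1 G x epowr (n / X1)
        + ennreal \<kappa>0 epowr (n / X1) * F x epowr (n / X1)) \<partial>lborel)"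
    unfolding H_def epowr_mult[OF nX(2), symmetric] using nX by (intro nn_integral_mono epowr_add_le)
  also have "\<dots> = ennreal (2 powr (n / X1)) * (ennreal \<kappa> epowr (n / X1) * (\<integral>\<^sup>+x. S1 G x epowr (n / X1) \<partial>lborel)
        + ennreal \<kappa>0 epowr (n / X1) * (\<integral>\<^sup>+x. F x epowr (n / X1) \<partial>lborel))"
    by (simp add: nn_integral_cmult nn_integral_add)
  also have "\<dots> < top" using S1G Ffin by (simp add: ennreal_mult_less_top)
  finally have Hfin: "(\<integral>\<^sup>+x. H x epowr (n / X1) \<partial>lborel) < top" .
  show ?thesis
  proof (rule regularity_lifting[where T = T and H = H and K = "ennreal (K0 * K0)" and r = "n / X0"])
    show "T w \<in> borel_measurable lborel" if "w \<in> borel_measurable lborel" for w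
      using that unfolding T_def by simp
    show "AE x in lborel. T w x \<le> T w' x" if "AE x in lborel. w x \<le> w' x" for w w'
    proof (rule AE_I2)
      fix x
      have "S1 (S2 w) x \<le> S1 (S2 w') x" by (intro S_mono AE_I2 S_mono(2) that)
      then show "T w x \<le> T w' x" unfolding T_def by (rule mult_left_mono) simp
    qed
    show "T (\<lambda>y. w y + w' y) x \<le> ennreal (K0 * K0) * (T w x + T w' x)"
      if "w \<in> borel_measurable lborel" "w' \<in> borel_measurable lborel" for w w' x
    proof -
      have [measurable]: "w \<in> borel_measurable borel" "w' \<in> borel_measurable borel" using that by auto
      have "S1 (S2 (\<lambda>y. w y + w' y)) x \<le> S1 (\<lambda>y. ennreal K0 * (S2 w y + S2 w' y)) x"
        by (intro S_mono AE_I2 S_add) auto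
      also have "\<dots> = ennreal K0 * S1 (\<lambda>y. S2 w y + S2 w' y) x" by (rule S_cmult) measurable
      also have "\<dots> \<le> ennreal K0 * (ennreal K0 * (S1 (S2 w) x + S1 (S2 w') x))"
        by (intro mult_left_mono S_add) auto
      finally have "T (\<lambda>y. w y + w' y) x \<le> ennreal \<kappa> * (ennreal K0 * (ennreal K0 * (S1 (S2 w) x + S1 (S2 w') x)))"
        unfolding T_def by (rule mult_left_mono) simp
      also have "\<dots> = ennreal (K0 * K0) * (T w x + T w' x)"
        using kpos by (simp add: T_def ennreal_mult algebra_simps)
      finally show ?thesis .
    qed
    show "ennreal (2 powr (n / X1)) * (\<integral>\<^sup>+x. (ennreal (K0 * K0) * T w x) epowr (n / X1) \<partial>lborel)
        \<le> ennreal (1 / 2) * (\<integral>\<^sup>+x. w x epowr (n / X1) \<partial>lborel)" if "w \<in> borel_measurable lborel" for w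
      using that by (intro T_bd[of _ _ Y1]) auto
    show "(\<integral>\<^sup>+x. (ennreal (K0 * K0) * T w x) epowr (n / X0) \<partial>lborel)
        \<le> ennreal (1 / 2) * (\<integral>\<^sup>+x. w x epowr (n / X0) \<partial>lborel)" if "w \<in> borel_measurable lborel" for w
    proof -
      let ?I = "\<integral>\<^sup>+x. (ennreal (K0 * K0) * T w x) epowr (n / X0) \<partial>lborel"
      \<comment> \<open>\<open>T_bd\<close> carries the extra factor 2^(n/X0) >= 1, which the
        contraction in the known space may drop.\<close>
      have "1 \<le> (2::real) powr (n / X0)" using nX by (intro ge_one_powr_ge_zero) auto
      then have "1 * ?I \<le> ennreal (2 powr (n / X0)) * ?I"
        by (intro mult_right_mono) (auto simp flip: ennreal_1 intro!: ennreal_leI)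
      also have "\<dots> \<le> ennreal (1 / 2) * (\<integral>\<^sup>+x. w x epowr (n / X0) \<partial>lborel)"
        using that by (intro T_bd[of _ _ Y0]) auto
      finally show ?thesis by simp
    qed
  qed (use nX UT fin Hfin in \<open>auto simp: H_def[abs_def]\<close>)
qed

section \<open>Boundedness and decay\<close>

lemma epowr_tendsto_0:
  assumes "(f \<longlongrightarrow> 0) F" "0 < s"
  shows "((\<lambda>x. f x epowr s) \<longlongrightarrow> 0) F"
proof (rule order_tendstoI)
  fix e :: ennreal assume "0 < e"
  then have "0 < e epowr (1 / s)" by (simp add: zero_less_iff_neq_zero)
  with assms(1) have "\<forall>\<^sub>F x in F. f x < e epowr (1 / s)" by (rule order_tendstoD)
  then show "\<forall>\<^sub>F x in F. f x epowr s < e"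
  proof eventually_elim
    case (elim x)
    show ?case
    proof (rule ccontr)
      assume "\<not> f x epowr s < e"
      then have "e epowr (1 / s) \<le> (f x epowr s) epowr (1 / s)" using assms by (intro epowr_mono) auto
      then show False using elim assms by (simp add: epowr_epowr)
    qed
  qed
qed simp

text \<open>The exponent Z1 lies below the critical value n + \<sigma> - b and controls small balls;
  Z2 lies above it and controls large ones. If g vanishes near x, no small scales contribute, and
  only the second norm survives, with decay in the distance \<delta>.\<close>

lemma wpot_weighted_le_two_norms:
  fixes a b \<sigma> Z1 Z2 :: real
  defines "n \<equiv> real DIM('a::euclidean_space)"
  assumes a: "0 < a" and \<sigma>: "\<sigma> \<le> 0" and Z: "0 < Z1" "Z1 < n + \<sigma> - b" "n + \<sigma> - b < Z2" "Z2 < n + \<sigma>"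
  shows "\<exists>C>0. \<forall>(g::'a \<Rightarrow> ennreal) x. g \<in> borel_measurable borel \<longrightarrow>
    wpot a b (weighted \<sigma> g) x \<le> ennreal C * ((\<integral>\<^sup>+y. g y epowr (n / Z1) \<partial>lborel) epowr (Z1 / (n * a))
      + (\<integral>\<^sup>+y. g y epowr (n / Z2) \<partial>lborel) epowr (Z2 / (n * a)))
    \<and> (\<forall>\<delta>>0. (\<forall>y\<in>ball x \<delta>. g y = 0) \<longrightarrow>
        wpot a b (weighted \<sigma> g) x \<le> ennreal C * (\<integral>\<^sup>+y. g y epowr (n / Z2) \<partial>lborel) epowr (Z2 / (n * a))
          * ennreal (\<delta> powr (- ((Z2 - (n + \<sigma> - b)) / a))))"
proof -
  define A where "A = n + \<sigma> - b - Z1"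
  define B where "B = Z2 - (n + \<sigma> - b)"
  have n: "0 < n" by (simp add: n_def)
  have AB: "0 < A" "0 < B" "0 < Z2" "Z1 < n + \<sigma>" using Z by (auto simp: A_def B_def)
  obtain C1 where C1: "0 < C1" "\<And>(g::'a \<Rightarrow> ennreal) x t. g \<in> borel_measurable borel \<Longrightarrow> 0 < t \<Longrightarrow>
    (\<integral>\<^sup>+y. weighted \<sigma> g y * indicator (ball x t) y \<partial>lborel) \<le>
    ennreal (C1 * t powr (n + \<sigma> - Z1)) * (\<integral>\<^sup>+y. g y epowr (n / Z1) * indicator (ball x t) y \<partial>lborel) epowr (Z1 / n)"
    using nn_integral_weighted_ball_le[OF Z(1), of \<sigma>, where 'a = 'a, folded n_def, OF AB(4) \<sigma>] by blast
  obtain C2 where C2: "0 < C2" "\<And>(g::'a \<Rightarrow> ennreal) x t. g \<in> borel_measurable borel \<Longrightarrow> 0 < t \<Longrightarrow>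
    (\<integral>\<^sup>+y. weighted \<sigma> g y * indicator (ball x t) y \<partial>lborel) \<le>
    ennreal (C2 * t powr (n + \<sigma> - Z2)) * (\<integral>\<^sup>+y. g y epowr (n / Z2) * indicator (ball x t) y \<partial>lborel) epowr (Z2 / n)"
    using nn_integral_weighted_ball_le[OF AB(3), of \<sigma>, where 'a = 'a, folded n_def, OF Z(4) \<sigma>] by blast
  define C where "C = max (C1 powr (1 / a) * (a / A)) (C2 powr (1 / a) * (a / B))"
  have C: "0 < C" using C1 a AB by (auto simp: C_def less_max_iff_disj)
  have "wpot a b (weighted \<sigma> g) x \<le> ennreal C * ((\<integral>\<^sup>+y. g y epowr (n / Z1) \<partial>lborel) epowr (Z1 / (n * a))
      + (\<integral>\<^sup>+y. g y epowr (n / Z2) \<partial>lborel) epowr (Z2 / (n * a)))"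
    "\<lbrakk>0 < \<delta>; \<forall>y\<in>ball x \<delta>. g y = 0\<rbrakk> \<Longrightarrow> wpot a b (weighted \<sigma> g) x \<le> ennreal C * (\<integral>\<^sup>+y. g y epowr (n / Z2) \<partial>lborel) epowr (Z2 / (n * a))
          * ennreal (\<delta> powr (- (B / a)))"
    if [measurable]: "g \<in> borel_measurable borel" for g :: "'a \<Rightarrow> ennreal" and x \<delta>
  proof -
    define I where "I Z = (\<integral>\<^sup>+y. g y epowr (n / Z) \<partial>lborel)" for Z
    have I: "(\<integral>\<^sup>+y. g y epowr (n / Z) * indicator (ball x t) y \<partial>lborel) \<le> I Z" for Z t
      unfolding I_def by (intro nn_integral_mono) (auto split: split_indicator)
    have bd: "(\<integral>\<^sup>+y. weighted \<sigma> g y * indicator (ball x t) y \<partial>lborel) \<le> (ennreal C' * I Z epowr (Z / n)) * ennreal (t powr e)"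
      if "(\<integral>\<^sup>+y. weighted \<sigma> g y * indicator (ball x t) y \<partial>lborel) \<le>
        ennreal (C' * t powr e) * (\<integral>\<^sup>+y. g y epowr (n / Z) * indicator (ball x t) y \<partial>lborel) epowr (Z / n)"
        "0 < C'" "0 < Z" for C' Z t e
    proof -
      note that(1)
      also have "ennreal (C' * t powr e) * (\<integral>\<^sup>+y. g y epowr (n / Z) * indicator (ball x t) y \<partial>lborel) epowr (Z / n)
          \<le> ennreal (C' * t powr e) * I Z epowr (Z / n)"
        using that n by (intro mult_left_mono epowr_mono I) auto
      finally show ?thesis using that by (simp add: ennreal_mult mult_ac)
    qed
    have small: "(\<integral>\<^sup>+y. weighted \<sigma> g y * indicator (ball x t) y \<partial>lborel) \<le> (ennreal C1 * I Z1 epowr (Z1 / n)) * ennreal (t powr (b + A))"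
      if "0 < t" for t using bd[OF C1(2)[of g t x] C1(1) Z(1)] that by (simp add: A_def add_diff_eq)
    have large: "(\<integral>\<^sup>+y. weighted \<sigma> g y * indicator (ball x t) y \<partial>lborel) \<le> (ennreal C2 * I Z2 epowr (Z2 / n)) * ennreal (t powr (b - B))"
      if "0 < t" for t using bd[OF C2(2)[of g t x] C2(1) AB(3)] that by (simp add: B_def add_diff_eq)
    have conv: "(ennreal C' * I Z epowr (Z / n)) epowr (1 / a) * ennreal (d * c) \<le> ennreal C * I Z epowr (Z / (n * a)) * ennreal d"
      if "0 < C'" "0 < Z" "C' powr (1 / a) * c \<le> C" "0 \<le> c" "0 \<le> d" for C' Z c d
    proof -
      have "(ennreal C' * I Z epowr (Z / n)) epowr (1 / a) * ennreal (d * c)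
         = ennreal (C' powr (1 / a) * c) * (I Z epowr (Z / (n * a)) * ennreal d)"
        using that a by (simp add: epowr_mult epowr_epowr epowr_ennreal ennreal_mult mult_ac)
      also have "\<dots> \<le> ennreal C * (I Z epowr (Z / (n * a)) * ennreal d)"
        using that by (intro mult_right_mono ennreal_leI) auto
      finally show ?thesis by (simp add: mult.assoc)
    qed
    have "wpot a b (weighted \<sigma> g) x \<le> (ennreal C1 * I Z1 epowr (Z1 / n)) epowr (1 / a) * ennreal (1 powr (A / a) * (a / A))
       + (ennreal C2 * I Z2 epowr (Z2 / n)) epowr (1 / a) * ennreal (1 powr (- (B / a)) * (a / B))"
      by (rule wpot_le_two_scales[OF a AB(1,2) zero_less_one small large]) auto
    also have "\<dots> \<le> ennreal C * I Z1 epowr (Z1 / (n * a)) * ennreal (1 powr (A / a))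
        + ennreal C * I Z2 epowr (Z2 / (n * a)) * ennreal (1 powr (- (B / a)))"
      using C1 C2 Z AB a by (intro add_mono conv) (auto simp: C_def)
    finally show "wpot a b (weighted \<sigma> g) x \<le> ennreal C * ((\<integral>\<^sup>+y. g y epowr (n / Z1) \<partial>lborel) epowr (Z1 / (n * a))
      + (\<integral>\<^sup>+y. g y epowr (n / Z2) \<partial>lborel) epowr (Z2 / (n * a)))"
      by (simp add: I_def distrib_left)
    assume \<delta>: "0 < \<delta>" and zero: "\<forall>y\<in>ball x \<delta>. g y = 0"
    \<comment> \<open>The two-scale bound is applied with K = 0 and split at \<delta> instead of
      1.\<close>
    have vanish: "(\<integral>\<^sup>+y. weighted \<sigma> g y * indicator (ball x t) y \<partial>lborel) \<le> 0 * ennreal (t powr (b + A))" if "t < \<delta>" for t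
    proof -
      have "(\<integral>\<^sup>+y. weighted \<sigma> g y * indicator (ball x t) y \<partial>lborel) = (\<integral>\<^sup>+y. 0 \<partial>(lborel :: 'a measure))"
        using zero that by (intro nn_integral_cong) (auto split: split_indicator)
      then show ?thesis by simp
    qed
    have "wpot a b (weighted \<sigma> g) x \<le> 0 epowr (1 / a) * ennreal (\<delta> powr (A / a) * (a / A))
       + (ennreal C2 * I Z2 epowr (Z2 / n)) epowr (1 / a) * ennreal (\<delta> powr (- (B / a)) * (a / B))"
      by (rule wpot_le_two_scales[OF a AB(1,2) \<delta> vanish large]) (use \<delta> in auto)
    also have "\<dots> = (ennreal C2 * I Z2 epowr (Z2 / n)) epowr (1 / a) * ennreal (\<delta> powr (- (B / a)) * (a / B))" by simp
    also have "\<dots> \<le> ennreal C * I Z2 epowr (Z2 / (n * a)) * ennreal (\<delta> powr (- (B / a)))"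
      using C2 Z AB a by (intro conv) (auto simp: C_def)
    finally show "wpot a b (weighted \<sigma> g) x \<le> ennreal C * (\<integral>\<^sup>+y. g y epowr (n / Z2) \<partial>lborel) epowr (Z2 / (n * a))
          * ennreal (\<delta> powr (- (B / a)))" by (simp add: I_def)
  qed
  then show ?thesis using C unfolding B_def by blast
qed

text \<open>For the decay, g is cut at a large radius k. The outer part has small norms and thus a
  uniformly small potential; the inner part is far from x once |x| is large, so its potential decays
  like a negative power of |x|.\<close>

lemma wpot_weighted_bounded_and_vanishing:
  fixes a b \<sigma> Z1 Z2 :: real and g :: "'a::euclidean_space \<Rightarrow> ennreal"
  defines "n \<equiv> real DIM('a)"
  assumes a: "0 < a" and \<sigma>: "\<sigma> \<le> 0" and Z: "0 < Z1" "Z1 < n + \<sigma> - b" "n + \<sigma> - b < Z2" "Z2 < n + \<sigma>"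
    and [measurable]: "g \<in> borel_measurable borel"
    and fin: "(\<integral>\<^sup>+y. g y epowr (n / Z1) \<partial>lborel) < top" "(\<integral>\<^sup>+y. g y epowr (n / Z2) \<partial>lborel) < top"
  shows "\<exists>M. \<forall>x. wpot a b (weighted \<sigma> g) x \<le> ennreal M"
    and "((\<lambda>x. wpot a b (weighted \<sigma> g) x) \<longlongrightarrow> 0) at_infinity"
proof -
  define I where "I h Z = (\<integral>\<^sup>+y. h y epowr (n / Z) \<partial>lborel)" for h :: "'a \<Rightarrow> ennreal" and Z
  define s where "s = (Z2 - (n + \<sigma> - b)) / a"
  have n: "0 < n" by (simp add: n_def)
  have s: "0 < s" using a Z by (simp add: s_def)
  have Zp: "0 < Z1 / (n * a)" "0 < Z2 / (n * a)" using a n Z by (auto intro!: divide_pos_pos)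
  obtain C where C: "0 < C" and bd: "\<And>h x. h \<in> borel_measurable borel \<Longrightarrow>
      wpot a b (weighted \<sigma> h) x \<le> ennreal C * (I h Z1 epowr (Z1 / (n * a)) + I h Z2 epowr (Z2 / (n * a)))"
    and far: "\<And>h x \<delta>. h \<in> borel_measurable borel \<Longrightarrow> 0 < \<delta> \<Longrightarrow> (\<forall>y\<in>ball x \<delta>. h y = 0) \<Longrightarrow>
      wpot a b (weighted \<sigma> h) x \<le> ennreal C * I h Z2 epowr (Z2 / (n * a)) * ennreal (\<delta> powr (- s))"
    using wpot_weighted_le_two_norms[OF a \<sigma>, where 'a = 'a, folded n_def, OF Z] unfolding I_def s_def by blast
  have "ennreal C * (I g Z1 epowr (Z1 / (n * a)) + I g Z2 epowr (Z2 / (n * a))) < top"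
    using fin by (simp add: I_def ennreal_mult_less_top)
  then obtain M where "ennreal C * (I g Z1 epowr (Z1 / (n * a)) + I g Z2 epowr (Z2 / (n * a))) = ennreal M"
    by (auto simp: less_top_ennreal)
  then show "\<exists>M. \<forall>x. wpot a b (weighted \<sigma> g) x \<le> ennreal M"
    using bd[of g] by (intro exI[of _ M]) auto
  define E where "E k = {y::'a. real k < norm y}" for k
  define gout where "gout k y = g y * indicator (E k) y" for k y
  define gin where "gin k y = g y * indicator (- E k) y" for k y
  have [measurable]: "E k \<in> sets borel" for k unfolding E_def by measurable
  have [measurable]: "(\<lambda>y. gout k y) \<in> borel_measurable borel" "(\<lambda>y. gin k y) \<in> borel_measurable borel" for k
    unfolding gout_def gin_def by measurable
  have ev: "AE y in lborel. \<forall>\<^sub>F k in sequentially. y \<notin> E k"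
  proof (rule AE_I2)
    fix y :: 'a
    obtain N where "norm y < real N" using reals_Archimedean2 by blast
    then show "\<forall>\<^sub>F k in sequentially. y \<notin> E k"
      unfolding E_def eventually_sequentially by (intro exI[of _ N]) auto
  qed
  have Ilim: "(\<lambda>k. I (gout k) Z) \<longlonglongrightarrow> 0" if Z: "(\<integral>\<^sup>+y. g y epowr (n / Z) \<partial>lborel) < top" for Z
  proof -
    have "I (gout k) Z = (\<integral>\<^sup>+y. g y epowr (n / Z) * indicator (E k) y \<partial>lborel)" for k
      unfolding I_def gout_def by (intro nn_integral_cong) (auto split: split_indicator)
    moreover have "(\<lambda>k. \<integral>\<^sup>+y. g y epowr (n / Z) * indicator (E k) y \<partial>lborel) \<longlonglongrightarrow> 0"
      by (rule nn_integral_tendsto_zero[OF _ _ Z ev]) measurable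
    ultimately show ?thesis by simp
  qed
  \<comment> \<open>A bound, uniform in x, for the contribution of the outer part, including the
    constant of \<open>wpot_add_le\<close>.\<close>
  define R where "R k = ennreal (2 powr (1 / a)) * (ennreal C * (I (gout k) Z1 epowr (Z1 / (n * a)) + I (gout k) Z2 epowr (Z2 / (n * a))))" for k
  have "(\<lambda>k. I (gout k) Z1 epowr (Z1 / (n * a)) + I (gout k) Z2 epowr (Z2 / (n * a))) \<longlonglongrightarrow> 0 + 0"
    by (intro tendsto_add epowr_tendsto_0 Ilim fin Zp)
  then have "R \<longlonglongrightarrow> ennreal (2 powr (1 / a)) * (ennreal C * (0 + 0))"
    unfolding R_def[abs_def] by (intro ennreal_tendsto_cmult) auto
  then have Rlim: "R \<longlonglongrightarrow> 0" by simp
  show "((\<lambda>x. wpot a b (weighted \<sigma> g) x) \<longlongrightarrow> 0) at_infinity"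
  proof (rule order_tendstoI)
    fix e :: ennreal assume "0 < e"
    obtain \<epsilon> where \<epsilon>: "0 < \<epsilon>" "ennreal (2 * \<epsilon>) < e"
    proof (cases e)
      case (real r)
      then show thesis using that[of "r / 4"] \<open>0 < e\<close> by (auto simp: ennreal_less_iff)
    next
      case top
      then show thesis using that[of 1] by simp
    qed
    have "0 < ennreal \<epsilon>" using \<epsilon> by simp
    then have "\<forall>\<^sub>F k in sequentially. R k < ennreal \<epsilon>" using Rlim by (rule order_tendstoD(2)[rotated])
    then obtain k where k: "R k < ennreal \<epsilon>" by (auto simp: eventually_sequentially)
    define N where "N = ennreal (2 powr (1 / a)) * (ennreal C * I (gin k) Z2 epowr (Z2 / (n * a)))"
    have "I (gin k) Z2 \<le> I g Z2"
      unfolding I_def gin_def using n Z by (intro nn_integral_mono epowr_mono) (auto split: split_indicator)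
    also have "\<dots> < top" using fin by (simp add: I_def)
    finally have N: "N < top" by (simp add: N_def ennreal_mult_less_top)
    have "filterlim (\<lambda>x::'a. norm x / 2) at_top at_infinity"
      using filterlim_tendsto_pos_mult_at_top[OF tendsto_const _ filterlim_norm_at_top, of "1 / 2"] by simp
    then have "((\<lambda>x::'a. (norm x / 2) powr (- s)) \<longlongrightarrow> 0) at_infinity"
      using s by (intro tendsto_neg_powr) auto
    then have "((\<lambda>x::'a. N * ennreal ((norm x / 2) powr (- s))) \<longlongrightarrow> N * ennreal 0) at_infinity"
      by (intro ennreal_tendsto_cmult N tendsto_ennrealI)
    then have "((\<lambda>x::'a. N * ennreal ((norm x / 2) powr (- s))) \<longlongrightarrow> 0) at_infinity" by simp
    then have "\<forall>\<^sub>F x::'a in at_infinity. N * ennreal ((norm x / 2) powr (- s)) < ennreal \<epsilon>"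
      using \<open>0 < ennreal \<epsilon>\<close> by (rule order_tendstoD)
    \<comment> \<open>Points within |x| / 2 of x then have norm above |x| / 2 > k, where the inner
      part vanishes; the summand 1 also keeps x away from the origin.\<close>
    moreover have "\<forall>\<^sub>F x::'a in at_infinity. 2 * real k + 1 \<le> norm x"
      unfolding eventually_at_infinity by auto
    ultimately show "\<forall>\<^sub>F x in at_infinity. wpot a b (weighted \<sigma> g) x < e"
    proof eventually_elim
      case (elim x)
      have split: "weighted \<sigma> g = (\<lambda>y. weighted \<sigma> (gin k) y + weighted \<sigma> (gout k) y)"
        by (auto simp: fun_eq_iff gin_def gout_def split: split_indicator)
      have zero: "\<forall>y\<in>ball x (norm x / 2). gin k y = 0"
      proof
        fix y assume "y \<in> ball x (norm x / 2)"
        then have "norm x - norm y < norm x / 2"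
          using norm_triangle_ineq2[of x y] by (simp add: dist_norm)
        then have "real k < norm y" using elim(2) by simp
        then show "gin k y = 0" by (simp add: gin_def E_def)
      qed
      have x: "0 < norm x / 2" using elim(2) by linarith
      have "wpot a b (weighted \<sigma> g) x \<le> ennreal (2 powr (1 / a)) * (wpot a b (weighted \<sigma> (gin k)) x + wpot a b (weighted \<sigma> (gout k)) x)"
        unfolding split using a by (intro wpot_add_le) auto
      also have "\<dots> = ennreal (2 powr (1 / a)) * wpot a b (weighted \<sigma> (gin k)) x + ennreal (2 powr (1 / a)) * wpot a b (weighted \<sigma> (gout k)) x"
        by (rule distrib_left)
      also have "\<dots> \<le> N * ennreal ((norm x / 2) powr (- s)) + R k"
        unfolding N_def R_def mult.assoc
        by (intro add_mono mult_left_mono order_trans[OF far[OF _ x zero]] bd) (auto simp: mult.assoc)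
      also have "\<dots> \<le> ennreal \<epsilon> + ennreal \<epsilon>"
        using elim(1) k by (intro add_mono) auto
      also have "\<dots> = ennreal (2 * \<epsilon>)" using \<epsilon> by (simp flip: ennreal_plus)
      finally show ?case using \<epsilon> by simp
    qed
  qed simp
qed

section \<open>Integrable solutions\<close>

text \<open>Lifting covers the part of the line X - Y = X0 - Y0 on which both parameters are
  positive and below b / a. The remaining exponents of U, and then those of V, follow from one more
  application of the potential estimate to what is already known of the other function.\<close>

lemma wolff_system_integrability:
  fixes a b C \<sigma>1 \<sigma>2 p q X0 Y0 :: real and U V :: "'a::euclidean_space \<Rightarrow> ennreal"
  defines "n \<equiv> real DIM('a)"
  assumes a: "0 < a" "a < p" "a < q" and C: "0 < C"
    and \<sigma>: "\<sigma>1 \<le> 0" "\<sigma>2 \<le> 0" "b < n + \<sigma>1" "b < n + \<sigma>2"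
    and pos: "0 < Y0" "Y0 \<le> X0" and crit: "a * (X0 + Y0) \<le> b"
    and rel: "a * X0 = q * Y0 - (n + \<sigma>1 - b)" "a * Y0 = p * X0 - (n + \<sigma>2 - b)"
    and [measurable]: "U \<in> borel_measurable borel" "V \<in> borel_measurable borel"
    and U: "AE x in lborel. U x \<le> ennreal C * wpot a b (weighted \<sigma>1 (\<lambda>y. V y epowr q)) x"
    and V: "AE x in lborel. V x \<le> ennreal C * wpot a b (weighted \<sigma>2 (\<lambda>y. U y epowr p)) x"
    and fin: "(\<integral>\<^sup>+x. U x epowr (n / X0) \<partial>lborel) < top" "(\<integral>\<^sup>+x. V x epowr (n / Y0) \<partial>lborel) < top"
  shows "\<And>X. 0 < X \<Longrightarrow> a * X < b \<Longrightarrow> (\<integral>\<^sup>+x. U x epowr (n / X) \<partial>lborel) < top"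
    and "\<And>Y. 0 < Y \<Longrightarrow> a * Y < b \<Longrightarrow> a * (a * Y + (n + \<sigma>2 - b)) < p * b \<Longrightarrow> (\<integral>\<^sup>+x. V x epowr (n / Y) \<partial>lborel) < top"
proof -
  define d where "d = X0 - Y0"
  have n: "0 < n" by (simp add: n_def)
  have X0: "0 < X0" and d: "0 \<le> d" using pos by (auto simp: d_def)
  have aX0: "0 < a * X0" "0 < a * Y0" using a X0 pos by auto
  have sum: "a * X0 + a * Y0 \<le> b" using crit by (simp add: distrib_left)
  have lt0: "a * X0 < b" "a * Y0 < b" using sum aX0 by linarith+
  have ad: "a * d = a * X0 - a * Y0" "0 \<le> a * d" using a d by (auto simp: d_def right_diff_distrib)
  \<comment> \<open>The partner X - d must be positive. For V below, the partner Y + d must satisfy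
    a (Y + d) < b, and the same lemma is used with the two equations interchanged.\<close>
  have U_high: "(\<integral>\<^sup>+x. U x epowr (n / X) \<partial>lborel) < top" if X: "d < X" "a * X < b" for X
  proof -
    have Y: "0 < X - d" "a * (X - d) < b" "X - (X - d) = X0 - Y0" "0 < X"
      using X ad d by (auto simp: right_diff_distrib d_def)
    show ?thesis
      by (rule wolff_system_lifting[where 'a = 'a, folded n_def, OF a C \<sigma> X0 pos(1) Y(4,1) lt0 X(2) Y(2) rel Y(3) _ _ U V fin])
        measurable
  qed
  have V_low: "(\<integral>\<^sup>+x. V x epowr (n / Y) \<partial>lborel) < top" if Y: "0 < Y" "a * (Y + d) < b" for Y
  proof -
    have X: "a * Y < b" "0 < Y + d" "Y - (Y + d) = Y0 - X0"
      using Y ad d by (auto simp: distrib_left d_def)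
    show ?thesis
      by (rule wolff_system_lifting[where 'a = 'a, folded n_def, OF a(1,3,2) C \<sigma>(2,1,4,3) pos(1) X0 Y(1) X(2) lt0(2,1) X(1) Y(2)
          rel(2,1) X(3) _ _ V U fin(2,1)]) measurable
  qed
  have U_fin: "(\<integral>\<^sup>+x. U x epowr r \<partial>lborel) < top"
    if "(\<integral>\<^sup>+x. wpot a b (weighted \<sigma>1 (\<lambda>y. V y epowr q)) x epowr r \<partial>lborel) < top" "0 < r" for r
  proof -
    have "(\<integral>\<^sup>+x. U x epowr r \<partial>lborel) \<le> (\<integral>\<^sup>+x. (ennreal C * wpot a b (weighted \<sigma>1 (\<lambda>y. V y epowr q)) x) epowr r \<partial>lborel)"
      using U by (intro nn_integral_mono_AE, eventually_elim) (intro epowr_mono that)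
    also have "\<dots> = ennreal C epowr r * (\<integral>\<^sup>+x. wpot a b (weighted \<sigma>1 (\<lambda>y. V y epowr q)) x epowr r \<partial>lborel)"
      using that by (simp add: epowr_mult nn_integral_cmult)
    also have "\<dots> < top" using that by (simp add: ennreal_mult_less_top)
    finally show ?thesis .
  qed
  have V_fin: "(\<integral>\<^sup>+x. V x epowr r \<partial>lborel) < top"
    if "(\<integral>\<^sup>+x. wpot a b (weighted \<sigma>2 (\<lambda>y. U y epowr p)) x epowr r \<partial>lborel) < top" "0 < r" for r
  proof -
    have "(\<integral>\<^sup>+x. V x epowr r \<partial>lborel) \<le> (\<integral>\<^sup>+x. (ennreal C * wpot a b (weighted \<sigma>2 (\<lambda>y. U y epowr p)) x) epowr r \<partial>lborel)"
      using V by (intro nn_integral_mono_AE, eventually_elim) (intro epowr_mono that)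
    also have "\<dots> = ennreal C epowr r * (\<integral>\<^sup>+x. wpot a b (weighted \<sigma>2 (\<lambda>y. U y epowr p)) x epowr r \<partial>lborel)"
      using that by (simp add: epowr_mult nn_integral_cmult)
    also have "\<dots> < top" using that by (simp add: ennreal_mult_less_top)
    finally show ?thesis .
  qed
  show U_all: "(\<integral>\<^sup>+x. U x epowr (n / X) \<partial>lborel) < top" if X: "0 < X" "a * X < b" for X
  proof (cases "d < X")
    case False
    \<comment> \<open>Since a X <= a d < a X0, this Z stays below q Y0, so V is needed only at Z / q
      < Y0, which \<open>V_low\<close> covers.\<close>
    define Z where "Z = n + \<sigma>1 - b + a * X"
    have aX: "0 < a * X" "a * X \<le> a * d" using X a False by auto
    have Z: "0 < Z" "Z < q * Y0" using \<sigma> aX aX0 ad rel by (auto simp: Z_def)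
    then have Y: "0 < Z / q" "Z / q < Y0" using a by (auto simp: field_simps)
    have "a * (Z / q + d) < a * (Y0 + d)" using Y a by simp
    also have "a * (Y0 + d) = a * X0" by (simp add: d_def)
    finally have "a * (Z / q + d) < b" using lt0 by simp
    from V_low[OF Y(1) this] have "(\<integral>\<^sup>+x. V x epowr (q * (real DIM('a) / Z)) \<partial>lborel) < top"
      using a by (simp add: n_def mult.commute)
    then have "(\<integral>\<^sup>+x. wpot a b (weighted \<sigma>1 (\<lambda>y. V y epowr q)) x epowr (real DIM('a) / X) \<partial>lborel) < top"
      using a \<sigma> X by (intro wpot_weighted_finite) (auto simp: Z_def n_def)
    then show ?thesis using X n by (intro U_fin) (auto simp: n_def)
  qed (use U_high X in auto)
  show "(\<integral>\<^sup>+x. V x epowr (n / Y) \<partial>lborel) < top"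
    if Y: "0 < Y" "a * Y < b" "a * (a * Y + (n + \<sigma>2 - b)) < p * b" for Y
  proof -
    define Z where "Z = n + \<sigma>2 - b + a * Y"
    have aY: "0 < a * Y" using Y a by auto
    have Z: "0 < Z" using \<sigma> aY by (auto simp: Z_def)
    have "a * Z < p * b" using Y by (simp add: Z_def add.commute)
    \<comment> \<open>The third condition on Y says exactly that the exponent Z / p required of U is
      admissible.\<close>
    then have X: "0 < Z / p" "a * (Z / p) < b" using Z a by (auto simp: field_simps)
    from U_all[OF X] have "(\<integral>\<^sup>+x. U x epowr (p * (real DIM('a) / Z)) \<partial>lborel) < top"
      using a by (simp add: n_def mult.commute)
    then have "(\<integral>\<^sup>+x. wpot a b (weighted \<sigma>2 (\<lambda>y. U y epowr p)) x epowr (real DIM('a) / Y) \<partial>lborel) < top"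
      using a \<sigma> Y by (intro wpot_weighted_finite) (auto simp: Z_def n_def)
    then show ?thesis using Y n by (intro V_fin) (auto simp: n_def)
  qed
qed

section \<open>Transfer to the statement in terms of real functions\<close>

lemma in_LspaceI_nn_integral:
  fixes u :: "'a::euclidean_space \<Rightarrow> real"
  assumes [measurable]: "u \<in> borel_measurable lebesgue" and "\<And>x. 0 < u x"
    and "(\<integral>\<^sup>+x. ennreal (u x) epowr r \<partial>lborel) < top"
  shows "in_Lspace (ereal r) u"
  unfolding in_Lspace_def
proof (intro conjI, fact, simp, rule integrableI_bounded)
  have "(\<integral>\<^sup>+x. ennreal (norm (\<bar>u x\<bar> powr r)) \<partial>lebesgue) = (\<integral>\<^sup>+x. ennreal (u x) epowr r \<partial>lborel)"
    using assms(2) by (simp add: nn_integral_completion epowr_ennreal less_imp_le)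
  then show "(\<integral>\<^sup>+x. ennreal (norm (\<bar>u x\<bar> powr r)) \<partial>lebesgue) < \<infinity>" using assms(3) by simp
qed simp

lemma in_LspaceD_nn_integral:
  fixes u :: "'a::euclidean_space \<Rightarrow> real"
  assumes "in_Lspace (ereal r) u" and "\<And>x. 0 < u x"
  shows "(\<integral>\<^sup>+x. ennreal (u x) epowr r \<partial>lborel) < top"
proof -
  have "integrable lebesgue (\<lambda>x. \<bar>u x\<bar> powr r)" using assms(1) by (simp add: in_Lspace_def)
  then have "(\<integral>\<^sup>+x. ennreal (norm (\<bar>u x\<bar> powr r)) \<partial>lebesgue) < \<infinity>" by (simp add: integrable_iff_bounded)
  then show ?thesis using assms(2) by (simp add: nn_integral_completion epowr_ennreal less_imp_le)
qed

text \<open>X and Y are the scaling exponents: the solution by Cramer's rule of the linear system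
  formed by the first two conclusions, with determinant p q - a^2 > 0.\<close>

lemma wolff_exponents:
  fixes a \<alpha> \<sigma>1 \<sigma>2 p q n :: real
  defines "X \<equiv> (\<alpha> * (a + q) + a * \<sigma>1 + \<sigma>2 * q) / (p * q - a\<^sup>2)"
    and "Y \<equiv> (\<alpha> * (a + p) + a * \<sigma>2 + \<sigma>1 * p) / (p * q - a\<^sup>2)"
  assumes a: "0 < a" "a \<le> 1" and pq: "1 < p" "p \<le> q" and \<sigma>: "- \<alpha> < \<sigma>1" "\<sigma>1 \<le> \<sigma>2" "\<sigma>2 \<le> 0"
    and crit: "(n + \<sigma>1) / (a + q) + (n + \<sigma>2) / (a + p) \<le> (n - \<alpha>) / a"
  shows "a * X = q * Y - (\<alpha> + \<sigma>1)" "a * Y = p * X - (\<alpha> + \<sigma>2)" "0 < Y" "Y \<le> X" "a * (X + Y) \<le> n - \<alpha>"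
proof -
  define d where "d = p * q - a\<^sup>2"
  have "a * a < p * q" using a pq by (intro mult_strict_mono) auto
  then have d: "0 < d" by (simp add: d_def power2_eq_square)
  have X: "X * d = \<alpha> * (a + q) + a * \<sigma>1 + \<sigma>2 * q" and Y: "Y * d = \<alpha> * (a + p) + a * \<sigma>2 + \<sigma>1 * p"
    using d by (simp_all add: X_def Y_def flip: d_def)
  have "(a * X) * d = (q * Y - (\<alpha> + \<sigma>1)) * d"
  proof -
    have "(a * X) * d = a * (X * d)" "(q * Y - (\<alpha> + \<sigma>1)) * d = q * (Y * d) - (\<alpha> + \<sigma>1) * d" by (simp_all add: algebra_simps)
    then show ?thesis unfolding X Y by (simp add: d_def algebra_simps power2_eq_square)
  qed
  then show 1: "a * X = q * Y - (\<alpha> + \<sigma>1)" using d by simp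
  have "(a * Y) * d = (p * X - (\<alpha> + \<sigma>2)) * d"
  proof -
    have "(a * Y) * d = a * (Y * d)" "(p * X - (\<alpha> + \<sigma>2)) * d = p * (X * d) - (\<alpha> + \<sigma>2) * d" by (simp_all add: algebra_simps)
    then show ?thesis unfolding X Y by (simp add: d_def algebra_simps power2_eq_square)
  qed
  then show 2: "a * Y = p * X - (\<alpha> + \<sigma>2)" using d by simp
  have \<alpha>: "0 < \<alpha> + \<sigma>1" "0 < \<alpha> + \<sigma>2" using \<sigma> by linarith+
  have "Y * d = a * (\<alpha> + \<sigma>2) + p * (\<alpha> + \<sigma>1)" unfolding Y by (simp add: algebra_simps)
  moreover have "0 < a * (\<alpha> + \<sigma>2) + p * (\<alpha> + \<sigma>1)" using mult_pos_pos[OF a(1) \<alpha>(2)] mult_pos_pos[of p, OF _ \<alpha>(1)] pq by simp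
  ultimately have "0 < Y * d" by simp
  then show Y0: "0 < Y" using d by (simp add: zero_less_mult_iff)
  \<comment> \<open>Written so that every factor has a sign: q >= p, \<sigma>2 >= \<sigma>1 and p >
    1 >= a.\<close>
  have "X * d - Y * d = (\<alpha> + \<sigma>2) * (q - p) + (\<sigma>2 - \<sigma>1) * (p - a)" unfolding X Y by (simp add: algebra_simps)
  moreover have "0 \<le> (\<alpha> + \<sigma>2) * (q - p) + (\<sigma>2 - \<sigma>1) * (p - a)"
    using mult_nonneg_nonneg[of "\<alpha> + \<sigma>2" "q - p"] mult_nonneg_nonneg[of "\<sigma>2 - \<sigma>1" "p - a"] a pq \<sigma> \<alpha> by simp
  ultimately have "Y * d \<le> X * d" by simp
  then show XY: "Y \<le> X" using d by simp
  \<comment> \<open>The slack in the claim, divided by a. By the linear system the hypothesis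
    becomes 0 <= D (1 - a/(a+q) - a/(a+p)), whose last factor is the determinant over (a+q)(a+p),
    hence positive.\<close>
  define D where "D = (n - \<alpha>) / a - X - Y"
  have "n - \<alpha> = a * (D + X + Y)" using a by (simp add: D_def field_simps)
  then have n1: "n + \<sigma>1 = a * D + (a + q) * Y" and n2: "n + \<sigma>2 = a * D + (a + p) * X"
    using 1 2 by (simp_all add: algebra_simps)
  have "(n + \<sigma>1) / (a + q) = a * D / (a + q) + Y" "(n + \<sigma>2) / (a + p) = a * D / (a + p) + X"
    unfolding n1 n2 using a pq by (simp_all add: add_divide_distrib)
  with crit have "0 \<le> D - a * D / (a + q) - a * D / (a + p)" by (simp add: D_def)
  also have "\<dots> = D * (d / ((a + q) * (a + p)))"
    using a pq by (simp add: d_def field_simps power2_eq_square)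
  finally have "0 \<le> D * (d / ((a + q) * (a + p)))" .
  moreover have "0 < d / ((a + q) * (a + p))" using d a pq by simp
  ultimately have "0 \<le> D" by (metis linorder_not_less mult_neg_pos)
  then show "a * (X + Y) \<le> n - \<alpha>" using \<open>n - \<alpha> = a * (D + X + Y)\<close> a by (simp add: algebra_simps)
qed

text \<open>The potential sees its density only up to null sets, so v may be replaced by a Borel
  representative while the bound on u still holds at every point, as the limit at infinity
  requires.\<close>

lemma wolff_solution_upper_bound:
  fixes u v :: "real ^ 'n \<Rightarrow> real" and V :: "real ^ 'n \<Rightarrow> ennreal"
  assumes eq: "\<And>x. ennreal (u x) = ennreal (c x) * wolff \<beta> \<gamma> (\<lambda>y. norm y powr \<sigma> * v y powr q) x"
    and c: "\<And>x. c x \<le> C" and v: "\<And>x. 0 < v x" "AE y in lborel. ennreal (v y) = V y"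
  shows "ennreal (u x) \<le> ennreal C * wpot (\<gamma> - 1) (real CARD('n) - \<beta> * \<gamma>) (weighted \<sigma> (\<lambda>y. V y epowr q)) x"
proof -
  have "AE y in lborel. ennreal (norm y powr \<sigma> * v y powr q) = weighted \<sigma> (\<lambda>y. V y epowr q) y"
    using v(2) by eventually_elim (metis ennreal_mult epowr_ennreal less_imp_le powr_ge_zero v(1))
  then have "wolff \<beta> \<gamma> (\<lambda>y. norm y powr \<sigma> * v y powr q) x
      = wpot (\<gamma> - 1) (real CARD('n) - \<beta> * \<gamma>) (weighted \<sigma> (\<lambda>y. V y epowr q)) x"
    unfolding wolff_eq_wpot by (subst wpot_cong_AE) auto
  then show ?thesis unfolding eq using c[of x] by (auto intro!: mult_right_mono ennreal_leI)
qed

lemma tendsto_0_real_if_le_ennreal: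
  assumes le: "\<And>x. ennreal (u x) \<le> ennreal C * g x" and g: "(g \<longlongrightarrow> 0) F" and u: "\<And>x. 0 < u x"
  shows "(u \<longlongrightarrow> 0) F"
proof -
  have "((\<lambda>x. ennreal C * g x) \<longlongrightarrow> ennreal C * 0) F" by (intro ennreal_tendsto_cmult g) simp
  then have "((\<lambda>x. ennreal (u x)) \<longlongrightarrow> 0) F"
    using le by (intro tendsto_sandwich[of "\<lambda>_. 0" "\<lambda>x. ennreal (u x)" F "\<lambda>x. ennreal C * g x"]) auto
  then have "((\<lambda>x. ennreal (u x)) \<longlongrightarrow> ennreal 0) F" by simp
  then show ?thesis using u by (subst (asm) tendsto_ennreal_iff) (auto simp: less_imp_le)
qed

lemma in_Lspace_infinityI:
  fixes u :: "'a::euclidean_space \<Rightarrow> real"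
  assumes "u \<in> borel_measurable lebesgue" "\<And>x. 0 < u x" and le: "\<And>x. ennreal (u x) \<le> ennreal C * g x"
    and "\<exists>M. \<forall>x. g x \<le> ennreal M"
  shows "in_Lspace \<infinity> u"
proof -
  obtain M where M: "\<And>x. g x \<le> ennreal M" using assms(4) by blast
  have "ennreal (u x) \<le> ennreal (max 0 C * max 0 M)" for x
  proof -
    have "ennreal (u x) \<le> ennreal (max 0 C) * ennreal (max 0 M)"
      by (rule order_trans[OF le]) (intro mult_mono order_trans[OF M] ennreal_leI, auto)
    then show ?thesis by (simp add: ennreal_mult)
  qed
  then have "u x \<le> max 0 C * max 0 M" for x
    by (subst (asm) ennreal_le_iff) auto
  then show ?thesis using assms(1,2) by (auto simp: in_Lspace_def less_imp_le intro!: exI[of _ "max 0 C * max 0 M"])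
qed

lemma double_bounded_pos_bound:
  assumes "double_bounded c"
  obtains C where "0 < C" "\<And>x. c x \<le> C"
  using assms by (auto simp: double_bounded_def)

theorem theorem2:
  fixes \<beta> \<gamma> \<sigma>\<^sub>1 \<sigma>\<^sub>2 p q :: real
    and c\<^sub>1 c\<^sub>2 u v :: "real ^ 'n \<Rightarrow> real"
  defines "n \<equiv> real CARD('n)"
  assumes "CARD('n) \<ge> 3"
    and "1 < \<gamma>" and "\<gamma> \<le> 2"
    and "0 < \<beta>" and "\<beta> * \<gamma> < n"
    and "1 < p" and "p \<le> q"
    and "- (\<beta> * \<gamma>) < \<sigma>\<^sub>1" and "\<sigma>\<^sub>1 \<le> \<sigma>\<^sub>2" and "\<sigma>\<^sub>2 \<le> 0"
    and "double_bounded c\<^sub>1" and "double_bounded c\<^sub>2"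
    and "(n + \<sigma>\<^sub>1) / (\<gamma> - 1 + q) + (n + \<sigma>\<^sub>2) / (\<gamma> - 1 + p) \<le> (n - \<beta> * \<gamma>) / (\<gamma> - 1)"
    and "integrable_solution \<beta> \<gamma> \<sigma>\<^sub>1 \<sigma>\<^sub>2 p q c\<^sub>1 c\<^sub>2 u v"
  shows "(\<forall>r s :: ereal.
            ereal (n * (\<gamma> - 1) / (n - \<beta> * \<gamma>)) < r \<and>
            ereal (max (n * (\<gamma> - 1) / (n - \<beta> * \<gamma>))
                       (n * (\<gamma> - 1) / (p * ((n - \<beta> * \<gamma>) / (\<gamma> - 1)) - (\<beta> * \<gamma> + \<sigma>\<^sub>2)))) < s
            \<longrightarrow> in_Lspace r u \<and> in_Lspace s v)
         \<and> (u \<longlongrightarrow> 0) at_infinity \<and> (v \<longlongrightarrow> 0) at_infinity"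
proof -
  define a where "a = \<gamma> - 1"
  define \<alpha> where "\<alpha> = \<beta> * \<gamma>"
  define b where "b = n - \<alpha>"
  define X0 where "X0 = q0 \<beta> \<gamma> \<sigma>\<^sub>1 \<sigma>\<^sub>2 p q"
  define Y0 where "Y0 = p0 \<beta> \<gamma> \<sigma>\<^sub>1 \<sigma>\<^sub>2 p q"
  have a: "0 < a" "a \<le> 1" "a < p" "a < q" using assms by (auto simp: a_def)
  have b: "0 < b" "b < n + \<sigma>\<^sub>1" "b < n + \<sigma>\<^sub>2" and \<sigma>: "- \<alpha> < \<sigma>\<^sub>1"
    using assms by (auto simp: b_def \<alpha>_def)
  have n: "0 < n" "n = real DIM(real ^ 'n)" by (auto simp: n_def)
  have crit: "(n + \<sigma>\<^sub>1) / (a + q) + (n + \<sigma>\<^sub>2) / (a + p) \<le> (n - \<alpha>) / a"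
    using assms by (simp add: a_def \<alpha>_def)
  have XY: "X0 = (\<alpha> * (a + q) + a * \<sigma>\<^sub>1 + \<sigma>\<^sub>2 * q) / (p * q - a\<^sup>2)"
      "Y0 = (\<alpha> * (a + p) + a * \<sigma>\<^sub>2 + \<sigma>\<^sub>1 * p) / (p * q - a\<^sup>2)"
    by (simp_all add: X0_def Y0_def q0_def p0_def a_def \<alpha>_def)
  have "1 < p" "p \<le> q" "\<sigma>\<^sub>1 \<le> \<sigma>\<^sub>2" "\<sigma>\<^sub>2 \<le> 0" "\<sigma>\<^sub>1 \<le> 0" using assms by auto
  note exps = wolff_exponents[OF a(1,2) this(1,2) \<sigma> this(3,4) crit, folded XY]
  have rel: "a * X0 = q * Y0 - (n + \<sigma>\<^sub>1 - b)" "a * Y0 = p * X0 - (n + \<sigma>\<^sub>2 - b)"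
    using exps by (auto simp: b_def)
  have crit': "a * (X0 + Y0) \<le> b" using exps by (simp add: b_def)
  have pos: "0 < Y0" "Y0 \<le> X0" "0 < X0" using exps by auto
  have aXY: "0 < a * X0" "0 < a * Y0" using a pos by auto
  have lt: "a * X0 < b" "a * Y0 < b" using crit' aXY by (auto simp: distrib_left)
  have "integrable_solution \<beta> \<gamma> \<sigma>\<^sub>1 \<sigma>\<^sub>2 p q c\<^sub>1 c\<^sub>2 u v" by fact
  then have meas [measurable]: "u \<in> borel_measurable lebesgue" "v \<in> borel_measurable lebesgue"
    and up: "\<And>x. 0 < u x" and vp: "\<And>x. 0 < v x"
    and u_eq: "\<And>x. ennreal (u x) = ennreal (c\<^sub>1 x) * wolff \<beta> \<gamma> (\<lambda>y. norm y powr \<sigma>\<^sub>1 * v y powr q) x"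
    and v_eq: "\<And>x. ennreal (v x) = ennreal (c\<^sub>2 x) * wolff \<beta> \<gamma> (\<lambda>y. norm y powr \<sigma>\<^sub>2 * u y powr p) x"
    and uL: "in_Lspace (ereal (n / X0)) u" and vL: "in_Lspace (ereal (n / Y0)) v"
    by (auto simp: integrable_solution_def positive_solution_def n_def X0_def Y0_def)
  \<comment> \<open>The solutions are Lebesgue measurable, whereas the theory above is stated for
    Borel functions.\<close>
  obtain U where [measurable]: "U \<in> borel_measurable borel" and U: "AE x in lborel. ennreal (u x) = U x"
    using completion_ex_borel_measurable[of "\<lambda>x. ennreal (u x)" lborel] by auto
  obtain V where [measurable]: "V \<in> borel_measurable borel" and V: "AE x in lborel. ennreal (v x) = V x"
    using completion_ex_borel_measurable[of "\<lambda>x. ennreal (v x)" lborel] by auto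
  have U_int: "(\<integral>\<^sup>+x. U x epowr r \<partial>lborel) = (\<integral>\<^sup>+x. ennreal (u x) epowr r \<partial>lborel)" for r
    using U by (intro nn_integral_cong_AE) auto
  have V_int: "(\<integral>\<^sup>+x. V x epowr r \<partial>lborel) = (\<integral>\<^sup>+x. ennreal (v x) epowr r \<partial>lborel)" for r
    using V by (intro nn_integral_cong_AE) auto
  obtain C1 where C1: "0 < C1" "\<And>x. c\<^sub>1 x \<le> C1" using \<open>double_bounded c\<^sub>1\<close> by (rule double_bounded_pos_bound) (rule that)
  obtain C2 where C2: "0 < C2" "\<And>x. c\<^sub>2 x \<le> C2" using \<open>double_bounded c\<^sub>2\<close> by (rule double_bounded_pos_bound) (rule that)
  define C where "C = max C1 C2"
  have C: "0 < C" "\<And>x. c\<^sub>1 x \<le> C" "\<And>x. c\<^sub>2 x \<le> C"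
    using C1 C2 by (auto simp: C_def less_max_iff_disj le_max_iff_disj)
  have ab: "\<gamma> - 1 = a" "real CARD('n) - \<beta> * \<gamma> = b" by (auto simp: a_def b_def n_def \<alpha>_def)
  have u_le: "ennreal (u x) \<le> ennreal C * wpot a b (weighted \<sigma>\<^sub>1 (\<lambda>y. V y epowr q)) x" for x
    by (rule wolff_solution_upper_bound[OF u_eq C(2) vp V, unfolded ab])
  have v_le: "ennreal (v x) \<le> ennreal C * wpot a b (weighted \<sigma>\<^sub>2 (\<lambda>y. U y epowr p)) x" for x
    by (rule wolff_solution_upper_bound[OF v_eq C(3) up U, unfolded ab])
  have U_le: "AE x in lborel. U x \<le> ennreal C * wpot a b (weighted \<sigma>\<^sub>1 (\<lambda>y. V y epowr q)) x"
    using U by eventually_elim (metis u_le)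
  have V_le: "AE x in lborel. V x \<le> ennreal C * wpot a b (weighted \<sigma>\<^sub>2 (\<lambda>y. U y epowr p)) x"
    using V by eventually_elim (metis v_le)
  have fin0: "(\<integral>\<^sup>+x. U x epowr (n / X0) \<partial>lborel) < top" "(\<integral>\<^sup>+x. V x epowr (n / Y0) \<partial>lborel) < top"
    unfolding U_int V_int by (intro in_LspaceD_nn_integral uL vL up vp)+
  note integ = wolff_system_integrability[where 'a = "real ^ 'n", folded n(2),
      OF a(1,3,4) C(1) \<open>\<sigma>\<^sub>1 \<le> 0\<close> \<open>\<sigma>\<^sub>2 \<le> 0\<close> b(2,3) pos(1,2) crit' rel _ _ U_le V_le fin0]
  have U_fin: "(\<integral>\<^sup>+x. U x epowr (n / X) \<partial>lborel) < top" if "0 < X" "a * X < b" for X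
    using that by (intro integ(1)) auto
  have V_fin: "(\<integral>\<^sup>+x. V x epowr (n / Y) \<partial>lborel) < top"
    if "0 < Y" "a * Y < b" "a * (a * Y + (n + \<sigma>\<^sub>2 - b)) < p * b" for Y
    using that by (intro integ(2)) auto
  have pb: "a * (p * X0) < p * b" using mult_strict_left_mono[OF lt(1), of p] a by (simp add: mult_ac)
  \<comment> \<open>For Y <= Y0 the extra condition is automatic: a Y + (n + \<sigma> - b) <= p X0
    with \<sigma> the second weight exponent, and a X0 < b.\<close>
  have V_small: "(\<integral>\<^sup>+x. V x epowr (n / Y) \<partial>lborel) < top" if "0 < Y" "Y \<le> Y0" for Y
  proof (rule V_fin)
    have "a * Y \<le> a * Y0" using that a by simp
    then show "a * Y < b" using lt by simp
    have "a * Y + (n + \<sigma>\<^sub>2 - b) \<le> p * X0" using \<open>a * Y \<le> a * Y0\<close> rel by simp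
    then have "a * (a * Y + (n + \<sigma>\<^sub>2 - b)) \<le> a * (p * X0)" using a by (intro mult_left_mono) auto
    then show "a * (a * Y + (n + \<sigma>\<^sub>2 - b)) < p * b" using pb by simp
  qed fact
  \<comment> \<open>The critical parameters for the densities V^q and U^p. Since q Y0 = A1 + a X0
    and 0 < a X0 < b, the choices A1 / 2 and q Y0 lie on either side of A1, the latter still in the
    admissible range; likewise A2 / 2 and p X0.\<close>
  define A1 where "A1 = n + \<sigma>\<^sub>1 - b"
  define A2 where "A2 = n + \<sigma>\<^sub>2 - b"
  have A: "0 < A1" "0 < A2" "A1 < q * Y0" "A2 < p * X0" using b rel aXY by (auto simp: A1_def A2_def)
  have Z: "q * Y0 < n + \<sigma>\<^sub>1" "p * X0 < n + \<sigma>\<^sub>2" using rel lt by auto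
  have V1: "(\<integral>\<^sup>+y. (V y epowr q) epowr (n / Z) \<partial>lborel) < top" if "0 < Z" "Z \<le> q * Y0" for Z
    using V_small[of "Z / q"] that a by (simp add: epowr_epowr field_simps)
  have U1: "(\<integral>\<^sup>+y. (U y epowr p) epowr (n / Z) \<partial>lborel) < top" if "0 < Z" "Z \<le> p * X0" for Z
  proof -
    have "a * (Z / p) \<le> a * X0" using that a by (intro mult_left_mono) (auto simp: field_simps)
    then have "a * (Z / p) < b" using lt by simp
    from U_fin[OF _ this] show ?thesis using that a by (simp add: epowr_epowr mult.commute)
  qed
  note potential = wpot_weighted_bounded_and_vanishing[where 'a = "real ^ 'n", folded n(2)]
  have Z1: "0 < A1 / 2" "A1 / 2 < A1" "A1 < q * Y0" "A1 / 2 \<le> q * Y0" "0 < q * Y0"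
    using A(1,3) less_trans[OF A(1,3)] by auto
  have Z2: "0 < A2 / 2" "A2 / 2 < A2" "A2 < p * X0" "A2 / 2 \<le> p * X0" "0 < p * X0"
    using A(2,4) less_trans[OF A(2,4)] by auto
  have "(\<lambda>y. V y epowr q) \<in> borel_measurable borel" "(\<lambda>y. U y epowr p) \<in> borel_measurable borel" by measurable
  note W1 = potential[OF a(1) \<open>\<sigma>\<^sub>1 \<le> 0\<close> Z1(1-3)[unfolded A1_def] Z(1) this(1) V1[OF Z1(1,4), unfolded A1_def] V1[OF Z1(5) order_refl]]
    and W2 = potential[OF a(1) \<open>\<sigma>\<^sub>2 \<le> 0\<close> Z2(1-3)[unfolded A2_def] Z(2) this(2) U1[OF Z2(1,4), unfolded A2_def] U1[OF Z2(5) order_refl]]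
  have u_lim: "(u \<longlongrightarrow> 0) at_infinity" and v_lim: "(v \<longlongrightarrow> 0) at_infinity"
    by (rule tendsto_0_real_if_le_ennreal[OF u_le W1(2) up], rule tendsto_0_real_if_le_ennreal[OF v_le W2(2) vp])
  have u_inf: "in_Lspace \<infinity> u" by (rule in_Lspace_infinityI[OF meas(1) up u_le W1(1)])
  have v_inf: "in_Lspace \<infinity> v" by (rule in_Lspace_infinityI[OF meas(2) vp v_le W2(1)])
  have u_fin: "in_Lspace (ereal r) u" if r: "n * a / b < r" for r
  proof (rule in_LspaceI_nn_integral[OF meas(1) up])
    have "0 < n * a / b" using n a b by simp
    then have r0: "0 < r" using r by linarith
    then have "a * (n / r) < b" using r b by (simp add: field_simps)
    from U_fin[OF _ this] show "(\<integral>\<^sup>+x. ennreal (u x) epowr r \<partial>lborel) < top"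
      using r0 n by (simp add: U_int)
  qed
  have v_fin: "in_Lspace (ereal s) v" if s: "n * a / b < s" "n * a / (p * (b / a) - (\<alpha> + \<sigma>\<^sub>2)) < s" for s
  proof (rule in_LspaceI_nn_integral[OF meas(2) vp])
    have "0 < n * a / b" using n a b by simp
    then have s0: "0 < s" using s by linarith
    then have 1: "a * (n / s) < b" using s b by (simp add: field_simps)
    have "a * A2 < a * (p * X0)" using A a by simp
    also note pb
    \<comment> \<open>Hence the denominator in the second term of the maximum is positive, and the
      condition on s can be cleared of it.\<close>
    finally have "A2 < p * (b / a)" using a by (simp add: field_simps)
    moreover have A2: "\<alpha> + \<sigma>\<^sub>2 = A2" by (simp add: A2_def b_def)
    ultimately have "n * a < s * (p * (b / a) - A2)" using s(2) by (simp add: pos_divide_less_eq)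
    then have "a * (n / s) < p * (b / a) - A2" using s0 by (simp add: field_simps)
    then have "a * (a * (n / s) + A2) < a * (p * (b / a))" using a by (intro mult_strict_left_mono) auto
    then have "a * (a * (n / s) + (n + \<sigma>\<^sub>2 - b)) < p * b" using a by (simp add: A2_def)
    from V_fin[OF _ 1 this] show "(\<integral>\<^sup>+x. ennreal (v x) epowr s \<partial>lborel) < top"
      using s0 n by (simp add: V_int)
  qed
  \<comment> \<open>Finite exponents come from \<open>u_fin\<close> and \<open>v_fin\<close>, the
    infinite ones from boundedness.\<close>
  have "in_Lspace r u \<and> in_Lspace s v"
    if "ereal (n * a / b) < r" "ereal (max (n * a / b) (n * a / (p * (b / a) - (\<alpha> + \<sigma>\<^sub>2)))) < s" for r s
    using that u_fin v_fin u_inf v_inf by (cases r; cases s) auto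
  then show ?thesis using u_lim v_lim unfolding a_def b_def \<alpha>_def by blast
qed

end
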